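(* Let $\Omega\subset\mathbb{R}^3$ be a connected bounded open convex domain with a Lipschitz boundary. Let $\boldsymbol{\sigma}^*$ be a given uniform eigenstress (a constant real symmetric $3\times 3$ tensor) that has two identical eigenvalues $k_1$ and a distinct eigenvalue $k_3\neq k_1$, and let $\mathbf{C}$ be an isotropic elastic tensor with Lamé parameters $\lambda,\mu$. Use the Cartesian coordinate system $\mathbf{x}=(x_1,x_2,x_3)$ whose axes are along mutually orthogonal unit eigenvectors of $\boldsymbol{\sigma}^*$, the $x_1$- and $x_2$-axes corresponding to $k_1$ and the $x_3$-axis to $k_3$. Suppose that the uniformity relations hold for $(\boldsymbol{\sigma}^*,\mathbf{C})$, i.e. there exist quadratic functions $q_1(\mathbf{x}),q_2(\mathbf{x})$, a function $\varphi_1(x_3)$ of $x_3$ only, and a function $\varphi_2(x_1,x_2)$ of $x_1,x_2$ only, such that for all $\mathbf{x}\in\Omega$ $$\gamma N_\Omega(\mathbf{x})+\tilde N_\Omega(\mathbf{x})=q_1(\mathbf{x})+\varphi_1(x_3),\qquad \eta N_\Omega(\mathbf{x})+\tilde N_\Omega(\mathbf{x})=q_2(\mathbf{x})+\varphi_2(x_1,x_2).$$ Then there exist an ellipsoid $E\subset\Omega$ and a function $\varphi(x_1,x_2)$ depending only on the two coordinates $x_1,x_2$ such that $$N_\Omega(\mathbf{x})-N_E(\mathbf{x})=\varphi(x_1,x_2)\qquad\text{for all }\mathbf{x}\in E.$$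
   Context: An isotropic elastic tensor is $C_{ijkl}=\lambda\delta_{ij}\delta_{kl}+\mu(\delta_{ik}\delta_{jl}+\delta_{il}\delta_{jk})$ with real Lamé parameters satisfying $\mu>0$ and $3\lambda+2\mu>0$. For a bounded domain $D\subset\mathbb{R}^3$ (here $D=\Omega$ or $D=E$), in the coordinates of the claim, $$N_D(\mathbf{x})=-\frac{1}{4\pi}\int_D\frac{1}{|\mathbf{x}-\mathbf{y}|}\,d\mathbf{y}\quad\text{(Newtonian potential)},\qquad \tilde N_D(\mathbf{x})=-\frac{1}{4\pi}\int_D\frac{(x_3-y_3)^2}{|\mathbf{x}-\mathbf{y}|^3}\,d\mathbf{y}.$$ The constants are $$\gamma=\frac{k_3(\lambda+\mu)-k_1(\lambda+3\mu)}{(\lambda+\mu)(k_1-k_3)},\qquad \eta=\frac{k_1(\lambda+\mu)-k_3(\lambda+3\mu)}{(\lambda+\mu)(k_1-k_3)}.$$ "Quadratic function" means a real polynomial of degree at most $2$ in $\mathbf{x}$. "Ellipsoid" means a solid (open) nondegenerate ellipsoid of arbitrary center and orientation (balls included). The uniformity relations express that the uniform eigenstress $\boldsymbol{\sigma}^*$ prescribed in the inclusion $\Omega$, embedded in the infinite homogeneous medium with elastic tensor $\mathbf{C}$, induces a uniform strain in $\Omega$. *)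

theory Defs
  imports "HOL-Analysis.Analysis"
begin

definition orthonormal_frame :: "(3 \<Rightarrow> real ^ 3) \<Rightarrow> bool" where
  "orthonormal_frame e \<longleftrightarrow> (\<forall>i j. e i \<bullet> e j = of_bool (i = j))"

definition isotropic_elastic_tensor :: "real \<Rightarrow> real \<Rightarrow> real ^ 3 ^ 3 ^ 3 ^ 3 \<Rightarrow> bool" where
  "isotropic_elastic_tensor lam \<mu> C \<longleftrightarrow>
     \<mu> > 0 \<and> 3 * lam + 2 * \<mu> > 0 \<and>
     (\<forall>i j k l. C $ i $ j $ k $ l =
        lam * of_bool (i = j) * of_bool (k = l) +
        \<mu> * (of_bool (i = k) * of_bool (j = l) + of_bool (i = l) * of_bool (j = k)))"

(* Near each boundary point, D is the strict subgraph, in some unit direction n, of a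
   Lipschitz function g on the plane orthogonal to n. *)
definition lipschitz_boundary :: "(real ^ 3) set \<Rightarrow> bool" where
  "lipschitz_boundary D \<longleftrightarrow>
     (\<forall>p \<in> frontier D. \<exists>U n g L.
        open U \<and> p \<in> U \<and> norm n = 1 \<and>
        L-lipschitz_on {v. v \<bullet> n = 0} (g :: real ^ 3 \<Rightarrow> real) \<and>
        D \<inter> U = {x \<in> U. x \<bullet> n < g (x - (x \<bullet> n) *\<^sub>R n)})"

(* The integrands below take the value 0 at y = x because x / 0 = 0; this single point
   is a null set. *)
definition newtonian_potential :: "(real ^ 3) set \<Rightarrow> real ^ 3 \<Rightarrow> real" where
  "newtonian_potential D x = - (1 / (4 * pi)) * (LINT y:D|lborel. 1 / norm (x - y))"

(* The unit vector n is the direction of the x3-axis, so (x - y) \<bullet> n = x3 - y3. *)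
definition directional_potential :: "real ^ 3 \<Rightarrow> (real ^ 3) set \<Rightarrow> real ^ 3 \<Rightarrow> real" where
  "directional_potential n D x =
     - (1 / (4 * pi)) * (LINT y:D|lborel. ((x - y) \<bullet> n)\<^sup>2 / norm (x - y) ^ 3)"

definition gamma_coeff :: "real \<Rightarrow> real \<Rightarrow> real \<Rightarrow> real \<Rightarrow> real" where
  "gamma_coeff lam \<mu> k1 k3 =
     (k3 * (lam + \<mu>) - k1 * (lam + 3 * \<mu>)) / ((lam + \<mu>) * (k1 - k3))"

definition eta_coeff :: "real \<Rightarrow> real \<Rightarrow> real \<Rightarrow> real \<Rightarrow> real" where
  "eta_coeff lam \<mu> k1 k3 =
     (k1 * (lam + \<mu>) - k3 * (lam + 3 * \<mu>)) / ((lam + \<mu>) * (k1 - k3))"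

(* Degree at most 2: A may vanish.  The notion is invariant under orthogonal changes of
   coordinates, so it need not mention the frame. *)
definition quadratic_function :: "(real ^ 3 \<Rightarrow> real) \<Rightarrow> bool" where
  "quadratic_function q \<longleftrightarrow>
     (\<exists>(A :: real ^ 3 ^ 3) b c. \<forall>x. q x = x \<bullet> (A *v x) + b \<bullet> x + c)"

(* Open solid ellipsoid with centre c, principal directions u i and semi-axes a i. *)
definition ellipsoid :: "(real ^ 3) set \<Rightarrow> bool" where
  "ellipsoid E \<longleftrightarrow>
     (\<exists>c u a. orthonormal_frame u \<and> (\<forall>i. a i > 0) \<and>
        E = {x. (\<Sum>i\<in>UNIV. (((x - c) \<bullet> u i) / a i)\<^sup>2) < 1})"

end

theory Submission
  imports Defs
begin

text \<open>
Write \<open>N\<close> for the Newtonian potential of the body \<open>\<Omega>\<close> and \<open>e\<close> for the direction of the third axis.  The two uniformity relations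
have the same second term, and the difference of their coefficients \<open>\<gamma> - \<eta> = - 2 (\<lambda> + 2\<mu>) / (\<lambda> + \<mu>)\<close> does not vanish, so
subtracting them writes \<open>N\<close> on \<open>\<Omega>\<close> as a quadratic function plus a function of \<open>x\<^sub>3\<close> plus a function of \<open>(x\<^sub>1, x\<^sub>2)\<close>.
Since \<open>N\<close> has Laplacian one in \<open>\<Omega>\<close>, the function of \<open>x\<^sub>3\<close> has constant second derivative.  Hence
\<open>\<partial>\<^sub>e N = v \<bullet> x + \<delta>\<close> is affine on \<open>\<Omega>\<close>.  Here the Laplacian is replaced by ball averages
(\<open>pot_mean_value\<close>) and the derivative by the difference \<open>N (x + t e) - N x\<close> (\<open>separated_potential_has_row\<close>).

The potential of an ellipsoid is quadratic inside it, with a Hessian \<open>D\<close> of trace one that does not change under translations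
and dilations.  Therefore it is enough to find a point \<open>p \<in> \<Omega>\<close> with \<open>v \<bullet> p + \<delta> = 0\<close> and a shape with \<open>D e = v\<close>: a small
ellipsoid of this shape with centre \<open>p\<close> lies in \<open>\<Omega>\<close>, and its potential has the same derivative in direction \<open>e\<close> as \<open>N\<close>.

The point exists because a body exerts no net force on itself, so \<open>\<partial>\<^sub>e N\<close> has mean zero over \<open>\<Omega>\<close> (\<open>row_zero\<close>).

The shape exists if and only if \<open>\<bar>v\<bar>\<^sup>2 < v \<bullet> e\<close>, and oblate spheroids already realise all these \<open>v\<close>
(\<open>exists_spheroid_with_row\<close>).  Their Hessians \<open>t I + (s - t) n n\<^sup>T\<close> with \<open>s + 2 t = 1\<close> are computed by writing the
potential as an integral over directions, and \<open>t\<close> runs continuously from \<open>1 / 3\<close> (ball) to \<open>0\<close> (disc).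

The inequality \<open>\<bar>v\<bar>\<^sup>2 < v \<bullet> e\<close> (\<open>row_strict\<close>) is an energy estimate.  It expresses that the field
\<open>\<nabla> \<partial>\<^sub>e N\<close>, the orthogonal projection of \<open>e\<close> times the indicator of \<open>\<Omega>\<close> onto the gradient fields, does not vanish outside
\<open>\<Omega>\<close>: its total energy is \<open>(v \<bullet> e) \<bar>\<Omega>\<bar>\<close> and the part inside is \<open>\<bar>v\<bar>\<^sup>2 \<bar>\<Omega>\<bar>\<close>.  The proof uses that the Coulomb kernel
\<open>1 / \<bar>x - y\<bar>\<close> is positive definite (\<open>energy_nonneg\<close>): it is applied to difference quotients of indicators, which stand for surface charges,
and averaged over the direction of one of the differences.
\<close>

section \<open>Lebesgue measure on three-dimensional space\<close>

lemma borel_measurable_orthogonal: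
  fixes f :: "real^3 \<Rightarrow> real^3"
  assumes "orthogonal_transformation f"
  shows "f \<in> borel_measurable borel"
  using assms by (intro borel_measurable_continuous_onI linear_continuous_on)
      (auto simp: orthogonal_transformation_def linear_conv_bounded_linear)

lemma lborel_distr_orthogonal:
  fixes f :: "real^3 \<Rightarrow> real^3"
  assumes "orthogonal_transformation f"
  shows "distr lborel borel f = lborel"
proof (rule lborel_eqI[symmetric])
  fix l u :: "real^3" assume le: "\<And>b. b \<in> Basis \<Longrightarrow> l \<bullet> b \<le> u \<bullet> b"
  note [measurable] = borel_measurable_orthogonal[OF assms]
  have b: "bij f" and i: "orthogonal_transformation (inv f)"
    using assms orthogonal_transformation_bij orthogonal_transformation_inv by auto
  have "emeasure (distr lborel borel f) (box l u) = emeasure lborel (f -` box l u)"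
    by (subst emeasure_distr) auto
  also have "f -` box l u = inv f ` box l u"
    using b by (simp add: bij_vimage_eq_inv_image)
  also have "emeasure lborel (inv f ` box l u) = emeasure lebesgue (inv f ` box l u)"
  proof -
    have "inv f ` box l u \<in> sets borel"
      using b measurable_sets[of f borel borel "box l u"]
      by (subst bij_vimage_eq_inv_image[symmetric]) auto
    then show ?thesis by (simp add: emeasure_completion)
  qed
  also have "\<dots> = ennreal (measure lebesgue (inv f ` box l u))"
    using measurable_orthogonal_image[OF i, of "box l u"]
    by (intro emeasure_eq_ennreal_measure) (auto simp: fmeasurable_def emeasure_lborel_box_eq)
  also have "\<dots> = ennreal (measure lborel (box l u))"
    using measure_orthogonal_image[OF i, of "box l u"] by (simp)
  also have "\<dots> = (\<Prod>b\<in>Basis. (u - l) \<bullet> b)"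
    using le by (simp add: inner_diff_left)
  finally show "emeasure (distr lborel borel f) (box l u) = (\<Prod>b\<in>Basis. (u - l) \<bullet> b)" .
qed simp

lemma nn_integral_orthogonal:
  fixes f :: "real^3 \<Rightarrow> real^3"
  assumes f: "orthogonal_transformation f" and [measurable]: "g \<in> borel_measurable borel"
  shows "(\<integral>\<^sup>+x. g (f x) \<partial>lborel) = (\<integral>\<^sup>+x. g x \<partial>lborel)"
proof -
  note [measurable] = borel_measurable_orthogonal[OF f]
  show ?thesis
    by (subst (2) lborel_distr_orthogonal[OF f, symmetric]) (simp add: nn_integral_distr)
qed

lemma integral_orthogonal:
  fixes f :: "real^3 \<Rightarrow> real^3" and g :: "real^3 \<Rightarrow> real"
  assumes f: "orthogonal_transformation f" and [measurable]: "g \<in> borel_measurable borel"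
  shows "(\<integral>x. g (f x) \<partial>lborel) = (\<integral>x. g x \<partial>lborel)"
proof -
  note [measurable] = borel_measurable_orthogonal[OF f]
  show ?thesis
    by (subst (2) lborel_distr_orthogonal[OF f, symmetric]) (simp add: integral_distr)
qed

lemma nn_integral_translate:
  fixes a :: "real^3"
  assumes [measurable]: "g \<in> borel_measurable borel"
  shows "(\<integral>\<^sup>+x. g (a + x) \<partial>lborel) = (\<integral>\<^sup>+x. g x \<partial>lborel)"
  by (subst (2) lborel_distr_plus[of a, symmetric]) (simp add: nn_integral_distr)

lemma integral_translate:
  fixes a :: "real^3" and g :: "real^3 \<Rightarrow> real"
  assumes [measurable]: "g \<in> borel_measurable borel"
  shows "(\<integral>x. g (a + x) \<partial>lborel) = (\<integral>x. g x \<partial>lborel)"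
  by (subst (2) lborel_distr_plus[of a, symmetric]) (simp add: integral_distr)

lemma integrable_translate:
  fixes a :: "real^3" and g :: "real^3 \<Rightarrow> real"
  assumes "integrable lborel g"
  shows "integrable lborel (\<lambda>x. g (a + x))"
proof -
  have [measurable]: "g \<in> borel_measurable borel" using assms by auto
  show ?thesis
    using assms by (subst (asm) lborel_distr_plus[of a, symmetric]) (simp add: integrable_distr_eq)
qed

lemma nn_integral_scale:
  fixes g :: "real^3 \<Rightarrow> ennreal"
  assumes [measurable]: "g \<in> borel_measurable borel" and "c > 0"
  shows "(\<integral>\<^sup>+x. g x \<partial>lborel) = ennreal (c^3) * (\<integral>\<^sup>+x. g (c *\<^sub>R x) \<partial>lborel)"
proof -
  have "(\<integral>\<^sup>+x. g x \<partial>lborel) = (\<integral>\<^sup>+x. g x \<partial>density (distr lborel borel (\<lambda>x. 0 + c *\<^sub>R x)) (\<lambda>_. ennreal (\<bar>c\<bar>^DIM(real^3))))"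
    using \<open>c > 0\<close> by (subst lborel_affine[of c "0::real^3", symmetric]) auto
  then show ?thesis
    using \<open>c > 0\<close> by (simp add: nn_integral_density nn_integral_distr nn_integral_cmult)
qed

lemma nn_integral_uminus:
  assumes [measurable]: "(g :: real^3 \<Rightarrow> ennreal) \<in> borel_measurable borel"
  shows "(\<integral>\<^sup>+x. g (- x) \<partial>lborel) = (\<integral>\<^sup>+x. g x \<partial>lborel)"
proof -
  have "orthogonal_transformation (\<lambda>x::real^3. - x)"
    by (simp add: orthogonal_transformation_neg)
  then show ?thesis by (rule nn_integral_orthogonal) fact
qed

text \<open>Pushing Lebesgue measure forward along the norm turns an integral of a radial
  function into a one-dimensional one.  The two measures are compared on the intervals
  \<open>{..a}\<close>, where both sides give the volume of a ball.\<close>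

lemma distr_norm_lborel:
  "distr (lborel :: (real^3) measure) borel norm
     = density lborel (\<lambda>r. ennreal (4 * pi * r\<^sup>2 * indicator {0..} r))"
proof (rule measure_eqI_generator_eq[where E="range (\<lambda>a::real. {..a})" and \<Omega>=UNIV and A="\<lambda>n::nat. {..real n}"])
  show "Int_stable (range (\<lambda>a::real. {..a}))"
    by (auto simp: Int_stable_def intro!: exI[of _ "min _ _"])
  have em: "emeasure (distr (lborel :: (real^3) measure) borel norm) {..a} = ennreal (4/3*pi*a^3 * indicator {0..} a)" for a
  proof -
    have "emeasure (distr (lborel :: (real^3) measure) borel norm) {..a} = emeasure lborel {z::real^3. norm z \<le> a}"
      by (subst emeasure_distr) (auto simp: vimage_def)
    also have "{z::real^3. norm z \<le> a} = cball 0 a" by (auto)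
    also have "emeasure lborel (cball 0 a :: (real^3) set) = ennreal (4/3*pi*a^3 * indicator {0..} a)"
    proof (cases "a \<ge> 0")
      case True
      then show ?thesis by (simp add: emeasure_cball unit_ball_vol_3)
    qed simp
    finally show ?thesis .
  qed
  have em2: "emeasure (density lborel (\<lambda>r. ennreal (4 * pi * r\<^sup>2 * indicator {0..} r))) {..a} = ennreal (4/3*pi*a^3 * indicator {0..} a)" for a
  proof -
    have "emeasure (density lborel (\<lambda>r. ennreal (4 * pi * r\<^sup>2 * indicator {0..} r))) {..a}
      = (\<integral>\<^sup>+r. ennreal (4 * pi * r\<^sup>2) * indicator {0..a} r \<partial>lborel)"
      by (subst emeasure_density) (auto intro!: nn_integral_cong split: split_indicator)
    also have "\<dots> = ennreal (4/3*pi*a^3 * indicator {0..} a)"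
    proof (cases "a \<ge> 0")
      case True
      have "(\<integral>\<^sup>+r. ennreal (4 * pi * r\<^sup>2) * indicator {0..a} r \<partial>lborel) = ennreal (4/3*pi*a^3 - 4/3*pi*0^3)"
        using True by (intro nn_integral_FTC_Icc[where F="\<lambda>r. 4/3*pi*r^3"]) (auto intro!: derivative_eq_intros)
      then show ?thesis using True by simp
    qed simp
    finally show ?thesis .
  qed
  show "emeasure (distr (lborel :: (real^3) measure) borel norm) X =
         emeasure (density lborel (\<lambda>r. ennreal (4 * pi * r\<^sup>2 * indicator {0..} r))) X"
    if "X \<in> range (\<lambda>a::real. {..a})" for X
    using that em em2 by auto
  show "emeasure (distr (lborel :: (real^3) measure) borel norm) {..real i} \<noteq> \<infinity>" for i
    by (simp add: em)
  show "sets (distr (lborel :: (real^3) measure) borel norm) = sigma_sets UNIV (range (\<lambda>a::real. {..a}))"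
    "sets (density lborel (\<lambda>r. ennreal (4 * pi * r\<^sup>2 * indicator {0..} r))) = sigma_sets UNIV (range (\<lambda>a::real. {..a}))"
    by (simp_all add: borel_eq_atMost)
  show "(\<Union>i::nat. {..real i}) = UNIV" using real_arch_simple by auto
qed auto

lemma nn_integral_radial:
  assumes [measurable]: "g \<in> borel_measurable borel"
  shows "(\<integral>\<^sup>+z. g (norm (z::real^3)) \<partial>lborel) = (\<integral>\<^sup>+r. ennreal (4*pi*r\<^sup>2) * g r * indicator {0..} r \<partial>lborel)"
proof -
  have "(\<integral>\<^sup>+z. g (norm (z::real^3)) \<partial>lborel) = (\<integral>\<^sup>+r. g r \<partial>(distr (lborel :: (real^3) measure) borel norm))"
    by (subst nn_integral_distr) auto
  also have "\<dots> = (\<integral>\<^sup>+r. ennreal (4*pi*r\<^sup>2) * g r * indicator {0..} r \<partial>lborel)"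
    unfolding distr_norm_lborel
    by (subst nn_integral_density) (auto intro!: nn_integral_cong split: split_indicator)
  finally show ?thesis .
qed

text \<open>Differentiability of the primitive \<open>G\<close> is asked for away from the centre only, because the densities of interest are singular there.\<close>

lemma has_bochner_integral_radial_ball:
  fixes g G :: "real \<Rightarrow> real"
  assumes [measurable]: "g \<in> borel_measurable borel"
    and nn: "\<And>s. s \<ge> 0 \<Longrightarrow> g s \<ge> 0" and "r \<ge> 0"
    and G: "continuous_on {0..r} G"
           "\<And>s. 0 < s \<Longrightarrow> s < r \<Longrightarrow> (G has_real_derivative (4*pi * s\<^sup>2 * g s)) (at s)"
  shows "has_bochner_integral lborel (\<lambda>z::real^3. g (norm z) * indicator (ball 0 r) z) (G r - G 0)"
proof -
  have hi: "((\<lambda>s. 4*pi * s\<^sup>2 * g s) has_integral (G r - G 0)) {0..r}"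
    using \<open>r \<ge> 0\<close> G by (intro fundamental_theorem_of_calculus_interior)
      (auto simp: has_real_derivative_iff_has_vector_derivative)
  have "(\<integral>\<^sup>+z. ennreal (g (norm z) * indicator (ball 0 r) z) \<partial>(lborel :: (real^3) measure))
      = (\<integral>\<^sup>+z. (\<lambda>s. ennreal (g s * indicator {..<r} s)) (norm z) \<partial>(lborel :: (real^3) measure))"
    by (intro nn_integral_cong) (auto split: split_indicator)
  also have "\<dots> = (\<integral>\<^sup>+s. ennreal (4*pi * s\<^sup>2) * ennreal (g s * indicator {..<r} s) * indicator {0..} s \<partial>lborel)"
    by (rule nn_integral_radial) auto
  also have "\<dots> = (\<integral>\<^sup>+s. ennreal (indicator {0..<r} s * (4*pi * s\<^sup>2 * g s)) \<partial>lborel)"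
    by (intro nn_integral_cong) (auto simp: ennreal_mult' split: split_indicator)
  also have "\<dots> = (\<integral>\<^sup>+s. ennreal (indicator {0..r} s * (4*pi * s\<^sup>2 * g s)) \<partial>lborel)"
  proof (intro nn_integral_cong_AE)
    show "AE s in lborel. ennreal (indicator {0..<r} s * (4 * pi * s\<^sup>2 * g s)) = ennreal (indicator {0..r} s * (4 * pi * s\<^sup>2 * g s))"
      using AE_lborel_singleton[of r] by eventually_elim (auto split: split_indicator)
  qed
  also have "\<dots> = ennreal (G r - G 0)"
  proof (rule nn_integral_has_integral_lborel)
    have "(\<lambda>s. indicator {0..r} s * (4 * pi * s\<^sup>2 * g s)) = (\<lambda>s. if s \<in> {0..r} then 4 * pi * s\<^sup>2 * g s else 0)"
      by (auto simp: fun_eq_iff)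
    then show "((\<lambda>s. indicator {0..r} s * (4 * pi * s\<^sup>2 * g s)) has_integral G r - G 0) UNIV"
      using hi by (simp only: has_integral_restrict_UNIV)
    show "0 \<le> indicator {0..r} s * (4 * pi * s\<^sup>2 * g s)" for s
      by (cases "s \<in> {0..r}") (auto simp: nn)
  qed measurable
  finally have *: "(\<integral>\<^sup>+z. ennreal (g (norm z) * indicator (ball 0 r) z) \<partial>(lborel :: (real^3) measure)) = ennreal (G r - G 0)" .
  have "G r - G 0 \<ge> 0"
    using hi by (rule has_integral_nonneg) (auto simp: nn)
  then show ?thesis
    using * by (intro has_bochner_integral_nn_integral) (measurable, auto simp: nn)
qed

section \<open>Potentials of bounded charges\<close>

text \<open>The class contains the indicators of bounded Borel sets and is closed under translations and linear combinations, so it contains the difference quotients of indicators that serve as test densities below.\<close>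

definition charge :: "(real^3 \<Rightarrow> real) \<Rightarrow> bool" where
  "charge f \<longleftrightarrow> f \<in> borel_measurable borel \<and> (\<exists>M R. \<forall>y. \<bar>f y\<bar> \<le> M * indicator (ball 0 R) y)"

text \<open>This is \<open>- 4 \<pi>\<close> times the Newtonian potential of the density; with this sign the kernel is positive.\<close>

definition pot :: "(real^3 \<Rightarrow> real) \<Rightarrow> real^3 \<Rightarrow> real" where
  "pot f x = (\<integral>y. f y / norm (x - y) \<partial>lborel)"

lemma charge_measurable[measurable_dest]: "charge f \<Longrightarrow> f \<in> borel_measurable borel"
  by (simp add: charge_def)

lemma chargeE:
  assumes "charge f"
  obtains M R where "M > 0" "R > 0" "\<And>y. \<bar>f y\<bar> \<le> M * indicator (ball 0 R) y"
proof -
  from assms obtain M R where *: "\<And>y. \<bar>f y\<bar> \<le> M * indicator (ball 0 R) y"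
    unfolding charge_def by auto
  have "\<bar>f y\<bar> \<le> max M 1 * indicator (ball 0 (max R 1)) y" for y
    using *[of y] by (cases "norm y < R") (auto simp: indicator_def split: if_splits)
  moreover have "max M 1 > 0" "max R 1 > 0" by auto
  ultimately show ?thesis using that by blast
qed

lemma charge_indicator:
  assumes "bounded A" "A \<in> sets borel"
  shows "charge (indicator A)"
proof -
  from \<open>bounded A\<close> obtain R where "A \<subseteq> ball 0 R" using bounded_subset_ballD by blast
  then have "\<bar>indicator A y\<bar> \<le> (1::real) * indicator (ball 0 R) y" for y
    by (auto simp: indicator_def)
  then show ?thesis using assms unfolding charge_def by fastforce
qed

lemma charge_add:
  assumes f: "charge f" and g: "charge g"
  shows "charge (\<lambda>y. f y + g y)"
proof -
  obtain M R where 1: "M > 0" "\<And>y. \<bar>f y\<bar> \<le> M * indicator (ball 0 R) y" using chargeE[OF f] by metis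
  obtain M' R' where 2: "M' > 0" "\<And>y. \<bar>g y\<bar> \<le> M' * indicator (ball 0 R') y" using chargeE[OF g] by metis
  have "\<bar>f y + g y\<bar> \<le> (M + M') * indicator (ball 0 (max R R')) y" for y
    using 1(1) 1(2)[of y] 2(1) 2(2)[of y]
    by (cases "norm y < R"; cases "norm y < R'") (auto simp: indicator_def)
  then show ?thesis using f g unfolding charge_def by auto
qed

lemma charge_scale: "charge f \<Longrightarrow> charge (\<lambda>y. c * f y)"
proof -
  assume f: "charge f"
  obtain M R where 1: "M > 0" "\<And>y. \<bar>f y\<bar> \<le> M * indicator (ball 0 R) y" using chargeE[OF f] by metis
  have "\<bar>c * f y\<bar> \<le> (\<bar>c\<bar> * M) * indicator (ball 0 R) y" for y
    using 1(2)[of y] mult_left_mono[OF 1(2)[of y], of "\<bar>c\<bar>"] by (simp add: abs_mult mult.assoc)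
  then show ?thesis using f unfolding charge_def by auto
qed

lemma charge_diff: "charge f \<Longrightarrow> charge g \<Longrightarrow> charge (\<lambda>y. f y - g y)"
  using charge_add[of f "\<lambda>y. -1 * g y"] charge_scale[of g "-1"] by simp

lemma charge_translate: "charge f \<Longrightarrow> charge (\<lambda>y. f (a + y))"
proof -
  assume f: "charge f"
  obtain M R where 1: "M > 0" "\<And>y. \<bar>f y\<bar> \<le> M * indicator (ball 0 R) y" using chargeE[OF f] by metis
  have "\<bar>f (a + y)\<bar> \<le> M * indicator (ball 0 (R + norm a)) y" for y
  proof (cases "norm (a + y) < R")
    case True
    then have "norm y < R + norm a" using norm_triangle_ineq4[of "a + y" a] by simp
    then show ?thesis using 1(2)[of "a + y"] True by (simp)
  next
    case False
    then show ?thesis using 1(1) 1(2)[of "a + y"] by (auto simp: indicator_def)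
  qed
  then show ?thesis using f unfolding charge_def by auto
qed

lemma charge_cong_bound:
  assumes "charge f" "g \<in> borel_measurable borel" "\<And>y. \<bar>g y\<bar> \<le> \<bar>f y\<bar>"
  shows "charge g"
  using assms unfolding charge_def by (meson order_trans)

lemma emeasure_ball_finite: "emeasure lborel (ball (c::real^3) R) < \<infinity>"
  by (rule emeasure_bounded_finite) simp

lemma integrable_dominated:
  fixes f g :: "real^3 \<Rightarrow> real"
  assumes "integrable lborel g" "f \<in> borel_measurable borel" "\<And>x. \<bar>f x\<bar> \<le> g x"
  shows "integrable lborel f"
proof (rule Bochner_Integration.integrable_bound[OF assms(1)])
  show "AE x in lborel. norm (f x) \<le> norm (g x)"
    using assms(3) order_trans[OF _ abs_ge_self] by (intro AE_I2) (simp, blast)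
qed (use assms(2) in simp)

lemma charge_integrable: "charge f \<Longrightarrow> integrable lborel f"
proof -
  assume f: "charge f"
  obtain M R where 1: "M > 0" "\<And>y. \<bar>f y\<bar> \<le> M * indicator (ball 0 R) y" using chargeE[OF f] by metis
  have "integrable lborel (\<lambda>y::real^3. M * indicator (ball 0 R) y)"
    by (intro integrable_mult_right integrable_real_indicator) (auto simp: emeasure_ball_finite[unfolded infinity_ennreal_def])
  then show ?thesis
    using charge_measurable[OF f] 1(2) by (rule integrable_dominated)
qed

lemma has_integral_norm_powr_ball:
  assumes "0 < p" "p < 3" "r \<ge> 0"
  shows "has_bochner_integral lborel (\<lambda>z::real^3. norm z powr (-p) * indicator (ball 0 r) z)
           (4 * pi / (3 - p) * r powr (3 - p))"
proof -
  have "has_bochner_integral lborel (\<lambda>z::real^3. norm z powr (-p) * indicator (ball 0 r) z)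
           (4 * pi / (3 - p) * r powr (3 - p) - 4 * pi / (3 - p) * 0 powr (3 - p))"
  proof (rule has_bochner_integral_radial_ball)
    show "continuous_on {0..r} (\<lambda>s. 4 * pi / (3 - p) * s powr (3 - p))"
      using assms by (intro continuous_intros continuous_on_powr') auto
    fix s :: real assume s: "0 < s" "s < r"
    have "((\<lambda>s. 4 * pi / (3 - p) * s powr (3 - p)) has_real_derivative
        (4 * pi / (3 - p) * ((3 - p) * s powr (3 - p - 1)))) (at s)"
      using s by (intro DERIV_cmult has_real_derivative_powr)
    moreover have "4 * pi / (3 - p) * ((3 - p) * s powr (3 - p - 1)) = 4 * pi * s\<^sup>2 * s powr - p"
    proof -
      have "s powr (3 - p - 1) = s powr (2 + - p)" by (simp add: algebra_simps)
      also have "\<dots> = s\<^sup>2 * s powr - p" using s by (simp only: powr_add) simp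
      finally show ?thesis using assms by simp
    qed
    ultimately show "((\<lambda>s. 4 * pi / (3 - p) * s powr (3 - p)) has_real_derivative
         (4 * pi * s\<^sup>2 * s powr - p)) (at s)" by simp
  qed (use assms in auto)
  then show ?thesis by simp
qed

text \<open>The bound is uniform in \<open>x\<close>: within distance one of \<open>x\<close> the kernel is integrable, and farther away it is at most one.\<close>

lemma charge_riesz_bound:
  assumes f: "charge f" and p: "0 < p" "p < 3"
  obtains C where "C > 0" "\<And>x. integrable lborel (\<lambda>y. \<bar>f y\<bar> * norm (x - y) powr (-p))"
     "\<And>x. (\<integral>y. \<bar>f y\<bar> * norm (x - y) powr (-p) \<partial>lborel) \<le> C"
proof -
  obtain M R where M: "M > 0" "R > 0" "\<And>y. \<bar>f y\<bar> \<le> M * indicator (ball 0 R) y" using chargeE[OF f] by metis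
  note [measurable] = charge_measurable[OF f]
  let ?k = "\<lambda>z::real^3. norm z powr (-p) * indicator (ball 0 1) z"
  let ?b = "\<lambda>x y. M * ?k (- x + y) + M * indicator (ball 0 R) y"
  have ik: "integrable lborel ?k" and ikv: "integral\<^sup>L lborel ?k = 4*pi/(3-p)"
    using has_integral_norm_powr_ball[OF p, of 1] by (auto simp: has_bochner_integral_iff)
  have ib: "integrable lborel (?b x)" for x
    by (intro Bochner_Integration.integrable_add integrable_mult_right integrable_translate[OF ik] integrable_real_indicator)
       (auto simp: emeasure_ball_finite[unfolded infinity_ennreal_def])
  have ibv: "integral\<^sup>L lborel (?b x) = M * (4*pi/(3-p)) + M * measure lborel (ball (0::real^3) R)" for x
  proof -
    have "integral\<^sup>L lborel (?b x) = (\<integral>y. M * ?k (- x + y) \<partial>lborel) + (\<integral>y. M * indicator (ball (0::real^3) R) y \<partial>lborel)"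
      by (intro Bochner_Integration.integral_add integrable_mult_right integrable_translate[OF ik] integrable_real_indicator)
       (auto simp: emeasure_ball_finite[unfolded infinity_ennreal_def])
    moreover have "(\<integral>y. ?k (- x + y) \<partial>lborel) = 4*pi/(3-p)"
      using integral_translate[of ?k "- x"] ik ikv by (auto dest: borel_measurable_integrable)
    ultimately show ?thesis by simp
  qed
  have le: "\<bar>f y\<bar> * norm (x - y) powr (-p) \<le> ?b x y" for x y
  proof (cases "norm (x - y) < 1")
    case True
    then have "\<bar>f y\<bar> * norm (x - y) powr (-p) \<le> M * norm (x - y) powr (-p)"
      using M(1) M(3)[of y] by (intro mult_right_mono) (cases "norm y < R", auto)
    then show ?thesis using True M(1) by (auto simp: norm_minus_commute intro: add_increasing2)
  next
    case False
    have "norm (x - y) powr (-p) \<le> 1 powr (-p)"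
      using False p by (intro powr_mono2') auto
    then have "\<bar>f y\<bar> * norm (x - y) powr (-p) \<le> \<bar>f y\<bar>"
      by (intro mult_left_le) auto
    also have "\<dots> \<le> M * indicator (ball 0 R) y" by (rule M)
    finally show ?thesis using False M(1) by (auto simp: norm_minus_commute intro: add_increasing)
  qed
  have int: "integrable lborel (\<lambda>y. \<bar>f y\<bar> * norm (x - y) powr (-p))" for x
    by (rule integrable_dominated[OF ib[of x]])
      (measurable, use le[where x=x] in \<open>simp add: abs_mult\<close>)
  show ?thesis
  proof (rule that)
    show "0 < M * (4*pi/(3-p)) + M * measure lborel (ball (0::real^3) R)"
      using M p by (intro add_pos_nonneg mult_pos_pos divide_pos_pos) auto
    show "integrable lborel (\<lambda>y. \<bar>f y\<bar> * norm (x - y) powr (-p))" for x by (rule int)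
    show "(\<integral>y. \<bar>f y\<bar> * norm (x - y) powr (-p) \<partial>lborel) \<le> M * (4*pi/(3-p)) + M * measure lborel (ball (0::real^3) R)" for x
      unfolding ibv[of x, symmetric] by (rule integral_mono[OF int ib le])
  qed
qed

lemma abs_div_norm: "\<bar>a / norm x\<bar> = \<bar>a\<bar> * norm x powr (-1)"
  by (simp add: powr_minus divide_inverse abs_mult)

lemma integrable_pot:
  assumes f: "charge f"
  shows "integrable lborel (\<lambda>y. f y / norm (x - y))"
proof -
  note [measurable] = charge_measurable[OF f]
  have "integrable lborel (\<lambda>y. \<bar>f y\<bar> * norm (x - y) powr (-1))"
    using charge_riesz_bound[OF f, of 1] by auto
  moreover have "(\<lambda>y. f y / norm (x - y)) \<in> borel_measurable borel" by measurable
  moreover have "\<bar>f y / norm (x - y)\<bar> \<le> \<bar>f y\<bar> * norm (x - y) powr (-1)" for y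
    by (simp only: abs_div_norm order_refl)
  ultimately show ?thesis by (rule integrable_dominated)
qed

lemma pot_add: "charge f \<Longrightarrow> charge g \<Longrightarrow> pot (\<lambda>y. f y + g y) x = pot f x + pot g x"
  unfolding pot_def by (simp add: add_divide_distrib integrable_pot)

lemma pot_diff: "charge f \<Longrightarrow> charge g \<Longrightarrow> pot (\<lambda>y. f y - g y) x = pot f x - pot g x"
  unfolding pot_def by (simp add: diff_divide_distrib integrable_pot)

lemma pot_scale: "pot (\<lambda>y. c * f y) x = c * pot f x"
  unfolding pot_def by (simp flip: times_divide_eq_right)

lemma pot_translate:
  assumes f: "charge f"
  shows "pot (\<lambda>y. f (a + y)) x = pot f (a + x)"
proof -
  note [measurable] = charge_measurable[OF f]
  have "pot (\<lambda>y. f (a + y)) x = (\<integral>y. (\<lambda>z. f z / norm (a + x - z)) (a + y) \<partial>lborel)"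
    unfolding pot_def by (simp add: algebra_simps)
  also have "\<dots> = pot f (a + x)"
    unfolding pot_def by (rule integral_translate) auto
  finally show ?thesis .
qed

lemma pot_measurable[measurable]:
  assumes f: "charge f"
  shows "pot f \<in> borel_measurable borel"
proof -
  note [measurable] = charge_measurable[OF f]
  have "(\<lambda>x. \<integral>y. f y / norm (x - y) \<partial>lborel) \<in> borel_measurable borel"
    by measurable
  then show ?thesis by (simp add: pot_def[abs_def])
qed

lemma pot_bounded:
  assumes f: "charge f"
  obtains C where "C > 0" "\<And>x. \<bar>pot f x\<bar> \<le> C"
proof -
  obtain C where C: "C > 0" "\<And>x. integrable lborel (\<lambda>y. \<bar>f y\<bar> * norm (x - y) powr (-1))"
     "\<And>x. (\<integral>y. \<bar>f y\<bar> * norm (x - y) powr (-1) \<partial>lborel) \<le> C"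
    using charge_riesz_bound[OF f, of 1] by auto
  have "\<bar>pot f x\<bar> \<le> C" for x
  proof -
    have "\<bar>pot f x\<bar> \<le> (\<integral>y. \<bar>f y / norm (x - y)\<bar> \<partial>lborel)"
      unfolding pot_def by (rule integral_abs_bound)
    also have "\<dots> = (\<integral>y. \<bar>f y\<bar> * norm (x - y) powr (-1) \<partial>lborel)"
      by (simp only: abs_div_norm)
    finally show ?thesis using C(3)[of x] by simp
  qed
  then show ?thesis using C(1) that by blast
qed

text \<open>With the conventions \<open>1 / 0 = 0\<close> and \<open>0 powr a = 0\<close> the estimate persists at the two singular points, so no exceptional set has to be carried along.\<close>

lemma kernel_lipschitz:
  fixes z h :: "'a::real_normed_vector"
  shows "\<bar>1 / norm (z + h) - 1 / norm z\<bar> \<le> norm h * (norm (z + h) powr (-2) + norm z powr (-2))"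
proof -
  define p m d where "p = norm (z + h)" and "m = norm z" and "d = norm h"
  have nn: "p \<ge> 0" "m \<ge> 0" "d \<ge> 0" by (auto simp: p_def m_def d_def)
  have tri: "\<bar>p - m\<bar> \<le> d" using norm_triangle_ineq3[of "z + h" z] by (simp add: p_def m_def d_def)
  have sq: "a powr (-2) = 1 / a^2" if "a \<ge> 0" for a :: real
    using that by (cases "a = 0") (auto simp: powr_minus divide_inverse)
  have "\<bar>1 / p - 1 / m\<bar> \<le> d * (1/p\<^sup>2 + 1/m\<^sup>2)"
  proof (cases "p = 0 \<or> m = 0")
    case True
    then show ?thesis
    proof
      assume "p = 0"
      then have "m \<le> d" using tri by simp
      have "1 / m \<le> d * (1 / m\<^sup>2)"
        using \<open>m \<le> d\<close> nn by (cases "m = 0") (auto simp: field_simps power2_eq_square)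
      then show ?thesis using \<open>p = 0\<close> nn by simp
    next
      assume "m = 0"
      then have "p \<le> d" using tri by simp
      have "1 / p \<le> d * (1 / p\<^sup>2)"
        using \<open>p \<le> d\<close> nn by (cases "p = 0") (auto simp: field_simps power2_eq_square)
      then show ?thesis using \<open>m = 0\<close> nn by simp
    qed
  next
    case False
    then have pm: "p > 0" "m > 0" using nn by auto
    have "\<bar>1 / p - 1 / m\<bar> = \<bar>p - m\<bar> * (1/p * (1/m))"
    proof -
      have "1 / p - 1 / m = (m - p) * (1/p * (1/m))" using pm by (simp add: field_simps)
      then show ?thesis using pm by (simp add: abs_mult abs_minus_commute)
    qed
    also have "\<dots> \<le> d * (1/p * (1/m))"
      using tri pm by (intro mult_right_mono) auto
    also have "1/p * (1/m) \<le> 1/p\<^sup>2 + 1/m\<^sup>2"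
    proof -
      have "2 * (1/p * (1/m)) \<le> (1/p)\<^sup>2 + (1/m)\<^sup>2"
        using sum_squares_bound[of "1/p" "1/m"] by simp
      moreover have "1/p * (1/m) \<ge> 0" using pm by simp
      ultimately have "1/p * (1/m) \<le> (1/p)\<^sup>2 + (1/m)\<^sup>2" by linarith
      then show ?thesis by (simp add: power_divide)
    qed
    finally show ?thesis using nn by (simp add: mult_left_mono)
  qed
  then show ?thesis using nn by (simp add: sq p_def[symmetric] m_def[symmetric] d_def[symmetric])
qed

lemma pot_lipschitz:
  assumes f: "charge f"
  obtains L where "L > 0" "\<And>x h. \<bar>pot f (x + h) - pot f x\<bar> \<le> L * norm h"
proof -
  note [measurable] = charge_measurable[OF f]
  obtain C where C: "C > 0" "\<And>x. integrable lborel (\<lambda>y. \<bar>f y\<bar> * norm (x - y) powr (-2))"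
     "\<And>x. (\<integral>y. \<bar>f y\<bar> * norm (x - y) powr (-2) \<partial>lborel) \<le> C"
    using charge_riesz_bound[OF f, of 2] by auto
  have "\<bar>pot f (x + h) - pot f x\<bar> \<le> (2*C) * norm h" for x h
  proof -
    have "\<bar>pot f (x + h) - pot f x\<bar> = \<bar>\<integral>y. f y / norm (x + h - y) - f y / norm (x - y) \<partial>lborel\<bar>"
      unfolding pot_def using integrable_pot[OF f] by simp
    also have "\<dots> \<le> (\<integral>y. \<bar>f y / norm (x + h - y) - f y / norm (x - y)\<bar> \<partial>lborel)"
      by (rule integral_abs_bound)
    also have "\<dots> \<le> (\<integral>y. norm h * (\<bar>f y\<bar> * norm (x + h - y) powr (-2) + \<bar>f y\<bar> * norm (x - y) powr (-2)) \<partial>lborel)"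
    proof (rule integral_mono)
      show "integrable lborel (\<lambda>y. \<bar>f y / norm (x + h - y) - f y / norm (x - y)\<bar>)"
        using integrable_pot[OF f] by simp
      show "integrable lborel (\<lambda>y. norm h * (\<bar>f y\<bar> * norm (x + h - y) powr (-2) + \<bar>f y\<bar> * norm (x - y) powr (-2)))"
        using C(2) by simp
      fix y
      have "\<bar>f y / norm (x + h - y) - f y / norm (x - y)\<bar> = \<bar>f y\<bar> * \<bar>1 / norm (x - y + h) - 1 / norm (x - y)\<bar>"
        by (simp add: abs_mult[symmetric] right_diff_distrib algebra_simps)
      also have "\<dots> \<le> \<bar>f y\<bar> * (norm h * (norm (x - y + h) powr (-2) + norm (x - y) powr (-2)))"
        by (intro mult_left_mono kernel_lipschitz) auto
      finally show "\<bar>f y / norm (x + h - y) - f y / norm (x - y)\<bar> \<le> norm h * (\<bar>f y\<bar> * norm (x + h - y) powr (-2) + \<bar>f y\<bar> * norm (x - y) powr (-2))"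
        by (simp add: algebra_simps)
    qed
    also have "\<dots> = norm h * ((\<integral>y. \<bar>f y\<bar> * norm (x + h - y) powr (-2) \<partial>lborel) + (\<integral>y. \<bar>f y\<bar> * norm (x - y) powr (-2) \<partial>lborel))"
      using C(2) by simp
    also have "\<dots> \<le> norm h * (C + C)"
      using C(3) by (intro mult_left_mono add_mono) auto
    finally show ?thesis by (simp add: algebra_simps)
  qed
  then show ?thesis using C(1) that[of "2*C"] by simp
qed

lemma pot_continuous:
  assumes f: "charge f"
  shows "continuous_on A (pot f)"
proof -
  obtain L where L: "L > 0" "\<And>x h. \<bar>pot f (x + h) - pot f x\<bar> \<le> L * norm h" using pot_lipschitz[OF f] by metis
  have "L-lipschitz_on A (pot f)"
    using L(1) L(2)[of x "y - x" for x y]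
    by (intro lipschitz_onI) (auto simp: dist_norm norm_minus_commute abs_minus_commute)
  then show ?thesis by (rule lipschitz_on_continuous_on)
qed

text \<open>The numerator of the second difference is \<open>-m(p + q - 2m) - 2(p - m)(q - m)\<close>, and the
  parallelogram law bounds both terms by multiples of \<open>d\<^sup>2\<close>, where \<open>p, q, m\<close> are the three distances and \<open>d\<close> is
  the length of \<open>h\<close>.  This gives \<open>3 d\<^sup>2 / (p q m)\<close> without a Taylor expansion away from the singularity.  One factor
  \<open>max p q \<ge> d powr (1/2) * m powr (1/2)\<close> of the denominator is then traded for the power \<open>d powr (3/2)\<close>, which is
  \<open>o(d)\<close> and leaves singularities of the integrable order \<open>5/2\<close>.\<close>

lemma kernel_second_difference:
  fixes z h :: "'a::real_inner"
  shows "\<bar>1 / norm (z + h) + 1 / norm (z - h) - 2 / norm z\<bar>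
     \<le> 6 * norm h powr (3/2) * (norm (z + h) powr (-5/2) + norm (z - h) powr (-5/2) + norm z powr (-5/2))"
proof -
  define p q m d where "p = norm (z + h)" and "q = norm (z - h)" and "m = norm z" and "d = norm h"
  have nn: "p \<ge> 0" "q \<ge> 0" "m \<ge> 0" "d \<ge> 0" by (auto simp: p_def q_def m_def d_def)
  have tri: "\<bar>p - m\<bar> \<le> d" "\<bar>q - m\<bar> \<le> d"
    using norm_triangle_ineq3[of "z + h" z] norm_triangle_ineq3[of "z - h" z] by (auto simp: p_def q_def m_def d_def)
  have par: "p\<^sup>2 + q\<^sup>2 = 2 * m\<^sup>2 + 2 * d\<^sup>2"
    unfolding p_def q_def m_def d_def
    by (simp add: power2_norm_eq_inner inner_simps inner_commute)
  let ?P = "\<lambda>a::real. a powr (-5/2)"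
  have P0: "?P a \<ge> 0" for a :: real by simp
  have "\<bar>1 / p + 1 / q - 2 / m\<bar> \<le> 6 * d powr (3/2) * (?P p + ?P q + ?P m)"
  proof (cases "d = 0")
    case True
    then have "h = 0" by (simp add: d_def)
    then show ?thesis by (simp add: p_def q_def m_def d_def)
  next
    case d: False
    then have d: "d > 0" using nn by simp
    have scale: "d powr (3/2) * ?P (c * d) = c powr (-5/2) * (1/d)" if "c > 0" for c
    proof -
      have "d powr (3/2) * ?P (c * d) = c powr (-5/2) * d powr (3/2 + (-5/2))"
        using that d by (simp only: powr_mult powr_add) (simp add: ac_simps)
      also have "3/2 + (-5/2) = (-1::real)" by simp
      finally show ?thesis using d by (simp add: powr_neg_one)
    qed
    show ?thesis
    proof (cases "p = 0 \<or> q = 0 \<or> m = 0")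
      case True
      then consider "m = 0" | "p = 0" | "q = 0" by blast
      then show ?thesis
      proof cases
        case 1
        then have "p = d" "q = d" by (auto simp: m_def p_def q_def d_def)
        moreover have "2 / d \<le> 6 * d powr (3/2) * (?P d + ?P d)"
          using scale[of 1] d by (simp add: algebra_simps divide_right_mono)
        ultimately show ?thesis using 1 d by (simp add: algebra_simps)
      next
        case 2
        then have z: "z = - h" by (simp add: p_def eq_neg_iff_add_eq_0)
        have q: "q = 2 * d" using norm_scaleR[of 2 "- h"] unfolding q_def z d_def by (simp add: scaleR_2)
        have m: "m = d" unfolding m_def z d_def by simp
        have "\<bar>1 / p + 1 / q - 2 / m\<bar> = (3/2) * (1/d)" using 2 d unfolding q m by (simp add: field_simps)
        also have "\<dots> \<le> 6 * (d powr (3/2) * ?P d)"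
          using scale[of 1] d by (simp add: field_simps)
        also have "\<dots> \<le> 6 * (d powr (3/2) * (?P p + ?P q + ?P m))"
          unfolding m by (intro mult_left_mono) auto
        finally show ?thesis by (simp only: mult.assoc)
      next
        case 3
        then have z: "z = h" by (simp add: q_def)
        have p: "p = 2 * d" using norm_scaleR[of 2 "h"] unfolding p_def z d_def by (simp add: scaleR_2)
        have m: "m = d" unfolding m_def z d_def by simp
        have "\<bar>1 / p + 1 / q - 2 / m\<bar> = (3/2) * (1/d)" using 3 d unfolding p m by (simp add: field_simps)
        also have "\<dots> \<le> 6 * (d powr (3/2) * ?P d)"
          using scale[of 1] d by (simp add: field_simps)
        also have "\<dots> \<le> 6 * (d powr (3/2) * (?P p + ?P q + ?P m))"
          unfolding m by (intro mult_left_mono) auto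
        finally show ?thesis by (simp only: mult.assoc)
      qed
    next
      case False
      then have pos: "p > 0" "q > 0" "m > 0" using nn by auto
      define \<alpha> \<beta> where "\<alpha> = p - m" and "\<beta> = q - m"
      have ab: "\<bar>\<alpha>\<bar> \<le> d" "\<bar>\<beta>\<bar> \<le> d" using tri by (auto simp: \<alpha>_def \<beta>_def)
      have a2: "\<alpha>\<^sup>2 \<le> d\<^sup>2" "\<beta>\<^sup>2 \<le> d\<^sup>2" using ab nn by (simp_all add: abs_le_square_iff[symmetric])
      have mab: "2 * (m * (\<alpha> + \<beta>)) = 2 * d\<^sup>2 - \<alpha>\<^sup>2 - \<beta>\<^sup>2"
        using par by (simp add: \<alpha>_def \<beta>_def power2_eq_square algebra_simps)
      have "\<bar>\<alpha> * \<beta>\<bar> \<le> d\<^sup>2" using ab by (simp add: abs_mult power2_eq_square mult_mono)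
      then have num: "\<bar>m * (\<alpha> + \<beta>) + 2 * (\<alpha> * \<beta>)\<bar> \<le> 3 * d\<^sup>2"
        using mab a2 by (smt (verit) zero_le_power2)
      have eq: "1 / p + 1 / q - 2 / m = - (m * (\<alpha> + \<beta>) + 2 * (\<alpha> * \<beta>)) / (p * q * m)"
        using pos by (simp add: \<alpha>_def \<beta>_def field_simps)
      define X where "X = max p q"
      define Y where "Y = min p q"
      have XY: "p * q = X * Y" by (auto simp: X_def Y_def max_def min_def)
      have Y0: "Y > 0" "X > 0" using pos by (auto simp: Y_def X_def)
      have "2 * X\<^sup>2 \<ge> p\<^sup>2 + q\<^sup>2" using pos by (auto simp: X_def max_def power_mono)
      then have "X\<^sup>2 \<ge> m\<^sup>2" "X\<^sup>2 \<ge> d\<^sup>2" using par zero_le_power2[of m] zero_le_power2[of d] by linarith+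
      then have X: "X \<ge> m" "X \<ge> d" using Y0 nn by (auto intro: power2_le_imp_le)
      have "\<bar>1 / p + 1 / q - 2 / m\<bar> \<le> 3 * d\<^sup>2 / (X * Y * m)"
        unfolding eq XY using pos Y0 num by (simp add: abs_mult divide_right_mono)
      also have "\<dots> \<le> 3 * (d powr (3/2) * (m powr (-3/2) * (1 / Y)))"
      proof -
        have "X = X powr (1/2) * X powr (1/2)" using Y0 by (simp add: powr_add[symmetric])
        also have "\<dots> \<ge> d powr (1/2) * m powr (1/2)"
          using X d pos by (intro mult_mono powr_mono2) auto
        finally have "d\<^sup>2 / (X * Y * m) \<le> d\<^sup>2 / (d powr (1/2) * m powr (1/2) * Y * m)"
          using Y0 pos d by (intro divide_left_mono mult_right_mono mult_pos_pos) auto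
        also have "\<dots> = (d\<^sup>2 * (1 / d powr (1/2))) * ((1 / m powr (1/2)) * (1 / m) * (1 / Y))"
          by simp
        also have "\<dots> = (d powr 2 * d powr (-1/2)) * (m powr (-1/2) * m powr (-1) * (1 / Y))"
          using d pos powr_minus_divide[of d "1/2"] powr_minus_divide[of m "1/2"] powr_minus_divide[of m 1]
          by simp
        also have "d powr 2 * d powr (-1/2) = d powr (3/2)"
          by (simp only: powr_add[symmetric]) simp
        also have "m powr (-1/2) * m powr (-1) = m powr (-3/2)"
          by (simp only: powr_add[symmetric]) simp
        finally show ?thesis by simp
      qed
      also have "m powr (-3/2) * (1 / Y) \<le> 2 * (?P Y + ?P m)"
      proof -
        have *: "m powr (-3/2) * Y powr (-1) \<le> ?P Y + ?P m"
        proof (cases "Y \<le> m")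
          case True
          have "m powr (-3/2) * Y powr (-1) \<le> Y powr (-3/2) * Y powr (-1)"
            using True Y0 by (intro mult_right_mono powr_mono2') auto
          also have "\<dots> = ?P Y" by (simp only: powr_add[symmetric]) simp
          finally show ?thesis by (rule add_increasing2[OF P0])
        next
          case False
          have "m powr (-3/2) * Y powr (-1) \<le> m powr (-3/2) * m powr (-1)"
            using False pos by (intro mult_left_mono powr_mono2') auto
          also have "\<dots> = ?P m" by (simp only: powr_add[symmetric]) simp
          finally show ?thesis by (rule add_increasing[OF P0])
        qed
        moreover have "Y powr (-1) = 1 / Y" using Y0 by (simp add: powr_neg_one)
        ultimately have "m powr (-3/2) * (1 / Y) \<le> ?P Y + ?P m" by simp
        moreover have "?P Y + ?P m \<le> 2 * (?P Y + ?P m)" by simp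
        ultimately show ?thesis by (rule order_trans)
      qed
      also have "?P Y + ?P m \<le> ?P p + ?P q + ?P m" by (auto simp: Y_def min_def)
      finally have "\<bar>1 / p + 1 / q - 2 / m\<bar> \<le> 3 * (d powr (3/2) * (2 * (?P p + ?P q + ?P m)))"
        by (simp add: mult_left_mono)
      then show ?thesis by (simp add: algebra_simps)
    qed
  qed
  then show ?thesis by (simp add: p_def q_def m_def d_def)
qed

lemma pot_second_difference:
  assumes f: "charge f"
  obtains C where "C > 0" "\<And>x h. \<bar>pot f (x + h) + pot f (x - h) - 2 * pot f x\<bar> \<le> C * norm h powr (3/2)"
proof -
  note [measurable] = charge_measurable[OF f]
  let ?P = "\<lambda>a::real. a powr (-5/2)"
  obtain C where C: "C > 0" "\<And>x. integrable lborel (\<lambda>y. \<bar>f y\<bar> * ?P (norm (x - y)))"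
     "\<And>x. (\<integral>y. \<bar>f y\<bar> * ?P (norm (x - y)) \<partial>lborel) \<le> C"
    using charge_riesz_bound[OF f, of "5/2"] by auto
  have "\<bar>pot f (x + h) + pot f (x - h) - 2 * pot f x\<bar> \<le> (18*C) * norm h powr (3/2)" for x h
  proof -
    let ?g = "\<lambda>y. f y / norm (x + h - y) + f y / norm (x - h - y) - 2 * (f y / norm (x - y))"
    let ?b = "\<lambda>y. 6 * norm h powr (3/2) * (\<bar>f y\<bar> * ?P (norm (x + h - y)) + \<bar>f y\<bar> * ?P (norm (x - h - y)) + \<bar>f y\<bar> * ?P (norm (x - y)))"
    have ig: "integrable lborel ?g"
      by (intro Bochner_Integration.integrable_add Bochner_Integration.integrable_diff integrable_mult_right integrable_pot[OF f])
    have "\<bar>pot f (x + h) + pot f (x - h) - 2 * pot f x\<bar> = \<bar>integral\<^sup>L lborel ?g\<bar>"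
    proof -
      have "integral\<^sup>L lborel ?g = (\<integral>y. f y / norm (x + h - y) \<partial>lborel) + (\<integral>y. f y / norm (x - h - y) \<partial>lborel)
          - (\<integral>y. 2 * (f y / norm (x - y)) \<partial>lborel)"
        by (simp only: Bochner_Integration.integral_add Bochner_Integration.integral_diff integrable_pot[OF f]
           Bochner_Integration.integrable_add integrable_mult_right)
      also have "(\<integral>y. 2 * (f y / norm (x - y)) \<partial>lborel) = 2 * pot f x"
        by (simp only: pot_def integral_mult_right_zero)
      finally show ?thesis by (simp only: pot_def)
    qed
    also have "\<dots> \<le> (\<integral>y. \<bar>?g y\<bar> \<partial>lborel)"
      by (rule integral_abs_bound)
    also have "\<dots> \<le> integral\<^sup>L lborel ?b"
    proof (rule integral_mono)
      show "integrable lborel (\<lambda>y. \<bar>?g y\<bar>)" using ig by simp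
      show "integrable lborel ?b" using C(2) by simp
      fix y
      have "?g y = f y * (1 / norm (x - y + h) + 1 / norm (x - y - h) - 2 / norm (x - y))"
        by (simp add: algebra_simps)
      then have "\<bar>?g y\<bar> = \<bar>f y\<bar> * \<bar>1 / norm (x - y + h) + 1 / norm (x - y - h) - 2 / norm (x - y)\<bar>"
        by (simp add: abs_mult)
      also have "\<dots> \<le> \<bar>f y\<bar> * (6 * norm h powr (3/2) * (?P (norm (x - y + h)) + ?P (norm (x - y - h)) + ?P (norm (x - y))))"
        by (intro mult_left_mono kernel_second_difference) auto
      finally show "\<bar>?g y\<bar> \<le> ?b y"
        by (simp add: algebra_simps)
    qed
    also have "\<dots> = 6 * norm h powr (3/2) * ((\<integral>y. \<bar>f y\<bar> * ?P (norm (x + h - y)) \<partial>lborel)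
        + (\<integral>y. \<bar>f y\<bar> * ?P (norm (x - h - y)) \<partial>lborel) + (\<integral>y. \<bar>f y\<bar> * ?P (norm (x - y)) \<partial>lborel))"
      using C(2) by simp
    also have "\<dots> \<le> 6 * norm h powr (3/2) * (C + C + C)"
      using C(3) by (intro mult_left_mono add_mono) auto
    finally show ?thesis by (simp add: algebra_simps)
  qed
  then show ?thesis using C(1) that[of "18*C"] by simp
qed

section \<open>The Coulomb energy\<close>

lemma mult_pot: "c * pot g x = (\<integral>y. c * (g y / norm (x - y)) \<partial>lborel)"
  by (simp only: pot_def integral_mult_right_zero)

definition energy :: "(real^3 \<Rightarrow> real) \<Rightarrow> (real^3 \<Rightarrow> real) \<Rightarrow> real" where
  "energy f g = (\<integral>x. f x * pot g x \<partial>lborel)"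

lemma integrable_energy:
  assumes f: "charge f" and g: "charge g"
  shows "integrable lborel (\<lambda>x. f x * pot g (a + x))"
proof -
  note [measurable] = charge_measurable[OF f] pot_measurable[OF g]
  obtain C where C: "C > 0" "\<And>x. \<bar>pot g x\<bar> \<le> C" using pot_bounded[OF g] by blast
  have "integrable lborel (\<lambda>x. C * \<bar>f x\<bar>)" using charge_integrable[OF f] by simp
  moreover have "\<bar>f x * pot g (a + x)\<bar> \<le> C * \<bar>f x\<bar>" for x
    using mult_right_mono[OF C(2)[of "a + x"], of "\<bar>f x\<bar>"] by (simp add: abs_mult mult.commute)
  moreover have "(\<lambda>x. f x * pot g (a + x)) \<in> borel_measurable borel" by measurable
  ultimately show ?thesis by (metis (no_types, lifting) integrable_dominated)
qed

lemma integrable_energy0: "charge f \<Longrightarrow> charge g \<Longrightarrow> integrable lborel (\<lambda>x. f x * pot g x)"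
  using integrable_energy[of f g 0] by simp

lemma integrable_pair_kernel:
  assumes f: "charge f" and g: "charge g"
  shows "integrable (lborel \<Otimes>\<^sub>M lborel) (\<lambda>(x, y). f x * (g y / norm (x - y)))"
proof (rule lborel_pair.Fubini_integrable)
  note [measurable] = charge_measurable[OF f] charge_measurable[OF g]
  show "(\<lambda>(x, y). f x * (g y / norm (x - y))) \<in> borel_measurable (lborel \<Otimes>\<^sub>M lborel)" by measurable
  have ag: "charge (\<lambda>y. \<bar>g y\<bar>)" by (rule charge_cong_bound[OF g]) auto
  have "(\<lambda>x. \<integral>y. norm (case (x, y) of (x, y) \<Rightarrow> f x * (g y / norm (x - y))) \<partial>lborel) = (\<lambda>x. \<bar>f x\<bar> * pot (\<lambda>y. \<bar>g y\<bar>) x)"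
    by (simp only: mult_pot prod.case real_norm_def abs_mult abs_divide abs_norm_cancel)
  moreover have "integrable lborel (\<lambda>x. \<bar>f x\<bar> * pot (\<lambda>y. \<bar>g y\<bar>) x)"
    by (rule integrable_energy0[OF charge_cong_bound[OF f] ag]) auto
  ultimately show "integrable lborel (\<lambda>x. \<integral>y. norm (case (x, y) of (x, y) \<Rightarrow> f x * (g y / norm (x - y))) \<partial>lborel)"
    by simp
  show "AE x in lborel. integrable lborel (\<lambda>y. case (x, y) of (x, y) \<Rightarrow> f x * (g y / norm (x - y)))"
    by (simp only: prod.case) (intro AE_I2 integrable_mult_right integrable_pot[OF g])
qed

lemma energy_commute:
  assumes f: "charge f" and g: "charge g"
  shows "energy f g = energy g f"
proof -
  have "energy f g = (\<integral>x. (\<integral>y. f x * (g y / norm (x - y)) \<partial>lborel) \<partial>lborel)"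
    by (simp only: energy_def mult_pot)
  also have "\<dots> = (\<integral>y. (\<integral>x. f x * (g y / norm (x - y)) \<partial>lborel) \<partial>lborel)"
    by (rule lborel_pair.Fubini_integral[symmetric]) (rule integrable_pair_kernel[OF f g])
  also have "\<dots> = (\<integral>y. (\<integral>x. g y * (f x / norm (y - x)) \<partial>lborel) \<partial>lborel)"
    by (intro Bochner_Integration.integral_cong refl) (simp add: norm_minus_commute mult.commute)
  finally show ?thesis by (simp only: energy_def mult_pot)
qed

lemma energy_add_left:
  "charge f \<Longrightarrow> charge f' \<Longrightarrow> charge g \<Longrightarrow> energy (\<lambda>x. f x + f' x) g = energy f g + energy f' g"
  unfolding energy_def by (simp add: distrib_right integrable_energy0)

lemma energy_diff_left:
  "charge f \<Longrightarrow> charge f' \<Longrightarrow> charge g \<Longrightarrow> energy (\<lambda>x. f x - f' x) g = energy f g - energy f' g"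
  unfolding energy_def by (simp add: left_diff_distrib integrable_energy0)

lemma energy_scale_left: "energy (\<lambda>x. c * f x) g = c * energy f g"
  unfolding energy_def by (simp add: mult.assoc)

lemma energy_add_right:
  "charge f \<Longrightarrow> charge f' \<Longrightarrow> charge g \<Longrightarrow> energy g (\<lambda>x. f x + f' x) = energy g f + energy g f'"
  unfolding energy_def by (simp add: distrib_left integrable_energy0 pot_add)

lemma energy_diff_right:
  "charge f \<Longrightarrow> charge f' \<Longrightarrow> charge g \<Longrightarrow> energy g (\<lambda>x. f x - f' x) = energy g f - energy g f'"
  unfolding energy_def by (simp add: right_diff_distrib integrable_energy0 pot_diff)

lemma energy_scale_right: "energy g (\<lambda>x. c * f x) = c * energy g f"
  unfolding energy_def by (simp add: pot_scale mult.left_commute)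

text \<open>The kernel \<open>1 / \<bar>x - y\<bar>\<close> is, up to a constant, the composition of \<open>1 / \<bar>x - z\<bar>\<^sup>2\<close> with itself:
  translations, rotations and dilations act on the composed kernel exactly as on \<open>1 / \<bar>x - y\<bar>\<close>,
  so the two agree as soon as one value is finite and positive.\<close>

definition riesz2 :: "real^3 \<Rightarrow> real^3 \<Rightarrow> ennreal" where
  "riesz2 x y = (\<integral>\<^sup>+z. ennreal (norm (x - z) powr (-2) * norm (y - z) powr (-2)) \<partial>lborel)"

lemma riesz2_translate: "riesz2 (x + a) (y + a) = riesz2 x y"
proof -
  have "riesz2 x y = (\<integral>\<^sup>+z. (\<lambda>z. ennreal (norm (x + a - z) powr (-2) * norm (y + a - z) powr (-2))) (a + z) \<partial>lborel)"
    unfolding riesz2_def by (simp add: algebra_simps)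
  also have "\<dots> = riesz2 (x + a) (y + a)"
    unfolding riesz2_def by (rule nn_integral_translate) measurable
  finally show ?thesis by simp
qed

lemma riesz2_orthogonal:
  assumes f: "orthogonal_transformation f"
  shows "riesz2 (f x) (f y) = riesz2 x y"
proof -
  have "riesz2 (f x) (f y) = (\<integral>\<^sup>+z. ennreal (norm (f x - f z) powr (-2) * norm (f y - f z) powr (-2)) \<partial>lborel)"
    unfolding riesz2_def
    by (rule nn_integral_orthogonal[OF f, symmetric, of "\<lambda>z. ennreal (norm (f x - z) powr (-2) * norm (f y - z) powr (-2))"]) measurable
  also have "\<dots> = riesz2 x y"
  proof -
    have "norm (f u - f z) = norm (u - z)" for u z
      using f by (metis linear_diff orthogonal_transformation)
    then show ?thesis by (simp add: riesz2_def)
  qed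
  finally show ?thesis .
qed

lemma riesz2_scale:
  assumes c: "c > 0"
  shows "riesz2 0 (c *\<^sub>R x) = ennreal (1 / c) * riesz2 0 x"
proof -
  have "riesz2 0 (c *\<^sub>R x) = ennreal (c^3) * (\<integral>\<^sup>+z. ennreal (norm (0 - c *\<^sub>R z) powr (-2) * norm (c *\<^sub>R x - c *\<^sub>R z) powr (-2)) \<partial>lborel)"
    unfolding riesz2_def by (rule nn_integral_scale[OF _ c]) measurable
  also have "\<dots> = ennreal (c^3) * (\<integral>\<^sup>+z. ennreal (c powr (-4)) * ennreal (norm (0 - z) powr (-2) * norm (x - z) powr (-2)) \<partial>lborel)"
  proof (intro arg_cong2[where f="(*)"] refl nn_integral_cong)
    fix z
    have "norm (c *\<^sub>R x - c *\<^sub>R z) = c * norm (x - z)"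
      using c by (simp flip: scaleR_diff_right)
    then have "norm (0 - c *\<^sub>R z) powr (-2) * norm (c *\<^sub>R x - c *\<^sub>R z) powr (-2)
      = (c powr (-2) * c powr (-2)) * (norm (0 - z) powr (-2) * norm (x - z) powr (-2))"
      using c by (simp add: powr_mult)
    also have "c powr (-2) * c powr (-2) = c powr (-4)" by (simp flip: powr_add)
    finally show "ennreal (norm (0 - c *\<^sub>R z) powr (-2) * norm (c *\<^sub>R x - c *\<^sub>R z) powr (-2)) =
       ennreal (c powr (-4)) * ennreal (norm (0 - z) powr (-2) * norm (x - z) powr (-2))"
      by (simp add: ennreal_mult')
  qed
  also have "\<dots> = ennreal (c^3 * c powr (-4)) * riesz2 0 x"
    using c by (simp add: nn_integral_cmult riesz2_def ennreal_mult' mult.assoc)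
  also have "c^3 * c powr (-4) = 1 / c"
  proof -
    have "c^3 = c powr 3" using c by (simp add: powr_numeral)
    then have "c^3 * c powr (-4) = c powr (-1)" by (simp flip: powr_add)
    then show ?thesis using c by (simp add: powr_neg_one)
  qed
  finally show ?thesis .
qed

text \<open>At every point the larger of the distances to \<open>0\<close> and \<open>e\<close> is at least \<open>1 / 2\<close>, so the integrand is bounded by a radial function of the smaller distance that decays like its inverse fourth power.\<close>

lemma riesz2_unit_finite:
  assumes e: "norm e = 1"
  shows "riesz2 0 e < \<infinity>"
proof -
  let ?G = "\<lambda>r::real. ennreal (r powr (-2) * (4 * indicator {..1} r + r powr (-2) * indicator {1<..} r))"
  let ?H = "\<lambda>z::real^3. ?G (norm z)"
  have bound: "norm (0 - z) powr (-2) * norm (e - z) powr (-2)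
      \<le> norm z powr (-2) * (4 * indicator {..1} (norm z) + norm z powr (-2) * indicator {1<..} (norm z))
       + norm (-e+z) powr (-2) * (4 * indicator {..1} (norm (-e+z)) + norm (-e+z) powr (-2) * indicator {1<..} (norm (-e+z)))"
    (is "_ \<le> ?A (norm z) + ?A (norm (-e+z))") for z
  proof -
    define a b where "a = norm z" and "b = norm (e - z)"
    have nn: "a \<ge> 0" "b \<ge> 0" by (auto simp: a_def b_def)
    have ab: "a + b \<ge> 1" using norm_triangle_ineq[of z "e - z"] e by (simp add: a_def b_def)
    have A0: "?A r \<ge> 0" for r by simp
    have key: "r powr (-2) * s powr (-2) \<le> ?A r" if "0 \<le> r" "r \<le> s" "r + s \<ge> 1" for r s :: real
    proof (cases "r \<le> 1")
      case True
      have "s powr (-2) \<le> (1/2) powr (-2)" using that by (intro powr_mono2') auto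
      also have "(1/2::real) powr (-2) = 4" by (simp add: powr_minus power2_eq_square)
      finally show ?thesis using True by (simp add: mult_left_mono)
    next
      case False
      have "s powr (-2) \<le> r powr (-2)" using that False by (intro powr_mono2') auto
      then show ?thesis using False by (simp add: mult_left_mono)
    qed
    have "a powr (-2) * b powr (-2) \<le> ?A a + ?A b"
    proof (cases "a \<le> b")
      case True
      then show ?thesis using key[of a b] nn ab A0[of b] by linarith
    next
      case False
      then have "b powr (-2) * a powr (-2) \<le> ?A b" using key[of b a] nn ab by simp
      then have "a powr (-2) * b powr (-2) \<le> ?A b" by (simp only: mult.commute)
      then show ?thesis by (rule add_increasing[OF A0])
    qed
    then show ?thesis by (simp add: a_def b_def norm_minus_commute)
  qed
  have "riesz2 0 e \<le> (\<integral>\<^sup>+z. ?H z + ?H (- e + z) \<partial>lborel)"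
    unfolding riesz2_def
  proof (rule nn_integral_mono)
    fix z
    have "ennreal (norm (0 - z) powr (-2) * norm (e - z) powr (-2)) \<le> ennreal (norm z powr (-2) * (4 * indicator {..1} (norm z) + norm z powr (-2) * indicator {1<..} (norm z))
       + norm (-e+z) powr (-2) * (4 * indicator {..1} (norm (-e+z)) + norm (-e+z) powr (-2) * indicator {1<..} (norm (-e+z))))"
      by (rule ennreal_leI) (rule bound)
    then show "ennreal (norm (0 - z) powr (-2) * norm (e - z) powr (-2)) \<le> ?H z + ?H (- e + z)"
      by (subst (asm) ennreal_plus) auto
  qed
  also have "\<dots> = (\<integral>\<^sup>+z. ?H z \<partial>lborel) + (\<integral>\<^sup>+z. ?H (- e + z) \<partial>lborel)"
    by (rule nn_integral_add) measurable
  also have "(\<integral>\<^sup>+z. ?H (- e + z) \<partial>lborel) = (\<integral>\<^sup>+z. ?H z \<partial>lborel)"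
    by (rule nn_integral_translate) measurable
  also have "(\<integral>\<^sup>+z. ?H z \<partial>lborel) + (\<integral>\<^sup>+z. ?H z \<partial>lborel) < \<infinity>"
  proof -
    have "(\<integral>\<^sup>+z. ?H z \<partial>lborel) = (\<integral>\<^sup>+r. ennreal (4 * pi * r\<^sup>2) * ?G r * indicator {0..} r \<partial>lborel)"
      by (rule nn_integral_radial) measurable
    also have "\<dots> \<le> (\<integral>\<^sup>+r. ennreal (16 * pi) * indicator {0..1} r + ennreal (4*pi * (1 / r\<^sup>2)) * indicator {1..} r \<partial>lborel)"
    proof (rule nn_integral_mono)
      fix r :: real
      have p: "r powr (-2) = 1 / r\<^sup>2" if "r > 0" using that by (simp add: powr_minus divide_inverse)
      consider "r < 0" | "r = 0" | "0 < r \<and> r \<le> 1" | "r > 1" by linarith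
      then show "ennreal (4 * pi * r\<^sup>2) * ?G r * indicator {0..} r
          \<le> ennreal (16 * pi) * indicator {0..1} r + ennreal (4*pi * (1 / r\<^sup>2)) * indicator {1..} r"
      proof cases
        case 3
        then have "4 * pi * r\<^sup>2 * (r powr (-2) * 4) = 16 * pi" by (simp add: p)
        then have "ennreal (4 * pi * r\<^sup>2) * ennreal (r powr (-2) * 4) = ennreal (16 * pi)"
          by (simp flip: ennreal_mult')
        then show ?thesis using 3 by simp
      next
        case 4
        then have "4 * pi * r\<^sup>2 * (r powr (-2) * r powr (-2)) = 4 * pi * (1 / r\<^sup>2)"
          by (simp add: p power2_eq_square)
        then have "ennreal (4 * pi * r\<^sup>2) * ennreal (r powr (-2) * r powr (-2)) = ennreal (4 * pi * (1 / r\<^sup>2))"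
          by (simp flip: ennreal_mult')
        then show ?thesis using 4 by simp
      qed auto
    qed
    also have "\<dots> = (\<integral>\<^sup>+r. ennreal (16 * pi) * indicator {0..1::real} r \<partial>lborel) + (\<integral>\<^sup>+r. ennreal (4*pi * (1 / r\<^sup>2)) * indicator {1::real..} r \<partial>lborel)"
      by (rule nn_integral_add) measurable
    also have "(\<integral>\<^sup>+r. ennreal (4*pi * (1 / r\<^sup>2)) * indicator {1::real..} r \<partial>lborel) = ennreal (0 - - (4*pi) / 1)"
    proof (rule nn_integral_FTC_atLeast)
      fix x :: real assume "1 \<le> x"
      then show "((\<lambda>x. - (4*pi) / x) has_real_derivative 4 * pi * (1 / x\<^sup>2)) (at x)"
        by (auto intro!: derivative_eq_intros simp: power2_eq_square)
    next
      show "((\<lambda>x. - (4*pi) / x) \<longlongrightarrow> 0) at_top"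
        by (rule real_tendsto_divide_at_top[OF tendsto_const filterlim_ident])
    qed auto
    finally have "(\<integral>\<^sup>+z. ?H z \<partial>lborel) < \<infinity>"
      by (auto simp: nn_integral_cmult ennreal_mult_less_top intro: le_less_trans)
    then show ?thesis by simp
  qed
  finally show ?thesis .
qed

lemma riesz2_unit_pos:
  assumes e: "norm e = 1"
  shows "riesz2 0 e > 0"
proof (rule ccontr)
  assume "\<not> ?thesis"
  then have "riesz2 0 e = 0" by simp
  then have "AE z in lborel. norm (0 - z) powr (-2) * norm (e - z) powr (-2) \<le> (0::real)"
    unfolding riesz2_def by (subst (asm) nn_integral_0_iff_AE) (auto simp: ennreal_eq_0_iff)
  moreover have "AE z in lborel. z \<noteq> (0::real^3)" by (rule AE_lborel_singleton)
  moreover have "AE z in lborel. z \<noteq> e" by (rule AE_lborel_singleton)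
  ultimately have "AE z in (lborel :: (real^3) measure). False"
  proof eventually_elim
    case (elim z)
    then have "norm (0 - z) powr (-2) * norm (e - z) powr (-2) > (0::real)" by simp
    then show ?case using elim by linarith
  qed
  then show False by (simp add: AE_iff_null null_sets_def)
qed

lemma riesz2_eq:
  obtains \<kappa> :: real where "\<kappa> > 0" "\<And>x y. x \<noteq> y \<Longrightarrow> riesz2 x y = ennreal (\<kappa> / norm (x - y))"
proof -
  define e :: "real^3" where "e = axis 1 1"
  have e: "norm e = 1" by (simp add: e_def)
  define \<kappa> where "\<kappa> = enn2real (riesz2 0 e)"
  have k: "riesz2 0 e = ennreal \<kappa>" "\<kappa> > 0"
    using riesz2_unit_finite[OF e] riesz2_unit_pos[OF e] by (auto simp: \<kappa>_def enn2real_positive_iff)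
  have "riesz2 x y = ennreal (\<kappa> / norm (x - y))" if "x \<noteq> y" for x y
  proof -
    define d where "d = norm (y - x)"
    have d: "d > 0" using that by (simp add: d_def)
    have "norm e = norm ((1/d) *\<^sub>R (y - x))" using d e by (simp add: d_def)
    then obtain f where f: "orthogonal_transformation f" "f e = (1/d) *\<^sub>R (y - x)"
      using orthogonal_transformation_exists by metis
    have "f 0 = 0" using f(1) by (simp add: orthogonal_transformation_def linear_0)
    have "riesz2 x y = riesz2 (0 + x) ((y - x) + x)" by simp
    also have "\<dots> = riesz2 0 (y - x)" by (rule riesz2_translate)
    also have "\<dots> = riesz2 0 (d *\<^sub>R f e)" using d by (simp add: f)
    also have "\<dots> = ennreal (1/d) * riesz2 (f 0) (f e)" using riesz2_scale[OF d] \<open>f 0 = 0\<close> by simp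
    also have "\<dots> = ennreal (1/d) * ennreal \<kappa>" using riesz2_orthogonal[OF f(1)] k by simp
    also have "\<dots> = ennreal (\<kappa> / norm (x - y))"
      using d k(2) by (simp flip: ennreal_mult' add: d_def norm_minus_commute)
    finally show ?thesis .
  qed
  then show ?thesis using k(2) that by blast
qed

lemma ennreal_am_gm: "2 * (a * b) \<le> a * a + b * (b::ennreal)"
proof (cases "a = top \<or> b = top")
  case True
  then show ?thesis by (auto simp: ennreal_top_mult ennreal_mult_top top_unique)
next
  case False
  then obtain r s where r: "a = ennreal r" "r \<ge> 0" and s: "b = ennreal s" "s \<ge> 0"
    by (metis ennreal_cases)
  have "2 * (r * s) \<le> r * r + s * s"
    using sum_squares_bound[of r s] by (simp add: power2_eq_square)
  then have "ennreal (2 * (r * s)) \<le> ennreal (r * r + s * s)" by (rule ennreal_leI)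
  then show ?thesis using r s by (simp add: ennreal_mult' ennreal_plus)
qed

lemma energy_nn_integral:
  assumes f: "charge f" and g: "charge g" and nn: "\<And>x. f x \<ge> 0" "\<And>x. g x \<ge> 0"
    and k: "\<kappa> > 0" "\<And>x y. x \<noteq> y \<Longrightarrow> riesz2 x y = ennreal (\<kappa> / norm (x - y))"
  shows "ennreal (\<kappa> * energy f g) =
    (\<integral>\<^sup>+z. (\<integral>\<^sup>+x. ennreal (f x * norm (x - z) powr (-2)) \<partial>lborel) * (\<integral>\<^sup>+y. ennreal (g y * norm (y - z) powr (-2)) \<partial>lborel) \<partial>lborel)"
proof -
  note [measurable] = charge_measurable[OF f] charge_measurable[OF g]
  have pg: "pot g x \<ge> 0" for x unfolding pot_def by (intro integral_nonneg_AE AE_I2) (simp add: nn)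
  have "ennreal (\<kappa> * energy f g) = (\<integral>\<^sup>+x. ennreal (\<kappa> * (f x * pot g x)) \<partial>lborel)"
    using k(1) nn pg integrable_energy0[OF f g]
    by (subst nn_integral_eq_integral) (auto simp: energy_def)
  also have "\<dots> = (\<integral>\<^sup>+x. ennreal (f x) * (\<integral>\<^sup>+y. ennreal (g y) * riesz2 x y \<partial>lborel) \<partial>lborel)"
  proof (rule nn_integral_cong)
    fix x
    have "ennreal (\<kappa> * pot g x) = (\<integral>\<^sup>+y. ennreal (\<kappa> * (g y / norm (x - y))) \<partial>lborel)"
    proof (subst nn_integral_eq_integral)
      show "integrable lborel (\<lambda>y. \<kappa> * (g y / norm (x - y)))" by (intro integrable_mult_right integrable_pot g)
      show "AE y in lborel. 0 \<le> \<kappa> * (g y / norm (x - y))" using k(1) nn by simp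
    qed (simp only: mult_pot)
    also have "\<dots> = (\<integral>\<^sup>+y. ennreal (g y) * riesz2 x y \<partial>lborel)"
    proof (rule nn_integral_cong_AE)
      show "AE y in lborel. ennreal (\<kappa> * (g y / norm (x - y))) = ennreal (g y) * riesz2 x y"
        using AE_lborel_singleton[of x]
      proof eventually_elim
        case (elim y)
        then have "riesz2 x y = ennreal (\<kappa> / norm (x - y))" using k(2)[of x y] by simp
        then show ?case using nn k(1) by (simp flip: ennreal_mult add: mult.commute)
      qed
    qed
    moreover have "ennreal (\<kappa> * (f x * pot g x)) = ennreal (f x) * ennreal (\<kappa> * pot g x)"
      using nn k(1) pg[of x] by (simp add: mult.left_commute flip: ennreal_mult)
    ultimately show "ennreal (\<kappa> * (f x * pot g x)) = ennreal (f x) * (\<integral>\<^sup>+y. ennreal (g y) * riesz2 x y \<partial>lborel)"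
      by (simp only:)
  qed
  also have "\<dots> = (\<integral>\<^sup>+x. \<integral>\<^sup>+y. \<integral>\<^sup>+z. ennreal (f x * norm (x - z) powr (-2)) * ennreal (g y * norm (y - z) powr (-2)) \<partial>lborel \<partial>lborel \<partial>lborel)"
  proof (rule nn_integral_cong)
    fix x
    have "(\<integral>\<^sup>+y. ennreal (g y) * riesz2 x y \<partial>lborel) = (\<integral>\<^sup>+y. \<integral>\<^sup>+z. ennreal (norm (x - z) powr (-2)) * ennreal (g y * norm (y - z) powr (-2)) \<partial>lborel \<partial>lborel)"
      unfolding riesz2_def
      by (intro nn_integral_cong, subst nn_integral_cmult[symmetric])
        (auto intro!: nn_integral_cong simp: nn mult_ac simp flip: ennreal_mult)
    then have "ennreal (f x) * (\<integral>\<^sup>+y. ennreal (g y) * riesz2 x y \<partial>lborel) = 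
       ennreal (f x) * (\<integral>\<^sup>+y. \<integral>\<^sup>+z. ennreal (norm (x - z) powr (-2)) * ennreal (g y * norm (y - z) powr (-2)) \<partial>lborel \<partial>lborel)"
      by simp
    also have "\<dots> = (\<integral>\<^sup>+y. ennreal (f x) * (\<integral>\<^sup>+z. ennreal (norm (x - z) powr (-2)) * ennreal (g y * norm (y - z) powr (-2)) \<partial>lborel) \<partial>lborel)"
      by (rule nn_integral_cmult[symmetric]) measurable
    also have "\<dots> = (\<integral>\<^sup>+y. \<integral>\<^sup>+z. ennreal (f x * norm (x - z) powr (-2)) * ennreal (g y * norm (y - z) powr (-2)) \<partial>lborel \<partial>lborel)"
      by (intro nn_integral_cong, subst nn_integral_cmult[symmetric])
        (auto intro!: nn_integral_cong simp: nn mult_ac simp flip: ennreal_mult)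
    finally show "ennreal (f x) * (\<integral>\<^sup>+y. ennreal (g y) * riesz2 x y \<partial>lborel) = \<dots>" .
  qed
  also have "\<dots> = (\<integral>\<^sup>+x. \<integral>\<^sup>+z. \<integral>\<^sup>+y. ennreal (f x * norm (x - z) powr (-2)) * ennreal (g y * norm (y - z) powr (-2)) \<partial>lborel \<partial>lborel \<partial>lborel)"
    by (intro nn_integral_cong lborel_pair.Fubini') measurable
  also have "\<dots> = (\<integral>\<^sup>+x. \<integral>\<^sup>+z. ennreal (f x * norm (x - z) powr (-2)) * (\<integral>\<^sup>+y. ennreal (g y * norm (y - z) powr (-2)) \<partial>lborel) \<partial>lborel \<partial>lborel)"
    by (intro nn_integral_cong nn_integral_cmult) measurable
  also have "\<dots> = (\<integral>\<^sup>+z. \<integral>\<^sup>+x. ennreal (f x * norm (x - z) powr (-2)) * (\<integral>\<^sup>+y. ennreal (g y * norm (y - z) powr (-2)) \<partial>lborel) \<partial>lborel \<partial>lborel)"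
    by (intro lborel_pair.Fubini') measurable
  also have "\<dots> = (\<integral>\<^sup>+z. (\<integral>\<^sup>+x. ennreal (f x * norm (x - z) powr (-2)) \<partial>lborel) * (\<integral>\<^sup>+y. ennreal (g y * norm (y - z) powr (-2)) \<partial>lborel) \<partial>lborel)"
    by (intro nn_integral_cong nn_integral_multc) measurable
  finally show ?thesis .
qed

text \<open>Factoring the kernel through \<open>1 / \<bar>x - z\<bar>\<^sup>2\<close> turns the energy into the integral of a square.  Tonelli's theorem is applied to the positive and negative parts separately, and the three resulting integrals are combined by \<open>2 a b \<le> a\<^sup>2 + b\<^sup>2\<close> under the integral sign.\<close>

theorem energy_nonneg:
  assumes f: "charge f"
  shows "energy f f \<ge> 0"
proof -
  note [measurable] = charge_measurable[OF f]
  define p n where "p = (\<lambda>x. max (f x) 0)" and "n = (\<lambda>x. max (- f x) 0)"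
  have cp: "charge p" and cn: "charge n"
    by (rule charge_cong_bound[OF f]; auto simp: p_def n_def)+
  note [measurable] = charge_measurable[OF cp] charge_measurable[OF cn]
  have nn: "p x \<ge> 0" "n x \<ge> 0" for x by (auto simp: p_def n_def)
  have f_eq: "f = (\<lambda>x. p x - n x)" by (auto simp: p_def n_def fun_eq_iff)
  obtain \<kappa> where k: "\<kappa> > 0" "\<And>x y. x \<noteq> y \<Longrightarrow> riesz2 x y = ennreal (\<kappa> / norm (x - y))" using riesz2_eq by metis
  define F where "F g z = (\<integral>\<^sup>+x. ennreal (g x * norm (x - z) powr (-2)) \<partial>lborel)" for g :: "real^3 \<Rightarrow> real" and z
  have [measurable]: "F p \<in> borel_measurable borel" "F n \<in> borel_measurable borel"
    unfolding F_def[abs_def] by measurable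
  have e: "energy g h \<ge> 0" if "\<And>x. g x \<ge> 0" "\<And>x. h x \<ge> 0" for g h
    unfolding energy_def pot_def using that by (intro integral_nonneg_AE AE_I2 mult_nonneg_nonneg) auto
  have "ennreal (2 * (\<kappa> * energy p n)) = (\<integral>\<^sup>+z. 2 * (F p z * F n z) \<partial>lborel)"
  proof -
    have "ennreal (\<kappa> * energy p n) = (\<integral>\<^sup>+z. F p z * F n z \<partial>lborel)"
      unfolding F_def by (rule energy_nn_integral[OF cp cn nn k])
    then show ?thesis
      using e[of p n] nn k(1) by (subst nn_integral_cmult, measurable) (simp add: ennreal_mult)
  qed
  also have "\<dots> \<le> (\<integral>\<^sup>+z. F p z * F p z + F n z * F n z \<partial>lborel)"
    by (intro nn_integral_mono ennreal_am_gm)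
  also have "\<dots> = (\<integral>\<^sup>+z. F p z * F p z \<partial>lborel) + (\<integral>\<^sup>+z. F n z * F n z \<partial>lborel)"
    by (rule nn_integral_add) measurable
  also have "\<dots> = ennreal (\<kappa> * energy p p) + ennreal (\<kappa> * energy n n)"
    unfolding F_def
    by (rule arg_cong2[where f="(+)"]; rule energy_nn_integral[symmetric]) (use cp cn nn k in auto)
  also have "\<dots> = ennreal (\<kappa> * energy p p + \<kappa> * energy n n)"
    using e nn k(1) by (intro ennreal_plus[symmetric]) auto
  finally have "2 * (\<kappa> * energy p n) \<le> \<kappa> * energy p p + \<kappa> * energy n n"
    using e nn k(1) by (subst (asm) ennreal_le_iff) auto
  then have "\<kappa> * (energy p p - energy p n - energy n p + energy n n) \<ge> 0"
    using energy_commute[OF cp cn] by (simp add: algebra_simps)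
  then have "energy p p - energy p n - energy n p + energy n n \<ge> 0"
    using k(1) by (simp add: zero_le_mult_iff)
  moreover have "energy f f = energy p p - energy p n - energy n p + energy n n"
    unfolding f_eq by (simp add: energy_diff_left energy_diff_right cp cn charge_diff)
  ultimately show ?thesis by simp
qed

lemma energy_quadratic_nonneg:
  assumes "charge g" "charge f" "charge k"
  shows "0 \<le> energy g g + x\<^sup>2 * energy f f + y\<^sup>2 * energy k k
     + 2 * x * energy g f + 2 * y * energy g k + 2 * x * y * energy f k"
proof -
  have c: "charge (\<lambda>z. x * f z)" "charge (\<lambda>z. y * k z)" "charge (\<lambda>z. x * f z + y * k z)"
    using assms by (auto intro: charge_scale charge_add)
  have "0 \<le> energy (\<lambda>z. g z + (x * f z + y * k z)) (\<lambda>z. g z + (x * f z + y * k z))"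
    by (intro energy_nonneg charge_add assms c)
  also have "\<dots> = energy g g + x * energy g f + y * energy g k + x * energy f g + x*x*energy f f + x*y*energy f k
     + y * energy k g + y*x*energy k f + y*y*energy k k"
    using assms c by (simp add: energy_add_left energy_add_right charge_add energy_scale_left energy_scale_right algebra_simps)
  finally show ?thesis
    using energy_commute[of f g] energy_commute[of k g] energy_commute[of k f] assms
    by (simp add: power2_eq_square algebra_simps)
qed

section \<open>Moments of radial weights\<close>

lemma pred_in_ball[measurable (raw)]:
  fixes f :: "'a \<Rightarrow> real^3"
  assumes [measurable]: "f \<in> borel_measurable M"
  shows "Measurable.pred M (\<lambda>x. f x \<in> ball c r)"
  unfolding mem_ball by measurable

lemma integral_odd:
  fixes g :: "real^3 \<Rightarrow> real"
  assumes "g \<in> borel_measurable borel" "\<And>y. g (- y) = - g y"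
  shows "(\<integral>y. g y \<partial>lborel) = 0"
proof -
  have "(\<integral>y. g (- y) \<partial>lborel) = (\<integral>y. g y \<partial>lborel)"
    by (rule integral_orthogonal[OF _ assms(1)]) (simp add: orthogonal_transformation_neg)
  then show ?thesis by (simp add: assms(2))
qed

lemma inner_orthogonal_transformation: "orthogonal_transformation f \<Longrightarrow> f x \<bullet> f y = x \<bullet> y"
  by (simp add: orthogonal_transformation_def)

lemma integrable_second_moment:
  fixes w :: "real^3 \<Rightarrow> real"
  assumes "w \<in> borel_measurable borel" and i: "integrable lborel (\<lambda>y. w y * (norm y)\<^sup>2)"
  shows "integrable lborel (\<lambda>y. w y * ((a \<bullet> y) * (b \<bullet> y)))"
proof (rule integrable_dominated)
  note [measurable] = assms(1)
  show "integrable lborel (\<lambda>y. norm a * norm b * \<bar>w y * (norm y)\<^sup>2\<bar>)"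
    by (intro integrable_mult_right integrable_abs i)
  show "(\<lambda>y. w y * ((a \<bullet> y) * (b \<bullet> y))) \<in> borel_measurable borel" by measurable
  fix y
  have "\<bar>a \<bullet> y\<bar> * \<bar>b \<bullet> y\<bar> \<le> (norm a * norm y) * (norm b * norm y)"
    by (intro mult_mono Cauchy_Schwarz_ineq2) auto
  then have "\<bar>w y\<bar> * (\<bar>a \<bullet> y\<bar> * \<bar>b \<bullet> y\<bar>) \<le> \<bar>w y\<bar> * ((norm a * norm y) * (norm b * norm y))"
    by (rule mult_left_mono) auto
  then show "\<bar>w y * ((a \<bullet> y) * (b \<bullet> y))\<bar> \<le> norm a * norm b * \<bar>w y * (norm y)\<^sup>2\<bar>"
    by (simp add: abs_mult power2_eq_square algebra_simps)
qed

lemma orthogonal_maps: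
  fixes a b :: "real^3"
  shows "norm a = norm b \<Longrightarrow> \<exists>f. orthogonal_transformation f \<and> f a = b"
  by (metis orthogonal_transformation_exists)

text \<open>The quadratic form \<open>a \<mapsto> \<integral> w (a \<bullet> y)\<^sup>2\<close> is invariant under orthogonal transformations, hence a multiple of \<open>a \<bullet> a\<close>; summing over the coordinate axes gives the factor, and polarisation the bilinear version.\<close>

lemma second_moment:
  fixes w :: "real^3 \<Rightarrow> real"
  assumes m[measurable]: "w \<in> borel_measurable borel" and i: "integrable lborel (\<lambda>y. w y * (norm y)\<^sup>2)"
    and inv: "\<And>f y. orthogonal_transformation f \<Longrightarrow> w (f y) = w y"
  shows "(\<integral>y. w y * ((a \<bullet> y) * (b \<bullet> y)) \<partial>lborel) = (a \<bullet> b) / 3 * (\<integral>y. w y * (norm y)\<^sup>2 \<partial>lborel)"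
proof -
  note im = integrable_second_moment[OF m i]
  define Q where "Q a = (\<integral>y. w y * ((a \<bullet> y) * (a \<bullet> y)) \<partial>lborel)" for a
  \<comment> \<open>the value of the form on every unit vector\<close>
  define c where "c = Q (axis 1 1)"
  have Qf: "Q (f a) = Q a" if f: "orthogonal_transformation f" for f a
  proof -
    have "Q (f a) = (\<integral>y. w (f y) * ((f a \<bullet> f y) * (f a \<bullet> f y)) \<partial>lborel)"
      unfolding Q_def
      by (rule integral_orthogonal[OF f, of "\<lambda>y. w y * ((f a \<bullet> y) * (f a \<bullet> y))", symmetric]) measurable
    then show ?thesis by (simp add: inv[OF f] inner_orthogonal_transformation[OF f] Q_def)
  qed
  have Qs: "Q (k *\<^sub>R a) = k\<^sup>2 * Q a" for k a
  proof -
    have "w y * ((k *\<^sub>R a \<bullet> y) * (k *\<^sub>R a \<bullet> y)) = k\<^sup>2 * (w y * ((a \<bullet> y) * (a \<bullet> y)))" for y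
      by (simp add: power2_eq_square)
    then show ?thesis by (simp only: Q_def integral_mult_right_zero)
  qed
  have Qa: "Q a = (a \<bullet> a) * c" for a
  proof -
    have "norm (norm a *\<^sub>R (axis 1 1 :: real^3)) = norm a" by simp
    from orthogonal_maps[OF this]
    obtain f where f: "orthogonal_transformation f" "f (norm a *\<^sub>R (axis 1 1 :: real^3)) = a" by auto
    then have "Q a = Q (norm a *\<^sub>R axis 1 1)" using Qf[OF f(1), of "norm a *\<^sub>R axis 1 1"] by simp
    then show ?thesis by (simp add: Qs c_def power2_norm_eq_inner)
  qed
  have "(\<integral>y. w y * (norm y)\<^sup>2 \<partial>lborel) = (\<integral>y. (\<Sum>i\<in>UNIV. w y * ((axis i 1 \<bullet> y) * (axis i 1 \<bullet> y))) \<partial>lborel)"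
  proof (intro Bochner_Integration.integral_cong refl)
    fix y :: "real^3"
    have "(norm y)\<^sup>2 = (\<Sum>i\<in>UNIV. y $ i * y $ i)"
      by (simp add: power2_norm_eq_inner inner_vec_def)
    also have "\<dots> = (\<Sum>i\<in>UNIV. (axis i 1 \<bullet> y) * (axis i 1 \<bullet> y))"
      by (simp add: inner_axis')
    finally have "(norm y)\<^sup>2 = (\<Sum>i\<in>UNIV. (axis i 1 \<bullet> y) * (axis i 1 \<bullet> y))" .
    then show "w y * (norm y)\<^sup>2 = (\<Sum>i\<in>UNIV. w y * ((axis i 1 \<bullet> y) * (axis i 1 \<bullet> y)))"
      by (simp only: sum_distrib_left)
  qed
  also have "\<dots> = (\<Sum>i\<in>UNIV. Q (axis i 1))"
    unfolding Q_def by (rule Bochner_Integration.integral_sum) (rule im)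
  also have "\<dots> = 3 * c" by (simp add: Qa inner_axis_axis)
  finally have c: "(\<integral>y. w y * (norm y)\<^sup>2 \<partial>lborel) = 3 * c" .
  have "(\<integral>y. w y * ((a \<bullet> y) * (b \<bullet> y)) \<partial>lborel) =
     (\<integral>y. (w y * (((a+b) \<bullet> y) * ((a+b) \<bullet> y)) - w y * (((a-b) \<bullet> y) * ((a-b) \<bullet> y))) / 4 \<partial>lborel)"
    by (intro Bochner_Integration.integral_cong refl) (simp add: inner_simps algebra_simps)
  also have "\<dots> = (Q (a+b) - Q (a-b)) / 4"
    by (simp only: integral_divide_zero Bochner_Integration.integral_diff[OF im im] Q_def)
  also have "\<dots> = (a \<bullet> b) * c"
    unfolding Qa by (simp add: inner_simps inner_commute algebra_simps)
  finally show ?thesis using c by simp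
qed

section \<open>The potential of a spheroid\<close>

text \<open>Fubini's theorem for \<open>1 / t\<^sup>2\<close> on the pairs \<open>(z, t)\<close> with \<open>z \<in> S\<close> and \<open>\<bar>z\<bar> < t\<close>, followed by the
  dilation \<open>z = t y\<close>, plays the role of polar coordinates: \<open>\<tau> y\<close> is the distance from the origin to
  the boundary of \<open>S\<close> in direction \<open>y\<close>, measured in units of \<open>\<bar>y\<bar>\<close>.\<close>

lemma nn_integral_star_shaped:
  fixes S :: "(real^3) set" and \<tau> :: "real^3 \<Rightarrow> real"
  assumes S[measurable]: "S \<in> sets borel" and [measurable]: "\<tau> \<in> borel_measurable borel"
    and pos: "\<And>y. y \<noteq> 0 \<Longrightarrow> \<tau> y > 0"
    and star: "\<And>y t. y \<noteq> 0 \<Longrightarrow> t > 0 \<Longrightarrow> t *\<^sub>R y \<in> S \<longleftrightarrow> t < \<tau> y"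
  shows "(\<integral>\<^sup>+z. ennreal (indicator S z / norm z) \<partial>lborel)
       = (\<integral>\<^sup>+y. ennreal (indicator (ball 0 1) y * ((\<tau> y)\<^sup>2 / 2)) \<partial>lborel)"
proof -
  let ?h = "\<lambda>(z::real^3) (t::real). indicator S z * (ennreal (1 / t\<^sup>2) * indicator {norm z<..} t) :: ennreal"
  have [measurable]: "case_prod ?h \<in> borel_measurable (lborel \<Otimes>\<^sub>M lborel)"
  proof -
    have "case_prod ?h = (\<lambda>(z, t). indicator S z * (ennreal (1 / t\<^sup>2) * (if norm z < t then 1 else 0)))"
      by (auto simp: fun_eq_iff)
    also have "\<dots> \<in> borel_measurable (lborel \<Otimes>\<^sub>M lborel)" by measurable
    finally show ?thesis .
  qed
  have inv: "(\<integral>\<^sup>+t. ennreal (1 / t\<^sup>2) * indicator {a<..} t \<partial>lborel) = ennreal (1 / a)" if "a > 0" for a :: real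
  proof -
    have "(\<integral>\<^sup>+t. ennreal (1 / t\<^sup>2) * indicator {a<..} t \<partial>lborel) = (\<integral>\<^sup>+t. ennreal (1 / t\<^sup>2) * indicator {a..} t \<partial>lborel)"
    proof (rule nn_integral_cong_AE)
      show "AE t in lborel. ennreal (1 / t\<^sup>2) * indicator {a<..} t = ennreal (1 / t\<^sup>2) * indicator {a..} t"
        using AE_lborel_singleton[of a] by eventually_elim (auto split: split_indicator)
    qed
    also have "\<dots> = ennreal (0 - - 1 / a)"
    proof (rule nn_integral_FTC_atLeast)
      fix x :: real assume "a \<le> x"
      then show "((\<lambda>x. - 1 / x) has_real_derivative 1 / x\<^sup>2) (at x)"
        using that by (auto intro!: derivative_eq_intros simp: power2_eq_square)
    next
      show "((\<lambda>x. - 1 / x) \<longlongrightarrow> (0::real)) at_top"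
        by (rule real_tendsto_divide_at_top[OF tendsto_const filterlim_ident])
    qed auto
    finally show ?thesis by simp
  qed
  have "(\<integral>\<^sup>+z. ennreal (indicator S z / norm z) \<partial>lborel) = (\<integral>\<^sup>+z. \<integral>\<^sup>+t. ?h z t \<partial>lborel \<partial>lborel)"
  proof (rule nn_integral_cong_AE)
    show "AE z in lborel. ennreal (indicator S z / norm z) = (\<integral>\<^sup>+t. ?h z t \<partial>lborel)"
      using AE_lborel_singleton[of 0]
      by eventually_elim (auto simp: nn_integral_cmult inv split: split_indicator)
  qed
  also have "\<dots> = (\<integral>\<^sup>+t. \<integral>\<^sup>+z. ?h z t \<partial>lborel \<partial>lborel)"
    by (rule lborel_pair.Fubini'[symmetric]) measurable
  also have "\<dots> = (\<integral>\<^sup>+t. \<integral>\<^sup>+y. indicator {0<..} t * (ennreal t * (indicator S (t *\<^sub>R y) * indicator (ball 0 1) y)) \<partial>lborel \<partial>lborel)"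
  proof (rule nn_integral_cong)
    fix t :: real
    show "(\<integral>\<^sup>+z. ?h z t \<partial>lborel) = (\<integral>\<^sup>+y. indicator {0<..} t * (ennreal t * (indicator S (t *\<^sub>R y) * indicator (ball 0 1) y)) \<partial>lborel)"
    proof (cases "t > 0")
      case True
      have "(\<integral>\<^sup>+z. ?h z t \<partial>lborel) = ennreal (t^3) * (\<integral>\<^sup>+y. ?h (t *\<^sub>R y) t \<partial>lborel)"
        by (rule nn_integral_scale[OF _ True]) measurable
      also have "\<dots> = (\<integral>\<^sup>+y. ennreal (t^3) * ?h (t *\<^sub>R y) t \<partial>lborel)"
        by (rule nn_integral_cmult[symmetric]) measurable
      also have "\<dots> = (\<integral>\<^sup>+y. indicator {0<..} t * (ennreal t * (indicator S (t *\<^sub>R y) * indicator (ball 0 1) y)) \<partial>lborel)"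
      proof (rule nn_integral_cong)
        fix y :: "real^3"
        have "ennreal (t^3) * ennreal (1 / t\<^sup>2) = ennreal t"
          using True by (simp add: power3_eq_cube power2_eq_square flip: ennreal_mult')
        moreover have "norm (t *\<^sub>R y) < t \<longleftrightarrow> norm y < 1" using True by simp
        ultimately show "ennreal (t^3) * ?h (t *\<^sub>R y) t = indicator {0<..} t * (ennreal t * (indicator S (t *\<^sub>R y) * indicator (ball 0 1) y))"
          using True by (auto split: split_indicator)
      qed
      finally show ?thesis .
    next
      case False
      have "?h z t = 0" for z
      proof -
        have "\<not> norm z < t" using False norm_ge_zero[of z] by linarith
        then show ?thesis by simp
      qed
      then have "(\<integral>\<^sup>+z. ?h z t \<partial>lborel) = (\<integral>\<^sup>+z. 0 \<partial>(lborel :: (real^3) measure))" by (simp only:)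
      then show ?thesis using False by simp
    qed
  qed
  also have "\<dots> = (\<integral>\<^sup>+y. \<integral>\<^sup>+t. indicator {0<..} t * (ennreal t * (indicator S (t *\<^sub>R y) * indicator (ball 0 1) y)) \<partial>lborel \<partial>lborel)"
    by (rule lborel_pair.Fubini'[symmetric]) measurable
  also have "\<dots> = (\<integral>\<^sup>+y. ennreal (indicator (ball 0 1) y * ((\<tau> y)\<^sup>2 / 2)) \<partial>lborel)"
  proof (rule nn_integral_cong_AE)
    show "AE y in lborel. (\<integral>\<^sup>+t. indicator {0<..} t * (ennreal t * (indicator S (t *\<^sub>R y) * indicator (ball 0 1) y)) \<partial>lborel)
       = ennreal (indicator (ball 0 1) y * ((\<tau> y)\<^sup>2 / 2))"
      using AE_lborel_singleton[of 0]
    proof eventually_elim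
      case (elim y)
      show ?case
      proof (cases "y \<in> ball 0 1")
        case True
        have "(\<integral>\<^sup>+t. indicator {0<..} t * (ennreal t * (indicator S (t *\<^sub>R y) * indicator (ball 0 1) y)) \<partial>lborel)
          = (\<integral>\<^sup>+t. ennreal t * indicator {0..\<tau> y} t \<partial>lborel)"
        proof (rule nn_integral_cong_AE)
          show "AE t in lborel. indicator {0<..} t * (ennreal t * (indicator S (t *\<^sub>R y) * indicator (ball 0 1) y)) = ennreal t * indicator {0..\<tau> y} t"
            using AE_lborel_singleton[of "\<tau> y"]
            by eventually_elim (use True star[OF elim] in \<open>auto split: split_indicator\<close>)
        qed
        also have "\<dots> = ennreal ((\<tau> y)\<^sup>2 / 2 - 0\<^sup>2 / 2)"
          using pos[OF elim] by (intro nn_integral_FTC_Icc[where F="\<lambda>t. t\<^sup>2 / 2"]) (auto intro!: derivative_eq_intros)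
        finally show ?thesis using True by simp
      qed simp
    qed
  qed
  finally show ?thesis .
qed

text \<open>The bilinear form of the matrix \<open>I + \<kappa> n n\<^sup>T\<close>, whose unit balls are oblate spheroids with axis \<open>n\<close> for \<open>\<kappa> > 0\<close>.\<close>

definition sph_form :: "real^3 \<Rightarrow> real \<Rightarrow> real^3 \<Rightarrow> real^3 \<Rightarrow> real" where
  "sph_form n \<kappa> x y = x \<bullet> y + \<kappa> * ((n \<bullet> x) * (n \<bullet> y))"

lemma sph_form_ge: "\<kappa> \<ge> 0 \<Longrightarrow> (norm y)\<^sup>2 \<le> sph_form n \<kappa> y y"
  by (simp add: sph_form_def power2_norm_eq_inner)

lemma sph_form_nonneg: "\<kappa> \<ge> 0 \<Longrightarrow> 0 \<le> sph_form n \<kappa> y y"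
  using sph_form_ge[of \<kappa> y n] zero_le_power2[of "norm y"] by linarith

lemma sph_form_pos: "\<kappa> \<ge> 0 \<Longrightarrow> y \<noteq> 0 \<Longrightarrow> sph_form n \<kappa> y y > 0"
  using sph_form_ge[of \<kappa> y n] by (smt (verit) zero_less_norm_iff zero_less_power)

lemma sph_form_line: "sph_form n \<kappa> (x + t *\<^sub>R y) (x + t *\<^sub>R y)
    = sph_form n \<kappa> x x + 2 * t * sph_form n \<kappa> x y + t\<^sup>2 * sph_form n \<kappa> y y"
  by (simp add: sph_form_def inner_simps inner_commute power2_eq_square algebra_simps)

lemma sph_form_measurable[measurable (raw)]:
  assumes [measurable]: "f \<in> borel_measurable M" "g \<in> borel_measurable M"
  shows "(\<lambda>x. sph_form n \<kappa> (f x) (g x)) \<in> borel_measurable M"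
  unfolding sph_form_def by measurable

definition spheroid :: "real^3 \<Rightarrow> real \<Rightarrow> real \<Rightarrow> (real^3) set" where
  "spheroid n \<kappa> \<rho> = {z. sph_form n \<kappa> z z < \<rho>\<^sup>2}"

lemma spheroid_borel[measurable]: "spheroid n \<kappa> \<rho> \<in> sets borel"
  unfolding spheroid_def by measurable

lemma spheroid_subset: "\<kappa> \<ge> 0 \<Longrightarrow> \<rho> \<ge> 0 \<Longrightarrow> spheroid n \<kappa> \<rho> \<subseteq> ball 0 \<rho>"
proof
  fix z assume *: "\<kappa> \<ge> 0" "\<rho> \<ge> 0" "z \<in> spheroid n \<kappa> \<rho>"
  then have "(norm z)\<^sup>2 < \<rho>\<^sup>2" using sph_form_ge[of \<kappa> z n] by (simp add: spheroid_def)
  then show "z \<in> ball 0 \<rho>" using * by (simp add: power2_less_imp_less)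
qed

lemma charge_spheroid: "\<kappa> \<ge> 0 \<Longrightarrow> \<rho> \<ge> 0 \<Longrightarrow> charge (indicator (spheroid n \<kappa> \<rho>))"
  by (rule charge_indicator[OF bounded_subset[OF bounded_ball spheroid_subset]]) auto

lemma quadratic_positive_root:
  fixes a b c t :: real
  assumes "a > 0" "c > 0" "t > 0"
  shows "2 * t * b + t\<^sup>2 * a < c \<longleftrightarrow> t < (- b + sqrt (b\<^sup>2 + a * c)) / a"
proof -
  have "2 * t * b + t\<^sup>2 * a < c \<longleftrightarrow> a * (2 * t * b + t\<^sup>2 * a) < a * c"
    using assms by simp
  also have "\<dots> \<longleftrightarrow> (a * t + b)\<^sup>2 < b\<^sup>2 + a * c"
    by (simp add: power2_eq_square algebra_simps)
  also have "\<dots> \<longleftrightarrow> \<bar>a * t + b\<bar> < sqrt (b\<^sup>2 + a * c)"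
    using real_sqrt_less_iff[of "(a * t + b)\<^sup>2" "b\<^sup>2 + a * c"] by simp
  also have "\<dots> \<longleftrightarrow> a * t + b < sqrt (b\<^sup>2 + a * c)"
  proof -
    have "\<bar>b\<bar> < sqrt (b\<^sup>2 + a * c)" using assms by (intro real_less_rsqrt) simp
    moreover have "a * t > 0" using assms by simp
    ultimately show ?thesis by linarith
  qed
  also have "\<dots> \<longleftrightarrow> t < (- b + sqrt (b\<^sup>2 + a * c)) / a"
    using assms by (simp add: field_simps)
  finally show ?thesis .
qed

lemma integrable_inverse_square_ball:
  "integrable lborel (\<lambda>y::real^3. indicator (ball 0 1) y / (norm y)\<^sup>2)"
  "(\<integral>y. indicator (ball 0 1) y / (norm (y::real^3))\<^sup>2 \<partial>lborel) = 4 * pi"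
proof -
  have "has_bochner_integral lborel (\<lambda>z::real^3. norm z powr (-2) * indicator (ball 0 1) z) (4 * pi)"
    using has_integral_norm_powr_ball[of 2 1] by simp
  moreover have "norm z powr (-2) * indicator (ball 0 1) z = indicator (ball 0 1) z / (norm z)\<^sup>2" for z :: "real^3"
    by (cases "z = 0") (auto simp: powr_minus divide_inverse)
  ultimately have *: "has_bochner_integral lborel (\<lambda>y::real^3. indicator (ball 0 1) y / (norm y)\<^sup>2) (4 * pi)" by simp
  show "integrable lborel (\<lambda>y::real^3. indicator (ball 0 1) y / (norm y)\<^sup>2)"
    "(\<integral>y. indicator (ball 0 1) y / (norm (y::real^3))\<^sup>2 \<partial>lborel) = 4 * pi"
    using * by (auto simp: has_bochner_integral_iff)
qed

lemma integrable_sph: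
  assumes \<kappa>: "\<kappa> \<ge> 0"
  shows "integrable lborel (\<lambda>y. indicator (ball 0 1) y / sph_form n \<kappa> y y)"
    and "integrable lborel (\<lambda>y. indicator (ball 0 1) y * ((a \<bullet> y) * (b \<bullet> y) / (sph_form n \<kappa> y y)\<^sup>2))"
proof -
  have r: "indicator (ball 0 1) y / sph_form n \<kappa> y y \<le> (indicator (ball 0 1) y / (norm y)\<^sup>2 :: real)" for y
    using sph_form_ge[OF \<kappa>, of y n] sph_form_pos[OF \<kappa>, of y n]
    by (cases "y = 0") (auto intro!: divide_left_mono mult_pos_pos simp: sph_form_def)
  note nn = sph_form_nonneg[OF \<kappa>]
  show "integrable lborel (\<lambda>y. indicator (ball 0 1) y / sph_form n \<kappa> y y)"
  proof (rule integrable_dominated[OF integrable_inverse_square_ball(1)])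
    show "(\<lambda>y. indicator (ball 0 1) y / sph_form n \<kappa> y y) \<in> borel_measurable borel" by measurable
    show "\<bar>indicator (ball 0 1) y / sph_form n \<kappa> y y\<bar> \<le> indicator (ball 0 1) y / (norm y)\<^sup>2" for y
      using r[of y] nn[of n y] by (simp add: abs_of_nonneg)
  qed
  show "integrable lborel (\<lambda>y. indicator (ball 0 1) y * ((a \<bullet> y) * (b \<bullet> y) / (sph_form n \<kappa> y y)\<^sup>2))"
  proof (rule integrable_dominated)
    show "integrable lborel (\<lambda>y::real^3. norm a * norm b * (indicator (ball 0 1) y / (norm y)\<^sup>2))"
      by (intro integrable_mult_right integrable_inverse_square_ball(1))
    fix y
    show "\<bar>indicator (ball 0 1) y * ((a \<bullet> y) * (b \<bullet> y) / (sph_form n \<kappa> y y)\<^sup>2)\<bar> \<le> norm a * norm b * (indicator (ball 0 1) y / (norm y)\<^sup>2)"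
    proof (cases "y = 0")
      case False
      have "\<bar>a \<bullet> y\<bar> * \<bar>b \<bullet> y\<bar> \<le> (norm a * norm y) * (norm b * norm y)"
        by (intro mult_mono Cauchy_Schwarz_ineq2) auto
      then have "\<bar>(a \<bullet> y) * (b \<bullet> y)\<bar> / (sph_form n \<kappa> y y)\<^sup>2 \<le> (norm a * norm b * (norm y)\<^sup>2) / ((norm y)\<^sup>2)\<^sup>2"
        using False sph_form_ge[OF \<kappa>, of y n]
        by (intro frac_le power_mono) (auto simp: abs_mult power2_eq_square algebra_simps)
      also have "\<dots> = norm a * norm b / (norm y)\<^sup>2" using False by (simp add: power2_eq_square)
      finally show ?thesis by (auto split: split_indicator)
    qed simp
  qed measurable
qed

text \<open>On the ray from \<open>x\<close> in direction \<open>y\<close> the boundary is reached at the positive root of a quadratic equation.  The squares of the roots for \<open>y\<close> and \<open>- y\<close> have a sum that is free of square roots and quadratic in \<open>x\<close>; this is why the potential is quadratic inside.\<close>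

lemma pot_spheroid_integral:
  assumes \<kappa>: "\<kappa> \<ge> 0" and \<rho>: "\<rho> > 0" and x: "x \<in> spheroid n \<kappa> \<rho>"
  shows "pot (indicator (spheroid n \<kappa> \<rho>)) x =
    (\<integral>y. indicator (ball 0 1) y * ((sph_form n \<kappa> x y)\<^sup>2 / (sph_form n \<kappa> y y)\<^sup>2) \<partial>lborel)
     + (\<rho>\<^sup>2 - sph_form n \<kappa> x x) / 2 * (\<integral>y. indicator (ball 0 1) y / sph_form n \<kappa> y y \<partial>lborel)"
proof -
  let ?E = "spheroid n \<kappa> \<rho>"
  let ?B = "\<lambda>y. sph_form n \<kappa> x y" and ?\<alpha> = "\<lambda>y. sph_form n \<kappa> y y"
  define \<gamma> where "\<gamma> = \<rho>\<^sup>2 - ?\<alpha> x"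
  have \<gamma>: "\<gamma> > 0" using x by (simp add: \<gamma>_def spheroid_def)
  note ch = charge_spheroid[OF \<kappa> less_imp_le[OF \<rho>], of n]
  \<comment> \<open>the positive root of \<open>\<alpha> t\<^sup>2 + 2 B t = \<gamma>\<close>, the parameter at which the ray leaves the spheroid\<close>
  define \<tau> where "\<tau> y = (- ?B y + sqrt ((?B y)\<^sup>2 + ?\<alpha> y * \<gamma>)) / ?\<alpha> y" for y
  have [measurable]: "\<tau> \<in> borel_measurable borel" unfolding \<tau>_def by measurable
  define S where "S = {w. x + w \<in> ?E}"
  have [measurable]: "S \<in> sets borel" unfolding S_def by measurable
  have star: "t *\<^sub>R y \<in> S \<longleftrightarrow> t < \<tau> y" if "y \<noteq> 0" "t > 0" for y t
    using quadratic_positive_root[OF sph_form_pos[OF \<kappa> that(1), of n] \<gamma> that(2), of "?B y"]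
    by (auto simp: S_def spheroid_def sph_form_line \<tau>_def \<gamma>_def)
  have pos: "\<tau> y > 0" if "y \<noteq> 0" for y
  proof -
    have "sqrt ((?B y)\<^sup>2) < sqrt ((?B y)\<^sup>2 + ?\<alpha> y * \<gamma>)" using sph_form_pos[OF \<kappa> that, of n] \<gamma> by (intro real_sqrt_less_mono) simp
    then show ?thesis using sph_form_pos[OF \<kappa> that, of n] by (auto simp: \<tau>_def)
  qed
  have p0: "pot (indicator ?E) x \<ge> 0" unfolding pot_def by (intro integral_nonneg_AE AE_I2) simp
  have "ennreal (pot (indicator ?E) x) = (\<integral>\<^sup>+y. ennreal (indicator ?E y / norm (x - y)) \<partial>lborel)"
    unfolding pot_def using integrable_pot[OF ch, of x] by (subst nn_integral_eq_integral) auto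
  also have "\<dots> = (\<integral>\<^sup>+w. ennreal (indicator ?E (x + w) / norm (x - (x + w))) \<partial>lborel)"
    by (rule nn_integral_translate[symmetric]) measurable
  also have "\<dots> = (\<integral>\<^sup>+w. ennreal (indicator S w / norm w) \<partial>lborel)"
    by (intro nn_integral_cong) (simp add: S_def indicator_def)
  also have "\<dots> = (\<integral>\<^sup>+y. ennreal (indicator (ball 0 1) y * ((\<tau> y)\<^sup>2 / 2)) \<partial>lborel)"
    by (rule nn_integral_star_shaped) (use pos star in auto)
  finally have p1: "ennreal (pot (indicator ?E) x) = (\<integral>\<^sup>+y. ennreal (indicator (ball 0 1) y * ((\<tau> y)\<^sup>2 / 2)) \<partial>lborel)" .
  also have "\<dots> = (\<integral>\<^sup>+y. ennreal (indicator (ball 0 1) (-y) * ((\<tau> (-y))\<^sup>2 / 2)) \<partial>lborel)"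
    by (rule nn_integral_uminus[symmetric]) measurable
  finally have p2: "ennreal (pot (indicator ?E) x) = (\<integral>\<^sup>+y. ennreal (indicator (ball 0 1) (-y) * ((\<tau> (-y))\<^sup>2 / 2)) \<partial>lborel)" .
  let ?g = "\<lambda>y. 2 * (indicator (ball 0 1) y * ((?B y)\<^sup>2 / (?\<alpha> y)\<^sup>2)) + \<gamma> * (indicator (ball 0 1) y / ?\<alpha> y)"
  have "ennreal (pot (indicator ?E) x + pot (indicator ?E) x) =
     (\<integral>\<^sup>+y. ennreal (indicator (ball 0 1) y * ((\<tau> y)\<^sup>2 / 2)) + ennreal (indicator (ball 0 1) (-y) * ((\<tau> (-y))\<^sup>2 / 2)) \<partial>lborel)"
  proof -
    have "ennreal (pot (indicator ?E) x + pot (indicator ?E) x) = (\<integral>\<^sup>+y. ennreal (indicator (ball 0 1) y * ((\<tau> y)\<^sup>2 / 2)) \<partial>lborel)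
        + (\<integral>\<^sup>+y. ennreal (indicator (ball 0 1) (-y) * ((\<tau> (-y))\<^sup>2 / 2)) \<partial>lborel)"
      unfolding ennreal_plus[OF p0 p0] by (rule arg_cong2[where f="(+)", OF p1 p2])
    also have "\<dots> = (\<integral>\<^sup>+y. ennreal (indicator (ball 0 1) y * ((\<tau> y)\<^sup>2 / 2)) + ennreal (indicator (ball 0 1) (-y) * ((\<tau> (-y))\<^sup>2 / 2)) \<partial>lborel)"
      by (rule nn_integral_add[symmetric]) measurable
    finally show ?thesis .
  qed
  also have "\<dots> = (\<integral>\<^sup>+y. ennreal (?g y) \<partial>lborel)"
  proof (rule nn_integral_cong_AE)
    show "AE y in lborel. ennreal (indicator (ball 0 1) y * ((\<tau> y)\<^sup>2 / 2)) + ennreal (indicator (ball 0 1) (-y) * ((\<tau> (-y))\<^sup>2 / 2)) = ennreal (?g y)"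
      using AE_lborel_singleton[of 0]
    proof eventually_elim
      case (elim y)
      have a: "?\<alpha> y > 0" using sph_form_pos[OF \<kappa> elim] .
      have m: "sph_form n \<kappa> x (-y) = - ?B y" "sph_form n \<kappa> (-y) (-y) = ?\<alpha> y"
        by (simp_all add: sph_form_def)
      define s where "s = sqrt ((?B y)\<^sup>2 + ?\<alpha> y * \<gamma>)"
      have s2: "s\<^sup>2 = (?B y)\<^sup>2 + ?\<alpha> y * \<gamma>" using a \<gamma> by (simp add: s_def)
      have "(\<tau> y)\<^sup>2 / 2 + (\<tau> (-y))\<^sup>2 / 2 = ((- ?B y + s)\<^sup>2 + (?B y + s)\<^sup>2) / (2 * (?\<alpha> y)\<^sup>2)"
      proof -
        have "\<tau> y = (- ?B y + s) / ?\<alpha> y" "\<tau> (-y) = (?B y + s) / ?\<alpha> y"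
          by (simp_all add: \<tau>_def m s_def)
        then show ?thesis by (simp only: power_divide) (simp add: add_divide_distrib mult.commute)
      qed
      also have "(- ?B y + s)\<^sup>2 + (?B y + s)\<^sup>2 = 2 * (2 * (?B y)\<^sup>2 + ?\<alpha> y * \<gamma>)"
        using s2 by (simp add: power2_eq_square algebra_simps)
      also have "2 * (2 * (?B y)\<^sup>2 + ?\<alpha> y * \<gamma>) / (2 * (?\<alpha> y)\<^sup>2) = 2 * ((?B y)\<^sup>2 / (?\<alpha> y)\<^sup>2) + \<gamma> / ?\<alpha> y"
        using a by (simp add: field_simps power2_eq_square)
      finally have "indicator (ball 0 1) y * ((\<tau> y)\<^sup>2 / 2) + indicator (ball 0 1) (-y) * ((\<tau> (-y))\<^sup>2 / 2) = ?g y"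
        by (simp add: indicator_def)
      then show ?case by (simp flip: ennreal_plus)
    qed
  qed
  also have "\<dots> = ennreal (\<integral>y. ?g y \<partial>lborel)"
  proof (rule nn_integral_eq_integral)
    have e: "(?B y)\<^sup>2 = ((x + (\<kappa> * (n \<bullet> x)) *\<^sub>R n) \<bullet> y) * ((x + (\<kappa> * (n \<bullet> x)) *\<^sub>R n) \<bullet> y)" for y
      by (simp add: sph_form_def inner_simps power2_eq_square mult.assoc)
    show "integrable lborel ?g"
      unfolding e by (intro Bochner_Integration.integrable_add integrable_mult_right integrable_sph[OF \<kappa>])
    show "AE y in lborel. 0 \<le> ?g y"
    proof (rule AE_I2)
      fix y show "0 \<le> ?g y"
        using \<gamma> sph_form_nonneg[OF \<kappa>, of n y]
        by (intro add_nonneg_nonneg mult_nonneg_nonneg divide_nonneg_nonneg) auto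
    qed
  qed
  finally have "ennreal (pot (indicator ?E) x + pot (indicator ?E) x) = ennreal (\<integral>y. ?g y \<partial>lborel)" .
  moreover have "(\<integral>y. ?g y \<partial>lborel) = 2 * (\<integral>y. indicator (ball 0 1) y * ((?B y)\<^sup>2 / (?\<alpha> y)\<^sup>2) \<partial>lborel) + \<gamma> * (\<integral>y. indicator (ball 0 1) y / ?\<alpha> y \<partial>lborel)"
  proof -
    have e: "(?B y)\<^sup>2 = ((x + (\<kappa> * (n \<bullet> x)) *\<^sub>R n) \<bullet> y) * ((x + (\<kappa> * (n \<bullet> x)) *\<^sub>R n) \<bullet> y)" for y
      by (simp add: sph_form_def inner_simps power2_eq_square mult.assoc)
    show ?thesis unfolding e
      by (subst Bochner_Integration.integral_add)
        (intro integrable_mult_right integrable_sph[OF \<kappa>] | simp only: integral_mult_right_zero)+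
  qed
  moreover have "(\<integral>y. indicator (ball 0 1) y * ((?B y)\<^sup>2 / (?\<alpha> y)\<^sup>2) \<partial>lborel) \<ge> 0"
    by (intro integral_nonneg_AE AE_I2) simp
  moreover have "(\<integral>y. indicator (ball 0 1) y / ?\<alpha> y \<partial>lborel) \<ge> 0"
    by (intro integral_nonneg_AE AE_I2) (simp add: sph_form_nonneg[OF \<kappa>])
  ultimately have "pot (indicator ?E) x + pot (indicator ?E) x = 2 * (\<integral>y. indicator (ball 0 1) y * ((?B y)\<^sup>2 / (?\<alpha> y)\<^sup>2) \<partial>lborel) + \<gamma> * (\<integral>y. indicator (ball 0 1) y / ?\<alpha> y \<partial>lborel)"
    using p0 \<gamma> by (subst (asm) ennreal_inj) auto
  then show ?thesis by (simp add: \<gamma>_def)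
qed

section \<open>Balls and the mean value formula\<close>

text \<open>The sphere average of \<open>(a \<bullet> y) (b \<bullet> y)\<close>, written over the ball with a weight homogeneous of degree \<open>- 4\<close>.\<close>

lemma second_moment_inverse_fourth:
  "(\<integral>y. indicator (ball 0 1) y * ((a \<bullet> y) * (b \<bullet> y) / ((norm y)\<^sup>2)\<^sup>2) \<partial>(lborel :: (real^3) measure)) = (a \<bullet> b) / 3 * (4 * pi)"
proof -
  let ?w = "\<lambda>y::real^3. indicator (ball 0 1) y / ((norm y)\<^sup>2)\<^sup>2 :: real"
  have w: "?w y * (norm y)\<^sup>2 = indicator (ball 0 1) y / (norm y)\<^sup>2" for y
    by (cases "y = 0") (auto simp: power2_eq_square)
  have "(\<integral>y. ?w y * ((a \<bullet> y) * (b \<bullet> y)) \<partial>lborel) = (a \<bullet> b) / 3 * (\<integral>y. ?w y * (norm y)\<^sup>2 \<partial>lborel)"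
  proof (rule second_moment)
    show "integrable lborel (\<lambda>y. ?w y * (norm y)\<^sup>2)" unfolding w by (rule integrable_inverse_square_ball)
  next
    fix f :: "real^3 \<Rightarrow> real^3" and y assume "orthogonal_transformation f"
    then show "?w (f y) = ?w y" by (simp add: orthogonal_transformation_norm indicator_def)
  qed measurable
  then show ?thesis unfolding w integrable_inverse_square_ball(2) by (simp add: field_simps)
qed

lemma charge_ball: "charge (indicator (ball c r))"
  by (rule charge_indicator) auto

lemma pot_ball_inside:
  assumes "norm x < r"
  shows "pot (indicator (ball 0 r)) x = 2 * pi * r\<^sup>2 - 2 * pi / 3 * (norm x)\<^sup>2"
proof -
  have r: "r > 0" using assms norm_ge_zero[of x] by linarith
  have s: "sph_form 0 0 x y = x \<bullet> y" for x y by (simp add: sph_form_def)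
  have b: "spheroid 0 0 r = ball 0 r"
    using r by (auto simp: spheroid_def s power2_norm_eq_inner[symmetric]
      intro: power_strict_mono dest: power_less_imp_less_base)
  have "pot (indicator (ball 0 r)) x = (\<integral>y. indicator (ball 0 1) y * ((x \<bullet> y)\<^sup>2 / (y \<bullet> y)\<^sup>2) \<partial>lborel)
     + (r\<^sup>2 - x \<bullet> x) / 2 * (\<integral>y. indicator (ball 0 1) y / (y \<bullet> y) \<partial>(lborel :: (real^3) measure))"
    using pot_spheroid_integral[of 0 r x 0] assms r by (simp add: b s)
  also have "\<dots> = (x \<bullet> x) / 3 * (4 * pi) + (r\<^sup>2 - x \<bullet> x) / 2 * (4 * pi)"
    using second_moment_inverse_fourth[of x x] integrable_inverse_square_ball(2)
    by (simp add: power2_norm_eq_inner power2_eq_square[of "x \<bullet> _"])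
  finally show ?thesis by (simp add: power2_norm_eq_inner field_simps)
qed

lemma pot_ball_radial:
  assumes "norm x = norm y"
  shows "pot (indicator (ball 0 r)) x = pot (indicator (ball 0 r)) y"
proof -
  obtain f where f: "orthogonal_transformation f" "f x = y" using orthogonal_maps[OF assms] by auto
  have "norm (f x - f z) = norm (x - z)" for z
    using f by (metis linear_diff orthogonal_transformation)
  moreover have "f z \<in> ball 0 r \<longleftrightarrow> z \<in> ball 0 r" for z
    using f by (simp add: orthogonal_transformation_norm)
  ultimately have "(\<lambda>z. indicator (ball 0 r) (f z) / norm (y - f z)) = (\<lambda>z. indicator (ball 0 r) z / norm (x - z) :: real)"
    using f(2) by (auto simp: fun_eq_iff indicator_def)
  moreover have "(\<integral>z. indicator (ball 0 r) (f z) / norm (y - f z) \<partial>lborel) = pot (indicator (ball 0 r)) y"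
    unfolding pot_def by (rule integral_orthogonal[OF f(1), of "\<lambda>z. indicator (ball 0 r) z / norm (y - z)"]) measurable
  ultimately show ?thesis by (simp add: pot_def)
qed

lemma integral_ball_power:
  assumes "r \<ge> 0"
  shows "has_bochner_integral lborel (\<lambda>z::real^3. (norm z)^k * indicator (ball 0 r) z) (4 * pi / (k + 3) * r^(k+3))"
proof -
  have "has_bochner_integral lborel (\<lambda>z::real^3. (norm z)^k * indicator (ball 0 r) z) (4 * pi / (k + 3) * r^(k+3) - 4 * pi / (k + 3) * 0^(k+3))"
    using assms
  proof (intro has_bochner_integral_radial_ball)
    fix s :: real
    have "((\<lambda>s. 4 * pi / (k + 3) * s^(k+3)) has_real_derivative (4 * pi / (k + 3) * ((k+3) * s^(k+2)))) (at s)"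
      using DERIV_cmult[OF DERIV_pow[of "k+3" s], of "4 * pi / (k + 3)"] by (simp add: add.commute)
    moreover have "4 * pi / (k + 3) * ((k+3) * s^(k+2)) = 4 * pi * s\<^sup>2 * s^k"
    proof -
      have "real k + 3 \<noteq> 0" by linarith
      then show ?thesis by (simp add: power_add power2_eq_square)
    qed
    ultimately show "((\<lambda>s. 4 * pi / (k + 3) * s^(k+3)) has_real_derivative (4 * pi * s\<^sup>2 * s^k)) (at s)"
      by (simp only:)
  qed (auto intro!: continuous_intros)
  then show ?thesis by (simp add: zero_power)
qed

lemma integral_ball_const:
  assumes "r \<ge> 0"
  shows "(\<integral>z. indicator (ball 0 r) (z::real^3) \<partial>lborel) = 4 / 3 * pi * r^3"
  using integral_ball_power[OF assms, of 0] by (simp add: has_bochner_integral_iff)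

lemma integral_ball_square:
  assumes "r \<ge> 0"
  shows "(\<integral>z. indicator (ball 0 r) (z::real^3) * (norm z)\<^sup>2 \<partial>lborel) = 4 / 3 * pi * r^3 * (3 * r\<^sup>2 / 5)"
proof -
  have "r^(2+3) = r^3 * r\<^sup>2" by (simp flip: power_add)
  then show ?thesis
    using integral_ball_power[OF assms, of 2] by (simp add: has_bochner_integral_iff mult.commute)
qed

text \<open>Let \<open>U\<^sub>r\<close> be the potential of the ball \<open>B\<^sub>r\<close>.  By symmetry of the energy, the integral of \<open>U\<^sub>r\<close> over \<open>B\<^sub>R\<close> is the integral
  of \<open>U\<^sub>R\<close> over \<open>B\<^sub>r\<close>, and for \<open>R \<ge> r\<close> the latter only involves the interior formula.  Comparing the radii \<open>R\<close> and
  \<open>R + \<eta>\<close> gives the average of the radial function \<open>U\<^sub>r\<close> over a thin shell, hence its value on the sphere of radius \<open>R\<close>.\<close>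

lemma pot_ball_outside:
  assumes r: "r > 0" and x: "norm x \<ge> r"
  shows "pot (indicator (ball 0 r)) x = 4 / 3 * pi * r^3 / norm x"
proof -
  define R where "R = norm x"
  have R: "R \<ge> r" "R > 0" using r x by (auto simp: R_def)
  let ?\<chi> = "\<lambda>R. indicator (ball (0::real^3) R) :: real^3 \<Rightarrow> real"
  let ?u = "pot (?\<chi> r)"
  let ?V = "4 / 3 * pi * r^3"
  obtain L where L: "L > 0" "\<And>x h. \<bar>?u (x + h) - ?u x\<bar> \<le> L * norm h" using pot_lipschitz[OF charge_ball] by metis
  have P: "energy (?\<chi> S) (?\<chi> r) = 2 * pi * S\<^sup>2 * ?V - 2 * pi / 3 * (\<integral>z. ?\<chi> r z * (norm z)\<^sup>2 \<partial>lborel)" if "S \<ge> r" for S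
  proof -
    have "energy (?\<chi> S) (?\<chi> r) = energy (?\<chi> r) (?\<chi> S)" by (intro energy_commute charge_ball)
    also have "\<dots> = (\<integral>z. 2 * pi * S\<^sup>2 * ?\<chi> r z - 2 * pi / 3 * (?\<chi> r z * (norm z)\<^sup>2) \<partial>lborel)"
      unfolding energy_def
    proof (intro Bochner_Integration.integral_cong refl)
      fix z :: "real^3"
      show "?\<chi> r z * pot (?\<chi> S) z = 2 * pi * S\<^sup>2 * ?\<chi> r z - 2 * pi / 3 * (?\<chi> r z * (norm z)\<^sup>2)"
        using pot_ball_inside[of z S] that by (cases "z \<in> ball 0 r") auto
    qed
    also have "\<dots> = (\<integral>z. 2 * pi * S\<^sup>2 * ?\<chi> r z \<partial>lborel) - (\<integral>z. 2 * pi / 3 * (?\<chi> r z * (norm z)\<^sup>2) \<partial>lborel)"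
    proof (rule Bochner_Integration.integral_diff)
      show "integrable lborel (\<lambda>z. 2 * pi * S\<^sup>2 * ?\<chi> r z)"
        by (intro integrable_mult_right charge_integrable charge_ball)
      have "integrable lborel (\<lambda>z::real^3. indicator (ball 0 r) z * (norm z)\<^sup>2 :: real)"
        using integral_ball_power[of r 2] r by (simp add: has_bochner_integral_iff mult.commute)
      then show "integrable lborel (\<lambda>z. 2 * pi / 3 * (?\<chi> r z * (norm z)\<^sup>2))" by (rule integrable_mult_right)
    qed
    also have "\<dots> = 2 * pi * S\<^sup>2 * ?V - 2 * pi / 3 * (\<integral>z. ?\<chi> r z * (norm z)\<^sup>2 \<partial>lborel)"
      using integral_ball_const[of r] r by (simp only: integral_mult_right_zero less_imp_le)
    finally show ?thesis .
  qed
  have bound: "\<bar>?V * 2 * pi * (2 * R + \<eta>) - ?u x * (4/3 * pi * (3 * R\<^sup>2 + 3 * R * \<eta> + \<eta>\<^sup>2))\<bar>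
       \<le> L * \<eta> * (4/3 * pi * (3 * R\<^sup>2 + 3 * R * \<eta> + \<eta>\<^sup>2))" (is "\<bar>_ - ?u x * ?W\<bar> \<le> _") if \<eta>: "\<eta> > 0" for \<eta>
  proof -
    let ?s = "\<lambda>z. ?\<chi> (R + \<eta>) z - ?\<chi> R z"
    have cs: "charge ?s" by (intro charge_diff charge_ball)
    have si: "integral\<^sup>L lborel ?s = \<eta> * ?W"
      using R \<eta> charge_integrable[OF charge_ball] integral_ball_const[of R] integral_ball_const[of "R + \<eta>"]
      by (simp add: power2_eq_square power3_eq_cube algebra_simps)
    have ie: "integral\<^sup>L lborel (\<lambda>z. ?s z * ?u z) = \<eta> * (?V * 2 * pi * (2 * R + \<eta>))"
    proof -
      have "integral\<^sup>L lborel (\<lambda>z. ?s z * ?u z) = energy (?\<chi> (R + \<eta>)) (?\<chi> r) - energy (?\<chi> R) (?\<chi> r)"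
        using energy_diff_left[OF charge_ball[of 0 "R + \<eta>"] charge_ball[of 0 R] charge_ball[of 0 r]] by (simp add: energy_def)
      also have "\<dots> = 2 * pi * ?V * ((R + \<eta>)\<^sup>2 - R\<^sup>2)" using P[of R] P[of "R + \<eta>"] R \<eta> by (simp add: algebra_simps)
      finally show ?thesis by (simp add: power2_eq_square algebra_simps)
    qed
    have close: "\<bar>?s z * ?u z - ?u x * ?s z\<bar> \<le> L * \<eta> * ?s z" for z
    proof (cases "R \<le> norm z \<and> norm z < R + \<eta>")
      case True
      \<comment> \<open>the point of the shell at the radius of \<open>z\<close> on the ray through \<open>x\<close>; the potential is radial\<close>
      define z' where "z' = (norm z / R) *\<^sub>R x"
      have "norm z' = norm z" using R by (simp add: z'_def R_def)
      then have "?u z = ?u z'" by (rule pot_ball_radial[symmetric])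
      moreover have "\<bar>?u (x + (z' - x)) - ?u x\<bar> \<le> L * norm (z' - x)" by (rule L)
      moreover have "norm (z' - x) = \<bar>norm z / R - 1\<bar> * R"
        unfolding z'_def R_def by (metis norm_scaleR scaleR_left.diff scaleR_one)
      moreover have "\<bar>norm z / R - 1\<bar> * R = norm z - R" using R True by (simp add: abs_if field_simps)
      ultimately have "\<bar>?u z - ?u x\<bar> \<le> L * (norm z - R)" by simp
      also have "\<dots> \<le> L * \<eta>" using True L by (intro mult_left_mono) auto
      finally show ?thesis using True by simp
    next
      case False
      then have "?s z = 0" using \<eta> by (auto simp: indicator_def)
      then show ?thesis by simp
    qed
    have i1: "integrable lborel (\<lambda>z. ?s z * ?u z)" by (rule integrable_energy0[OF cs charge_ball])
    have i2: "integrable lborel (\<lambda>z. ?u x * ?s z)" "integrable lborel (\<lambda>z. L * \<eta> * ?s z)"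
      by (intro integrable_mult_right charge_integrable[OF cs])+
    have "\<bar>\<eta> * (?V * 2 * pi * (2 * R + \<eta>)) - ?u x * (\<eta> * ?W)\<bar> = \<bar>\<integral>z. ?s z * ?u z - ?u x * ?s z \<partial>lborel\<bar>"
      unfolding Bochner_Integration.integral_diff[OF i1 i2(1)] integral_mult_right_zero si ie ..
    also have "\<dots> \<le> (\<integral>z. \<bar>?s z * ?u z - ?u x * ?s z\<bar> \<partial>lborel)" by (rule integral_abs_bound)
    also have "\<dots> \<le> (\<integral>z. L * \<eta> * ?s z \<partial>lborel)"
      by (rule integral_mono) (use i1 i2 close in auto)
    also have "\<dots> = L * \<eta> * (\<eta> * ?W)" unfolding integral_mult_right_zero si ..
    finally have *: "\<bar>\<eta> * (?V * 2 * pi * (2 * R + \<eta>)) - ?u x * (\<eta> * ?W)\<bar> \<le> L * \<eta> * (\<eta> * ?W)" .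
    have "\<bar>a - u * w\<bar> \<le> L * \<eta> * w" if "\<bar>\<eta> * a - u * (\<eta> * w)\<bar> \<le> L * \<eta> * (\<eta> * w)" for a u w
    proof -
      have "\<eta> * a - u * (\<eta> * w) = \<eta> * (a - u * w)" "L * \<eta> * (\<eta> * w) = \<eta> * (L * \<eta> * w)"
        by (simp_all add: algebra_simps)
      with that have "\<eta> * \<bar>a - u * w\<bar> \<le> \<eta> * (L * \<eta> * w)" using \<eta> by (simp only: abs_mult abs_of_pos)
      then show ?thesis using \<eta> by (rule mult_left_le_imp_le)
    qed
    from this[OF *] show ?thesis .
  qed
  have "((\<lambda>\<eta>. \<bar>?V * 2 * pi * (2 * R + \<eta>) - ?u x * (4/3 * pi * (3 * R\<^sup>2 + 3 * R * \<eta> + \<eta>\<^sup>2))\<bar>)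
      \<longlongrightarrow> \<bar>?V * 2 * pi * (2 * R + 0) - ?u x * (4/3 * pi * (3 * R\<^sup>2 + 3 * R * 0 + 0\<^sup>2))\<bar>) (at_right 0)"
    by (intro tendsto_intros)
  moreover have "((\<lambda>\<eta>. L * \<eta> * (4/3 * pi * (3 * R\<^sup>2 + 3 * R * \<eta> + \<eta>\<^sup>2))) \<longlongrightarrow> L * 0 * (4/3 * pi * (3 * R\<^sup>2 + 3 * R * 0 + 0\<^sup>2))) (at_right 0)"
    by (intro tendsto_intros)
  moreover have "\<forall>\<^sub>F \<eta> in at_right 0. \<bar>?V * 2 * pi * (2 * R + \<eta>) - ?u x * (4/3 * pi * (3 * R\<^sup>2 + 3 * R * \<eta> + \<eta>\<^sup>2))\<bar>
       \<le> L * \<eta> * (4/3 * pi * (3 * R\<^sup>2 + 3 * R * \<eta> + \<eta>\<^sup>2))"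
    using eventually_at_right_less[of "0::real"] by eventually_elim (rule bound)
  ultimately have "\<bar>?V * 2 * pi * (2 * R + 0) - ?u x * (4/3 * pi * (3 * R\<^sup>2 + 3 * R * 0 + 0\<^sup>2))\<bar> \<le> L * 0 * (4/3 * pi * (3 * R\<^sup>2 + 3 * R * 0 + 0\<^sup>2))"
    by (intro tendsto_le[OF trivial_limit_at_right_real])
  then have "?V * 2 * pi * (2 * R) = ?u x * (4/3 * pi * (3 * R\<^sup>2))" by simp
  then have "(4 * pi * R) * ?V = (4 * pi * R) * (?u x * R)" by (simp add: power2_eq_square algebra_simps)
  then have "?V = ?u x * R" by (rule mult_left_cancel[THEN iffD1, rotated]) (use R in simp)
  then show ?thesis using R by (simp add: R_def field_simps)
qed

text \<open>The excess of \<open>1 / \<bar>z\<bar>\<close> over its average on the ball of radius \<open>r\<close> around \<open>z\<close>: it is nonnegative and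
  vanishes for \<open>\<bar>z\<bar> \<ge> r\<close>.\<close>

definition mean_defect :: "real \<Rightarrow> real^3 \<Rightarrow> real" where
  "mean_defect r z = (r - norm z)\<^sup>2 * (norm z + 2 * r) / (2 * r^3 * norm z) * indicator (ball 0 r) z"

lemma mean_defect_nonneg: "r > 0 \<Longrightarrow> mean_defect r z \<ge> 0"
  by (simp add: mean_defect_def)

lemma mean_defect_measurable[measurable]: "mean_defect r \<in> borel_measurable borel"
  unfolding mean_defect_def by measurable

lemma mean_defect_integral:
  assumes r: "r > 0"
  shows "integrable lborel (mean_defect r)" "integral\<^sup>L lborel (mean_defect r) = 2 * pi * r\<^sup>2 / 5"
proof -
  let ?G = "\<lambda>s::real. 4 * pi * (s\<^sup>2 / 2 - s^3 * (1 / (2*r)) + s^5 * (1 / (10 * r^3)))"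
  have "has_bochner_integral lborel (\<lambda>z::real^3. (\<lambda>s. (r - s)\<^sup>2 * (s + 2 * r) / (2 * r^3 * s)) (norm z) * indicator (ball 0 r) z) (?G r - ?G 0)"
  proof (rule has_bochner_integral_radial_ball)
    fix s :: real assume s: "0 < s" "s < r"
    have "(?G has_real_derivative (4 * pi * (s - 3 * s\<^sup>2 * (1 / (2*r)) + 5 * s^4 * (1 / (10 * r^3))))) (at s)"
      by (rule derivative_eq_intros refl | simp)+
    also have "4 * pi * (s - 3 * s\<^sup>2 * (1 / (2*r)) + 5 * s^4 * (1 / (10 * r^3))) = 4 * pi * s\<^sup>2 * ((r - s)\<^sup>2 * (s + 2 * r) / (2 * r^3 * s))"
    proof -
      have "s - 3 * s\<^sup>2 * (1 / (2*r)) + 5 * s^4 * (1 / (10 * r^3)) = s\<^sup>2 * ((r - s)\<^sup>2 * (s + 2 * r) / (2 * r^3 * s))"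
      proof -
        have "(r - s)\<^sup>2 * (s + 2 * r) = 2 * r^3 - 3 * (r\<^sup>2 * s) + s^3"
          by (simp add: power2_eq_square power3_eq_cube algebra_simps)
        then show ?thesis using s r
          by (simp add: field_simps power2_eq_square power3_eq_cube power4_eq_xxxx)
      qed
      then show ?thesis by simp
    qed
    finally show "(?G has_real_derivative (4 * pi * s\<^sup>2 * ((r - s)\<^sup>2 * (s + 2 * r) / (2 * r^3 * s)))) (at s)" .
  qed (use r in \<open>auto intro!: continuous_intros\<close>)
  moreover have "?G r - ?G 0 = 2 * pi * r\<^sup>2 / 5"
    using r by (simp add: field_simps power2_eq_square power3_eq_cube power_def numeral_eq_Suc)
  ultimately have "has_bochner_integral lborel (mean_defect r) (2 * pi * r\<^sup>2 / 5)"
    by (simp only: mean_defect_def[abs_def])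
  then show "integrable lborel (mean_defect r)" "integral\<^sup>L lborel (mean_defect r) = 2 * pi * r\<^sup>2 / 5"
    by (auto simp: has_bochner_integral_iff)
qed

lemma pot_ball_eq:
  assumes r: "r > 0" and z: "z \<noteq> 0"
  shows "pot (indicator (ball 0 r)) z = 4 / 3 * pi * r^3 * (1 / norm z - mean_defect r z)"
proof (cases "norm z < r")
  case True
  have "4 / 3 * pi * r^3 * (1 / norm z - mean_defect r z) = 4 / 3 * pi * (r^3 * (1 / norm z - (r - norm z)\<^sup>2 * (norm z + 2 * r) / (2 * r^3 * norm z)))"
    unfolding mean_defect_def using True by (simp only: mem_ball dist_0_norm indicator_simps mult_1_right mult.assoc)
  also have "r^3 * (1 / norm z - (r - norm z)\<^sup>2 * (norm z + 2 * r) / (2 * r^3 * norm z)) = 3 / 2 * r\<^sup>2 - (norm z)\<^sup>2 / 2"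
  proof -
    have nz: "norm z \<noteq> 0" "r \<noteq> 0" using r z by auto
    have "r^3 * (1 / a - (r - a)\<^sup>2 * (a + 2 * r) / (2 * r^3 * a)) = 3 / 2 * r\<^sup>2 - a\<^sup>2 / 2" if "a \<noteq> 0" "r \<noteq> 0" for a :: real
    proof -
      have "(r - a)\<^sup>2 * (a + 2 * r) = 2 * r^3 - 3 * (r\<^sup>2 * a) + a^3"
        by (simp add: power2_eq_square power3_eq_cube algebra_simps)
      then show ?thesis using that by (simp add: field_simps power2_eq_square power3_eq_cube)
    qed
    then show ?thesis using nz by blast
  qed
  finally have e: "4 / 3 * pi * r^3 * (1 / norm z - mean_defect r z) = 4 / 3 * pi * (3 / 2 * r\<^sup>2 - (norm z)\<^sup>2 / 2)" .
  show ?thesis unfolding e pot_ball_inside[OF True] by (simp add: field_simps)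
next
  case False
  then show ?thesis using pot_ball_outside[OF r, of z] by (simp add: mean_defect_def)
qed

lemma pot_ball_translate: "pot (indicator (ball c r)) x = pot (indicator (ball 0 r)) (x - c)"
proof -
  have "(\<lambda>y. indicator (ball 0 r) (- c + y)) = (indicator (ball c r) :: real^3 \<Rightarrow> real)"
    by (auto simp: fun_eq_iff indicator_def dist_norm norm_minus_commute)
  then show ?thesis using pot_translate[OF charge_ball[of 0 r], of "- c" x] by simp
qed

text \<open>The integral of the potential over a ball is the energy of the charge against that ball; by symmetry it is the integral of the charge against the potential of the ball, which is known.\<close>

theorem pot_mean_value:
  assumes f: "charge f" and r: "r > 0"
  shows "(\<integral>h. indicator (ball 0 r) h * pot f (x + h) \<partial>lborel)
     = 4 / 3 * pi * r^3 * (pot f x - (\<integral>y. f y * mean_defect r (y - x) \<partial>lborel))"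
    and "integrable lborel (\<lambda>y. f y * mean_defect r (y - x))"
proof -
  note [measurable] = charge_measurable[OF f]
  obtain M R where M: "M > 0" "\<And>y. \<bar>f y\<bar> \<le> M * indicator (ball 0 R) y" using chargeE[OF f] by metis
  have b: "\<bar>f y\<bar> \<le> M" for y using M(1) M(2)[of y] by (cases "y \<in> ball 0 R") auto
  have id: "integrable lborel (\<lambda>y. mean_defect r (y - x))"
    using integrable_translate[OF mean_defect_integral(1)[OF r], of "- x"] by simp
  show i: "integrable lborel (\<lambda>y. f y * mean_defect r (y - x))"
  proof (rule integrable_dominated)
    show "integrable lborel (\<lambda>y. M * mean_defect r (y - x))" by (intro integrable_mult_right id)
    show "\<bar>f y * mean_defect r (y - x)\<bar> \<le> M * mean_defect r (y - x)" for y
      using b[of y] mean_defect_nonneg[OF r, of "y - x"] by (simp add: abs_mult mult_right_mono)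
  qed measurable
  have "(\<integral>h. indicator (ball 0 r) h * pot f (x + h) \<partial>lborel) = (\<integral>h. (\<lambda>z. indicator (ball x r) z * pot f z) (x + h) \<partial>lborel)"
    by (intro Bochner_Integration.integral_cong refl) (simp add: indicator_def dist_norm)
  also have "\<dots> = energy (indicator (ball x r)) f"
    unfolding energy_def by (rule integral_translate) (use pot_measurable[OF f] in measurable)
  also have "\<dots> = energy f (indicator (ball x r))" by (rule energy_commute[OF charge_ball f])
  also have "\<dots> = (\<integral>y. 4 / 3 * pi * r^3 * (f y / norm (x - y) - f y * mean_defect r (y - x)) \<partial>lborel)"
    unfolding energy_def
  proof (rule integral_cong_AE)
    show "AE y in lborel. f y * pot (indicator (ball x r)) y = 4 / 3 * pi * r^3 * (f y / norm (x - y) - f y * mean_defect r (y - x))"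
      using AE_lborel_singleton[of x]
    proof eventually_elim
      case (elim y)
      then have "pot (indicator (ball x r)) y = 4 / 3 * pi * r^3 * (1 / norm (x - y) - mean_defect r (y - x))"
        using pot_ball_eq[OF r, of "y - x"] by (simp only: pot_ball_translate[of x] norm_minus_commute[of x y]) simp
      moreover have "f y * (c * (1 / d - m)) = c * (f y / d - f y * m)" for c d m :: real
        by (simp add: algebra_simps)
      ultimately show ?case by (simp only:)
    qed
    show "(\<lambda>y. f y * pot (indicator (ball x r)) y) \<in> borel_measurable lborel"
      using pot_measurable[OF charge_ball[of x r]] by measurable
  qed measurable
  also have "\<dots> = 4 / 3 * pi * r^3 * (pot f x - (\<integral>y. f y * mean_defect r (y - x) \<partial>lborel))"
    unfolding integral_mult_right_zero by (simp only: Bochner_Integration.integral_diff[OF integrable_pot[OF f] i] pot_def)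
  finally show "(\<integral>h. indicator (ball 0 r) h * pot f (x + h) \<partial>lborel)
     = 4 / 3 * pi * r^3 * (pot f x - (\<integral>y. f y * mean_defect r (y - x) \<partial>lborel))" .
qed

lemma mean_defect_translate_integral:
  assumes "r > 0"
  shows "(\<integral>y. mean_defect r (y - x) \<partial>lborel) = 2 * pi * r\<^sup>2 / 5"
  using integral_translate[OF mean_defect_measurable[of r], of "- x"] mean_defect_integral(2)[OF assms] by simp

lemma pot_mean_value_inside:
  assumes A: "bounded A" "A \<in> sets borel" and r: "r > 0" and sub: "ball x r \<subseteq> A"
  shows "(\<integral>h. indicator (ball 0 r) h * pot (indicator A) (x + h) \<partial>lborel)
     = 4 / 3 * pi * r^3 * (pot (indicator A) x - 2 * pi * r\<^sup>2 / 5)"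
proof -
  have "indicator A y * mean_defect r (y - x) = mean_defect r (y - x)" for y
  proof (cases "y \<in> A")
    case False
    then have "y \<notin> ball x r" using sub by auto
    then show ?thesis by (simp add: mean_defect_def dist_norm norm_minus_commute)
  qed simp
  then have "(\<integral>y. indicator A y * mean_defect r (y - x) \<partial>lborel) = 2 * pi * r\<^sup>2 / 5"
    by (simp only: mean_defect_translate_integral[OF r])
  then show ?thesis
    unfolding pot_mean_value(1)[OF charge_indicator[OF A] r, of x] by simp
qed

lemma pot_mean_value_ge:
  assumes A: "bounded A" "A \<in> sets borel" and r: "r > 0"
  shows "(\<integral>h. indicator (ball 0 r) h * pot (indicator A) (x + h) \<partial>lborel)
     \<ge> 4 / 3 * pi * r^3 * (pot (indicator A) x - 2 * pi * r\<^sup>2 / 5)"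
proof -
  have "(\<integral>y. indicator A y * mean_defect r (y - x) \<partial>lborel) \<le> (\<integral>y. mean_defect r (y - x) \<partial>lborel)"
  proof (rule integral_mono)
    show "integrable lborel (\<lambda>y. indicator A y * mean_defect r (y - x))"
      by (rule pot_mean_value(2)[OF charge_indicator[OF A] r])
    show "integrable lborel (\<lambda>y. mean_defect r (y - x))"
      using integrable_translate[OF mean_defect_integral(1)[OF r], of "- x"] by simp
    show "indicator A y * mean_defect r (y - x) \<le> mean_defect r (y - x)" for y
      using mean_defect_nonneg[OF r, of "y - x"] by (auto simp: indicator_def)
  qed
  then show ?thesis
    unfolding pot_mean_value(1)[OF charge_indicator[OF A] r, of x] mean_defect_translate_integral[OF r]
    using r by (intro mult_left_mono) auto
qed

section \<open>Spheroids with a prescribed row of the potential\<close>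

text \<open>The reflection in the plane orthogonal to a unit vector.  Two vectors of equal length that are both orthogonal to \<open>n\<close> are exchanged by such a reflection fixing \<open>n\<close>.\<close>

definition householder :: "real^3 \<Rightarrow> real^3 \<Rightarrow> real^3" where
  "householder u y = y - (2 * (u \<bullet> y)) *\<^sub>R u"

lemma orthogonal_householder:
  assumes "norm u = 1"
  shows "orthogonal_transformation (householder u)"
proof -
  have "u \<bullet> u = 1" using assms by (simp add: dot_square_norm)
  then show ?thesis
    unfolding orthogonal_transformation_def householder_def
    by (auto intro!: linearI simp: algebra_simps inner_simps inner_commute scaleR_add_left)
qed

lemma inner_householder: "a \<bullet> householder u y = householder u a \<bullet> y"
  by (simp add: householder_def inner_simps inner_commute)

lemma sph_form_householder:
  assumes u: "norm u = 1" and "n \<bullet> u = 0 \<or> n = u"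
  shows "sph_form n \<kappa> (householder u y) (householder u y) = sph_form n \<kappa> y y"
proof -
  have "u \<bullet> u = 1" using u by (simp add: dot_square_norm)
  with assms have "(n \<bullet> householder u y) * (n \<bullet> householder u y) = (n \<bullet> y) * (n \<bullet> y)"
    by (auto simp: householder_def inner_simps)
  then show ?thesis
    using inner_orthogonal_transformation[OF orthogonal_householder[OF u]] by (simp add: sph_form_def)
qed

lemma indicator_ball_householder:
  "norm u = 1 \<Longrightarrow> indicator (ball 0 r) (householder u y) = indicator (ball 0 r) y"
  by (simp add: indicator_def orthogonal_transformation_norm[OF orthogonal_householder])

text \<open>The entries of the matrix through which the potential of a spheroid depends on the position; a reflection that preserves the spheroid preserves this matrix.\<close>

definition sph_moment :: "real^3 \<Rightarrow> real \<Rightarrow> real^3 \<Rightarrow> real^3 \<Rightarrow> real" where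
  "sph_moment n \<kappa> a b = (\<integral>y. indicator (ball 0 1) y * ((a \<bullet> y) * (b \<bullet> y) / (sph_form n \<kappa> y y)\<^sup>2) \<partial>lborel)"

lemma sph_moment_householder:
  assumes u: "norm u = 1" and nu: "n \<bullet> u = 0 \<or> n = u"
  shows "sph_moment n \<kappa> (householder u a) (householder u b) = sph_moment n \<kappa> a b"
proof -
  have "sph_moment n \<kappa> (householder u a) (householder u b) =
     (\<integral>y. (\<lambda>y. indicator (ball 0 1) y * ((a \<bullet> y) * (b \<bullet> y) / (sph_form n \<kappa> y y)\<^sup>2)) (householder u y) \<partial>lborel)"
    unfolding sph_moment_def
    by (simp only: sph_form_householder[OF u nu] indicator_ball_householder[OF u] inner_householder)
  also have "\<dots> = sph_moment n \<kappa> a b"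
    unfolding sph_moment_def by (rule integral_orthogonal[OF orthogonal_householder[OF u]]) measurable
  finally show ?thesis .
qed

lemma sph_moment_bilinear:
  assumes "\<kappa> \<ge> 0"
  shows "sph_moment n \<kappa> (p *\<^sub>R a + q *\<^sub>R b) (p *\<^sub>R a + q *\<^sub>R b)
     = p\<^sup>2 * sph_moment n \<kappa> a a + 2 * p * q * sph_moment n \<kappa> a b + q\<^sup>2 * sph_moment n \<kappa> b b"
proof -
  note i = integrable_sph(2)[OF assms, of _ _ n]
  let ?F = "\<lambda>a b y. indicator (ball 0 1) y * ((a \<bullet> y) * (b \<bullet> y) / (sph_form n \<kappa> y y)\<^sup>2)"
  have "sph_moment n \<kappa> (p *\<^sub>R a + q *\<^sub>R b) (p *\<^sub>R a + q *\<^sub>R b) =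
     (\<integral>y. p\<^sup>2 * ?F a a y + (2 * p * q) * ?F a b y + q\<^sup>2 * ?F b b y \<partial>lborel)"
    unfolding sph_moment_def
    by (intro Bochner_Integration.integral_cong refl)
      (simp add: inner_simps add_divide_distrib[symmetric] power2_eq_square algebra_simps)
  also have "\<dots> = (\<integral>y. p\<^sup>2 * ?F a a y \<partial>lborel) + (\<integral>y. (2 * p * q) * ?F a b y \<partial>lborel) + (\<integral>y. q\<^sup>2 * ?F b b y \<partial>lborel)"
    by (simp only: Bochner_Integration.integral_add Bochner_Integration.integrable_add integrable_mult_right i)
  finally show ?thesis by (simp only: integral_mult_right_zero sph_moment_def)
qed

lemma sph_moment_cross:
  assumes n: "norm n = 1" and a: "n \<bullet> a = 0"
  shows "sph_moment n \<kappa> n a = 0"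
proof -
  have "householder n n = - n" "householder n a = a"
    using n a by (simp_all add: householder_def dot_square_norm scaleR_2)
  then have "sph_moment n \<kappa> n a = sph_moment n \<kappa> (- n) a"
    using sph_moment_householder[OF n, of n \<kappa> n a] by simp
  also have "\<dots> = - sph_moment n \<kappa> n a"
    unfolding sph_moment_def by (simp flip: integral_minus)
  finally show ?thesis by simp
qed

lemma sph_moment_perp:
  assumes n: "norm n = 1" and b: "norm b = 1" "n \<bullet> b = 0" and p: "n \<bullet> p = 0" and \<kappa>: "\<kappa> \<ge> 0"
  shows "sph_moment n \<kappa> p p = (norm p)\<^sup>2 * sph_moment n \<kappa> b b"
proof -
  define a where "a = norm p *\<^sub>R b"
  have na: "norm a = norm p" using b by (simp add: a_def)
  have "sph_moment n \<kappa> a a = (norm p)\<^sup>2 * sph_moment n \<kappa> b b"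
    using sph_moment_bilinear[OF \<kappa>, of n "norm p" b 0 b] by (simp add: a_def)
  moreover have "sph_moment n \<kappa> p p = sph_moment n \<kappa> a a"
  proof (cases "p = a")
    case False
    define u where "u = (1 / norm (p - a)) *\<^sub>R (p - a)"
    have d: "norm (p - a) \<noteq> 0" using False by simp
    have u: "norm u = 1" using d by (simp add: u_def)
    have nu: "n \<bullet> u = 0" using b p by (simp add: u_def a_def inner_simps)
    have "2 * ((p - a) \<bullet> a) = - (norm (p - a))\<^sup>2"
      using na by (simp add: power2_norm_eq_inner inner_simps inner_commute norm_eq)
    moreover have "u \<bullet> a = (1 / norm (p - a)) * ((p - a) \<bullet> a)" by (simp only: u_def inner_scaleR_left)
    ultimately have "2 * (u \<bullet> a) = - norm (p - a)" using d by (simp add: power2_eq_square)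
    then have "householder u a = p" using d by (simp add: householder_def u_def)
    then show ?thesis using sph_moment_householder[OF u, of n \<kappa> a a] nu by simp
  qed simp
  ultimately show ?thesis by simp
qed

text \<open>For a unit vector \<open>b\<close> orthogonal to \<open>n\<close> this is the double eigenvalue of the Hessian of the Newtonian potential inside the spheroid.\<close>

definition sph_coeff :: "real^3 \<Rightarrow> real^3 \<Rightarrow> real \<Rightarrow> real" where
  "sph_coeff n b \<kappa> = 1 / (4 * pi) *
     (\<integral>y. indicator (ball 0 1) y * (1 / sph_form n \<kappa> y y - 2 * ((b \<bullet> y)\<^sup>2 / (sph_form n \<kappa> y y)\<^sup>2)) \<partial>lborel)"

lemma sph_coeff_eq:
  assumes \<kappa>: "\<kappa> \<ge> 0"
  shows "sph_coeff n b \<kappa> = 1 / (4 * pi) * ((\<integral>y. indicator (ball 0 1) y / sph_form n \<kappa> y y \<partial>lborel) - 2 * sph_moment n \<kappa> b b)"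
proof -
  have "(\<integral>y. indicator (ball 0 1) y * (1 / sph_form n \<kappa> y y - 2 * ((b \<bullet> y)\<^sup>2 / (sph_form n \<kappa> y y)\<^sup>2)) \<partial>lborel)
     = (\<integral>y. indicator (ball 0 1) y / sph_form n \<kappa> y y - 2 * (indicator (ball 0 1) y * ((b \<bullet> y) * (b \<bullet> y) / (sph_form n \<kappa> y y)\<^sup>2)) \<partial>lborel)"
    by (intro Bochner_Integration.integral_cong refl) (simp add: power2_eq_square algebra_simps)
  also have "\<dots> = (\<integral>y. indicator (ball 0 1) y / sph_form n \<kappa> y y \<partial>lborel) - (\<integral>y. 2 * (indicator (ball 0 1) y * ((b \<bullet> y) * (b \<bullet> y) / (sph_form n \<kappa> y y)\<^sup>2)) \<partial>lborel)"
    by (intro Bochner_Integration.integral_diff integrable_mult_right integrable_sph[OF \<kappa>])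
  finally show ?thesis by (simp only: sph_coeff_def sph_moment_def integral_mult_right_zero)
qed

text \<open>By its symmetries the Hessian has the eigenvector \<open>n\<close> and one eigenvalue on the orthogonal plane.  The size \<open>\<rho>\<close> enters only through the additive constant.\<close>

lemma pot_spheroid_quadratic:
  assumes n: "norm n = 1" and b: "norm b = 1" "n \<bullet> b = 0" and \<kappa>: "\<kappa> \<ge> 0"
  defines "t \<equiv> sph_coeff n b \<kappa>"
  obtains s where "\<And>\<rho>. \<rho> > 0 \<Longrightarrow> \<exists>c. \<forall>x \<in> spheroid n \<kappa> \<rho>. pot (indicator (spheroid n \<kappa> \<rho>)) x
     = c - 2 * pi * (s * (n \<bullet> x)\<^sup>2 + t * ((norm x)\<^sup>2 - (n \<bullet> x)\<^sup>2))"
proof -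
  define I where "I = (\<integral>y. indicator (ball 0 1) y / sph_form n \<kappa> y y \<partial>lborel)"
  define Qn Qb where "Qn = sph_moment n \<kappa> n n" and "Qb = sph_moment n \<kappa> b b"
  define s where "s = 1 / (4 * pi) * ((1 + \<kappa>) * I - 2 * (1 + \<kappa>)\<^sup>2 * Qn)"
  have t: "4 * pi * t = I - 2 * Qb" using sph_coeff_eq[OF \<kappa>, of n b] by (simp add: t_def I_def Qb_def)
  have s: "4 * pi * s = (1 + \<kappa>) * I - 2 * (1 + \<kappa>)\<^sup>2 * Qn" by (simp add: s_def)
  have nn: "n \<bullet> n = 1" using n by (simp add: dot_square_norm)
  have "pot (indicator (spheroid n \<kappa> \<rho>)) x = \<rho>\<^sup>2 / 2 * I - 2 * pi * (s * (n \<bullet> x)\<^sup>2 + t * ((norm x)\<^sup>2 - (n \<bullet> x)\<^sup>2))"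
    if \<rho>: "\<rho> > 0" and x: "x \<in> spheroid n \<kappa> \<rho>" for \<rho> x
  proof -
    define \<xi> p where "\<xi> = n \<bullet> x" and "p = x - (n \<bullet> x) *\<^sub>R n"
    have np: "n \<bullet> p = 0" by (simp add: p_def inner_simps nn)
    have pp: "(norm p)\<^sup>2 = (norm x)\<^sup>2 - \<xi>\<^sup>2"
      by (simp only: p_def \<xi>_def power2_norm_eq_inner) (simp add: inner_simps nn inner_commute power2_eq_square)
    have B: "sph_form n \<kappa> x y = (((1 + \<kappa>) * \<xi>) *\<^sub>R n + 1 *\<^sub>R p) \<bullet> y" for y
      by (simp add: sph_form_def p_def \<xi>_def inner_simps algebra_simps)
    have A: "sph_form n \<kappa> x x = (norm x)\<^sup>2 + \<kappa> * \<xi>\<^sup>2"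
      by (simp add: sph_form_def \<xi>_def dot_square_norm power2_eq_square)
    have "(\<integral>y. indicator (ball 0 1) y * ((sph_form n \<kappa> x y)\<^sup>2 / (sph_form n \<kappa> y y)\<^sup>2) \<partial>lborel)
      = sph_moment n \<kappa> (((1 + \<kappa>) * \<xi>) *\<^sub>R n + 1 *\<^sub>R p) (((1 + \<kappa>) * \<xi>) *\<^sub>R n + 1 *\<^sub>R p)"
      unfolding B sph_moment_def power2_eq_square[of "_ \<bullet> _"] ..
    also have "\<dots> = ((1 + \<kappa>) * \<xi>)\<^sup>2 * Qn + ((norm x)\<^sup>2 - \<xi>\<^sup>2) * Qb"
      unfolding sph_moment_bilinear[OF \<kappa>] sph_moment_cross[OF n np] sph_moment_perp[OF n b np \<kappa>]
      by (simp add: Qn_def Qb_def pp)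
    finally have "pot (indicator (spheroid n \<kappa> \<rho>)) x = ((1 + \<kappa>) * \<xi>)\<^sup>2 * Qn + ((norm x)\<^sup>2 - \<xi>\<^sup>2) * Qb
        + (\<rho>\<^sup>2 - ((norm x)\<^sup>2 + \<kappa> * \<xi>\<^sup>2)) / 2 * I"
      using pot_spheroid_integral[OF \<kappa> \<rho> x] by (simp add: A I_def)
    also have "\<dots> = \<rho>\<^sup>2 / 2 * I - 1 / 2 * ((4 * pi * s) * \<xi>\<^sup>2 + (4 * pi * t) * ((norm x)\<^sup>2 - \<xi>\<^sup>2))"
      unfolding s t by (simp add: field_simps power2_eq_square)
    finally show ?thesis by (simp add: \<xi>_def algebra_simps)
  qed
  then show ?thesis using that by blast
qed

lemma ball_subset_spheroid:
  assumes n: "norm n = 1" and \<kappa>: "\<kappa> \<ge> 0" and r: "r > 0"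
  shows "ball 0 r \<subseteq> spheroid n \<kappa> ((1 + \<kappa>) * r)"
proof
  fix z assume "z \<in> ball (0::real^3) r"
  then have z: "(norm z)\<^sup>2 < r\<^sup>2" by (simp add: power_strict_mono)
  have "\<bar>n \<bullet> z\<bar> \<le> norm z" using Cauchy_Schwarz_ineq2[of n z] n by simp
  then have "(n \<bullet> z)\<^sup>2 \<le> (norm z)\<^sup>2" by (metis abs_le_square_iff abs_norm_cancel)
  then have "\<kappa> * (n \<bullet> z)\<^sup>2 \<le> \<kappa> * (norm z)\<^sup>2" using \<kappa> by (rule mult_left_mono)
  then have "sph_form n \<kappa> z z \<le> (1 + \<kappa>) * (norm z)\<^sup>2"
    by (simp add: sph_form_def dot_square_norm power2_eq_square algebra_simps)
  also have "\<dots> < (1 + \<kappa>) * r\<^sup>2" using z \<kappa> by simp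
  also have "\<dots> \<le> (1 + \<kappa>)\<^sup>2 * r\<^sup>2" using \<kappa> by (intro mult_right_mono) (auto simp: power2_eq_square algebra_simps)
  finally show "z \<in> spheroid n \<kappa> ((1 + \<kappa>) * r)" by (simp add: spheroid_def power_mult_distrib)
qed

lemma ball_moment:
  assumes r: "r > 0"
  shows "(\<integral>h. indicator (ball 0 r) h * ((a \<bullet> h) * (b \<bullet> h)) \<partial>(lborel :: (real^3) measure)) = 4 / 3 * pi * r^3 * (r\<^sup>2 / 5 * (a \<bullet> b))"
    and "integrable (lborel :: (real^3) measure) (\<lambda>h. indicator (ball 0 r) h * ((a \<bullet> h) * (b \<bullet> h)))"
proof -
  have i: "integrable lborel (\<lambda>z::real^3. indicator (ball 0 r) z * (norm z)\<^sup>2 :: real)"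
    using integral_ball_power[of r 2] r by (simp add: has_bochner_integral_iff mult.commute)
  have "(\<integral>h. indicator (ball 0 r) h * ((a \<bullet> h) * (b \<bullet> h)) \<partial>(lborel :: (real^3) measure))
      = (a \<bullet> b) / 3 * (\<integral>z. indicator (ball 0 r) z * (norm (z::real^3))\<^sup>2 \<partial>lborel)"
    by (rule second_moment[where w="indicator (ball 0 r)", OF _ i]) (auto simp: orthogonal_transformation_norm indicator_def)
  then show "(\<integral>h. indicator (ball 0 r) h * ((a \<bullet> h) * (b \<bullet> h)) \<partial>(lborel :: (real^3) measure)) = 4 / 3 * pi * r^3 * (r\<^sup>2 / 5 * (a \<bullet> b))"
    using r by (simp add: integral_ball_square)
  show "integrable (lborel :: (real^3) measure) (\<lambda>h. indicator (ball 0 r) h * ((a \<bullet> h) * (b \<bullet> h)))"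
    by (rule integrable_second_moment[OF _ i]) measurable
qed

text \<open>The mean value formula at the centre is the statement that the Hessian has trace one.\<close>

lemma spheroid_trace:
  assumes n: "norm n = 1" and \<kappa>: "\<kappa> \<ge> 0"
    and q: "\<And>\<rho>. \<rho> > 0 \<Longrightarrow> \<exists>c. \<forall>x \<in> spheroid n \<kappa> \<rho>. pot (indicator (spheroid n \<kappa> \<rho>)) x
     = c - 2 * pi * (s * (n \<bullet> x)\<^sup>2 + t * ((norm x)\<^sup>2 - (n \<bullet> x)\<^sup>2))"
  shows "s + 2 * t = 1"
proof -
  \<comment> \<open>large enough to contain the unit ball, over which the potential is averaged\<close>
  let ?E = "spheroid n \<kappa> (1 + \<kappa>)"
  let ?V = "4 / 3 * pi * 1^3 :: real"
  obtain c where c: "\<And>x. x \<in> ?E \<Longrightarrow> pot (indicator ?E) x = c - 2 * pi * (s * (n \<bullet> x)\<^sup>2 + t * ((norm x)\<^sup>2 - (n \<bullet> x)\<^sup>2))"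
    using q[of "1 + \<kappa>"] \<kappa> by auto
  have sub: "ball 0 1 \<subseteq> ?E" using ball_subset_spheroid[OF n \<kappa>, of 1] by simp
  have "0 \<in> ?E" using sub by (rule subsetD) simp
  then have c0: "pot (indicator ?E) 0 = c" using c[of 0] by simp
  have i2: "integrable lborel (\<lambda>h::real^3. indicator (ball 0 1) h * (norm h)\<^sup>2 :: real)"
    using integral_ball_power[of 1 2] by (simp add: has_bochner_integral_iff mult.commute)
  have i1: "integrable lborel (\<lambda>h::real^3. indicator (ball 0 1) h :: real)" by (rule charge_integrable[OF charge_ball])
  have "(\<integral>h. indicator (ball 0 1) h * pot (indicator ?E) (0 + h) \<partial>lborel)
     = (\<integral>h. c * indicator (ball 0 1) h - (2 * pi * (s - t)) * (indicator (ball 0 1) h * ((n \<bullet> h) * (n \<bullet> h)))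
         - (2 * pi * t) * (indicator (ball 0 1) h * (norm h)\<^sup>2) \<partial>lborel)"
  proof (intro Bochner_Integration.integral_cong refl)
    fix h :: "real^3"
    show "indicator (ball 0 1) h * pot (indicator ?E) (0 + h) = c * indicator (ball 0 1) h - (2 * pi * (s - t)) * (indicator (ball 0 1) h * ((n \<bullet> h) * (n \<bullet> h)))
         - (2 * pi * t) * (indicator (ball 0 1) h * (norm h)\<^sup>2)"
      using c[of h] sub by (cases "h \<in> ball 0 1") (auto simp: power2_eq_square algebra_simps)
  qed
  also have "\<dots> = c * ?V - (2 * pi * (s - t)) * (?V * (1\<^sup>2 / 5 * (n \<bullet> n))) - (2 * pi * t) * (?V * (3 * 1\<^sup>2 / 5))"
    by (simp only: Bochner_Integration.integral_diff Bochner_Integration.integrable_diff integrable_mult_right i1 i2 ball_moment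
      integral_mult_right_zero integral_ball_const integral_ball_square zero_less_one zero_le_one)
  finally have "(\<integral>h. indicator (ball 0 1) h * pot (indicator ?E) (0 + h) \<partial>lborel) = ?V * (c - 2 * pi / 5 * (s + 2 * t))"
    using n by (simp add: dot_square_norm field_simps)
  moreover have "bounded ?E" using spheroid_subset[of \<kappa> "1 + \<kappa>" n] \<kappa> bounded_subset[OF bounded_ball] by auto
  ultimately have "?V * (c - 2 * pi / 5 * (s + 2 * t)) = ?V * (c - 2 * pi * 1\<^sup>2 / 5)"
    using pot_mean_value_inside[of ?E 1 0] sub c0 by simp
  then show ?thesis by simp
qed

lemma sph_coeff_integrand_bound:
  assumes \<kappa>: "\<kappa> \<ge> 0" and b: "norm b = 1"
  shows "\<bar>indicator (ball 0 1) y * (1 / sph_form n \<kappa> y y - 2 * ((b \<bullet> y)\<^sup>2 / (sph_form n \<kappa> y y)\<^sup>2))\<bar> \<le> 3 * (indicator (ball 0 1) y / (norm y)\<^sup>2)"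
proof (cases "y = 0")
  case False
  let ?\<alpha> = "sph_form n \<kappa> y y"
  have a: "?\<alpha> \<ge> (norm y)\<^sup>2" "(norm y)\<^sup>2 > 0" using sph_form_ge[OF \<kappa>] False by auto
  then have a0: "?\<alpha> > 0" by linarith
  have "\<bar>b \<bullet> y\<bar> \<le> norm y" using Cauchy_Schwarz_ineq2[of b y] b by simp
  then have bly: "(b \<bullet> y)\<^sup>2 \<le> (norm y)\<^sup>2" by (metis abs_le_square_iff abs_norm_cancel)
  have 1: "1 / ?\<alpha> \<le> 1 / (norm y)\<^sup>2" using a a0 by (intro divide_left_mono mult_pos_pos) auto
  have "(b \<bullet> y)\<^sup>2 / ?\<alpha>\<^sup>2 \<le> (norm y)\<^sup>2 / ((norm y)\<^sup>2)\<^sup>2"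
  proof (rule frac_le)
    show "((norm y)\<^sup>2)\<^sup>2 \<le> ?\<alpha>\<^sup>2" using a by (intro power_mono) auto
  qed (use bly False in auto)
  also have "\<dots> = 1 / (norm y)\<^sup>2" using False by (simp add: power2_eq_square)
  finally have 2: "(b \<bullet> y)\<^sup>2 / ?\<alpha>\<^sup>2 \<le> 1 / (norm y)\<^sup>2" .
  have "0 \<le> 1 / ?\<alpha>" "0 \<le> (b \<bullet> y)\<^sup>2 / ?\<alpha>\<^sup>2" using a0 by auto
  with 1 2 have "\<bar>1 / ?\<alpha> - 2 * ((b \<bullet> y)\<^sup>2 / ?\<alpha>\<^sup>2)\<bar> \<le> 3 * (1 / (norm y)\<^sup>2)" by linarith
  then show ?thesis by (cases "y \<in> ball 0 1") auto
qed (simp add: sph_form_def)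

lemma sph_coeff_continuous:
  assumes b: "norm b = 1"
  shows "continuous_on {0..} (sph_coeff n b)"
proof (rule continuous_on_sequentiallyI)
  fix u :: "nat \<Rightarrow> real" and a assume u: "\<forall>k. u k \<in> {0..}" and a: "a \<in> {0..}" and lim: "u \<longlonglongrightarrow> a"
  let ?F = "\<lambda>\<kappa> y. indicator (ball 0 1) y * (1 / sph_form n \<kappa> y y - 2 * ((b \<bullet> y)\<^sup>2 / (sph_form n \<kappa> y y)\<^sup>2))"
  have "(\<lambda>k. integral\<^sup>L lborel (?F (u k))) \<longlonglongrightarrow> integral\<^sup>L lborel (?F a)"
  proof (rule integral_dominated_convergence)
    show "integrable lborel (\<lambda>y::real^3. 3 * (indicator (ball 0 1) y / (norm y)\<^sup>2))"
      by (intro integrable_mult_right integrable_inverse_square_ball)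
    show "AE y in lborel. (\<lambda>k. ?F (u k) y) \<longlonglongrightarrow> ?F a y"
      using AE_lborel_singleton[of 0]
    proof eventually_elim
      case (elim y)
      have "(\<lambda>k. sph_form n (u k) y y) \<longlonglongrightarrow> sph_form n a y y"
        unfolding sph_form_def by (intro tendsto_intros lim)
      moreover have "sph_form n a y y \<noteq> 0" using sph_form_pos[OF _ elim, of a n] a by auto
      ultimately show ?case by (intro tendsto_intros) auto
    qed
    show "AE y in lborel. norm (?F (u k) y) \<le> 3 * (indicator (ball 0 1) y / (norm y)\<^sup>2)" for k
      unfolding real_norm_def by (rule AE_I2, rule sph_coeff_integrand_bound) (use u b in auto)
  qed measurable
  then show "(\<lambda>k. sph_coeff n b (u k)) \<longlonglongrightarrow> sph_coeff n b a"
    unfolding sph_coeff_def by (intro tendsto_mult tendsto_const)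
qed

lemma sph_coeff_at_0:
  assumes b: "norm b = 1"
  shows "sph_coeff n b 0 = 1 / 3"
proof -
  have s: "sph_form n 0 x y = x \<bullet> y" for x y by (simp add: sph_form_def)
  have "sph_moment n 0 b b = (b \<bullet> b) / 3 * (4 * pi)"
    using second_moment_inverse_fourth[of b b] by (simp add: sph_moment_def s power2_norm_eq_inner)
  moreover have "(\<integral>y. indicator (ball 0 1) y / sph_form n 0 y y \<partial>lborel) = 4 * pi"
    using integrable_inverse_square_ball(2) by (simp add: s power2_norm_eq_inner)
  ultimately show ?thesis using sph_coeff_eq[of 0 n b] b by (simp add: dot_square_norm)
qed

text \<open>The spheroid degenerates to a disc orthogonal to \<open>n\<close>.  The integrand tends to zero off the plane \<open>n \<bullet> y = 0\<close>, a null set, and is dominated uniformly in \<open>\<kappa>\<close>.\<close>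

lemma sph_coeff_at_infinity:
  assumes n: "norm n = 1" and b: "norm b = 1"
  shows "(\<lambda>k. sph_coeff n b (real k)) \<longlonglongrightarrow> 0"
proof -
  let ?F = "\<lambda>\<kappa> y. indicator (ball 0 1) y * (1 / sph_form n \<kappa> y y - 2 * ((b \<bullet> y)\<^sup>2 / (sph_form n \<kappa> y y)\<^sup>2))"
  have "(\<lambda>k. integral\<^sup>L lborel (?F (real k))) \<longlonglongrightarrow> integral\<^sup>L lborel (\<lambda>y::real^3. 0::real)"
  proof (rule integral_dominated_convergence)
    show "integrable lborel (\<lambda>y::real^3. 3 * (indicator (ball 0 1) y / (norm y)\<^sup>2))"
      by (intro integrable_mult_right integrable_inverse_square_ball)
    have "negligible {y. n \<bullet> y = 0}" using n by (intro negligible_hyperplane) auto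
    then have "{y. n \<bullet> y = 0} \<in> null_sets lborel"
      by (auto simp: negligible_iff_null_sets null_sets_completion_iff)
    then have "AE y in lborel. n \<bullet> y \<noteq> 0" by (rule AE_I') auto
    then show "AE y in lborel. (\<lambda>k. ?F (real k) y) \<longlonglongrightarrow> 0"
    proof eventually_elim
      case (elim y)
      have pos: "(n \<bullet> y) * (n \<bullet> y) > 0" using elim by (simp add: zero_less_mult_iff) linarith
      have "filterlim (\<lambda>k. y \<bullet> y + real k * ((n \<bullet> y) * (n \<bullet> y))) at_top sequentially"
        by (intro filterlim_tendsto_add_at_top[OF tendsto_const] filterlim_at_top_mult_tendsto_pos[OF tendsto_const pos] filterlim_real_sequentially)
      then have f: "filterlim (\<lambda>k. sph_form n (real k) y y) at_top sequentially"
        by (simp only: sph_form_def)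
      have "(\<lambda>k. 1 / sph_form n (real k) y y) \<longlonglongrightarrow> 0"
        by (rule real_tendsto_divide_at_top[OF tendsto_const f])
      moreover from this have "(\<lambda>k. (b \<bullet> y)\<^sup>2 * (1 / sph_form n (real k) y y)\<^sup>2) \<longlonglongrightarrow> (b \<bullet> y)\<^sup>2 * 0\<^sup>2"
        by (intro tendsto_intros)
      ultimately have "(\<lambda>k. indicator (ball 0 1) y * (1 / sph_form n (real k) y y - 2 * ((b \<bullet> y)\<^sup>2 * (1 / sph_form n (real k) y y)\<^sup>2))) \<longlonglongrightarrow> indicator (ball 0 1) y * (0 - 2 * ((b \<bullet> y)\<^sup>2 * 0\<^sup>2))"
        by (intro tendsto_intros)
      then show ?case by (simp add: power_divide)
    qed
    show "AE y in lborel. norm (?F (real k) y) \<le> 3 * (indicator (ball 0 1) y / (norm y)\<^sup>2)" for k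
      unfolding real_norm_def by (rule AE_I2, rule sph_coeff_integrand_bound) (use b in auto)
  qed measurable
  then have "(\<lambda>k. 1 / (4 * pi) * integral\<^sup>L lborel (?F (real k))) \<longlonglongrightarrow> 1 / (4 * pi) * 0"
    by (intro tendsto_mult tendsto_const) simp
  then show ?thesis unfolding sph_coeff_def by simp
qed

lemma sph_coeff_orthogonal:
  assumes f: "orthogonal_transformation f"
  shows "sph_coeff (f n) (f b) \<kappa> = sph_coeff n b \<kappa>"
proof -
  let ?F = "\<lambda>n b y. indicator (ball 0 1) y * (1 / sph_form n \<kappa> y y - 2 * ((b \<bullet> y)\<^sup>2 / (sph_form n \<kappa> y y)\<^sup>2))"
  have "(\<integral>y. ?F (f n) (f b) y \<partial>lborel) = (\<integral>y. ?F (f n) (f b) (f y) \<partial>lborel)"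
    by (rule integral_orthogonal[OF f, symmetric]) measurable
  also have "\<dots> = (\<integral>y. ?F n b y \<partial>lborel)"
    by (simp add: sph_form_def inner_orthogonal_transformation[OF f] orthogonal_transformation_norm[OF f] indicator_def)
  finally show ?thesis by (simp add: sph_coeff_def)
qed

lemma exists_perpendicular:
  fixes v :: "real^3"
  obtains b where "norm b = 1" "v \<bullet> b = 0"
proof -
  have "norm (norm v *\<^sub>R (axis 1 1 :: real^3)) = norm v" by simp
  from orthogonal_maps[OF this]
  obtain f where f: "orthogonal_transformation f" "f (norm v *\<^sub>R (axis 1 1 :: real^3)) = v" by auto
  have "norm (f (axis 2 1)) = 1" using orthogonal_transformation_norm[OF f(1), of "axis 2 1"] by simp
  moreover have "v \<bullet> f (axis 2 1) = norm v *\<^sub>R (axis 1 1 :: real^3) \<bullet> axis 2 1"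
    using inner_orthogonal_transformation[OF f(1)] f(2) by metis
  then have "v \<bullet> f (axis 2 1) = 0" by (simp add: inner_axis_axis)
  ultimately show ?thesis using that by blast
qed

text \<open>The reflection \<open>2 n n\<^sup>T - I\<close> in the bisector of \<open>e\<close> and \<open>u\<close> maps \<open>e\<close> to \<open>u\<close>; if \<open>u = - e\<close>, any direction orthogonal to \<open>e\<close> serves.\<close>

lemma exists_bisector:
  fixes e u :: "real^3"
  assumes e: "norm e = 1" and u: "norm u = 1"
  obtains n where "norm n = 1" "(2 * (n \<bullet> e)) *\<^sub>R n = e + u"
proof (cases "e + u = 0")
  case True
  obtain b where "norm b = 1" "e \<bullet> b = 0" by (rule exists_perpendicular)
  then show ?thesis using True that[of b] by (simp add: inner_commute)
next
  case False
  let ?m = "norm (e + u)"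
  have "2 * ((e + u) \<bullet> e) = ?m\<^sup>2"
    using e u by (simp add: power2_norm_eq_inner inner_simps inner_commute norm_eq_1)
  moreover define n where "n = (1 / ?m) *\<^sub>R (e + u)"
  moreover have "n \<bullet> e = (1 / ?m) * ((e + u) \<bullet> e)" by (simp only: n_def inner_scaleR_left)
  ultimately have "2 * (n \<bullet> e) * (1 / ?m) = 1" using False by (simp add: power2_eq_square)
  moreover have "(2 * (n \<bullet> e)) *\<^sub>R n = (2 * (n \<bullet> e) * (1 / ?m)) *\<^sub>R (e + u)"
    by (simp only: n_def scaleR_scaleR)
  ultimately have "(2 * (n \<bullet> e)) *\<^sub>R n = e + u" by (simp only: scaleR_one)
  moreover have "norm n = 1" using False by (simp only: n_def norm_scaleR) simp
  ultimately show ?thesis using that by blast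
qed

text \<open>The vectors \<open>D e\<close> for \<open>D = t I + (s - t) n n\<^sup>T\<close> form the sphere of centre \<open>((s + t) / 2) e\<close> and radius
  \<open>(s - t) / 2\<close> when \<open>n\<close> ranges over the unit vectors.  As \<open>t\<close> decreases from \<open>1 / 3\<close> to \<open>0\<close> with \<open>s = 1 - 2 t\<close>, these
  spheres grow from the point \<open>e / 3\<close> to the sphere with diameter from \<open>0\<close> to \<open>e\<close>, whose inside is the set of all \<open>v\<close>
  with \<open>\<bar>v\<bar>\<^sup>2 < v \<bullet> e\<close>.\<close>

theorem exists_spheroid_with_row:
  fixes e v :: "real^3"
  assumes e: "norm e = 1" and v: "(norm v)\<^sup>2 < v \<bullet> e"
  obtains n \<kappa> where "norm n = 1" "\<kappa> \<ge> 0"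
    "\<And>\<rho> x h. \<rho> > 0 \<Longrightarrow> x \<in> spheroid n \<kappa> \<rho> \<Longrightarrow> x + h *\<^sub>R e \<in> spheroid n \<kappa> \<rho> \<Longrightarrow>
       pot (indicator (spheroid n \<kappa> \<rho>)) (x + h *\<^sub>R e) - pot (indicator (spheroid n \<kappa> \<rho>)) x
         = - 4 * pi * (h * (v \<bullet> x) + h\<^sup>2 / 2 * (v \<bullet> e))"
proof -
  have ee: "e \<bullet> e = 1" using e by (simp add: dot_square_norm)
  define n0 b0 :: "real^3" where "n0 = axis 1 1" and "b0 = axis 2 1"
  have n0: "norm n0 = 1" and b0: "norm b0 = 1" "n0 \<bullet> b0 = 0"
    by (simp_all add: n0_def b0_def inner_axis_axis)
  define \<tau> where "\<tau> = sph_coeff n0 b0"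
  \<comment> \<open>its zero is the parameter for which \<open>v\<close> lies on the sphere of the vectors \<open>D e\<close>\<close>
  define g where "g t = norm (v - ((1 - t) / 2) *\<^sub>R e) - (1 - 3 * t) / 2" for t
  have cg: "continuous_on UNIV g" unfolding g_def by (intro continuous_intros) auto
  have g0: "g 0 < 0"
  proof -
    have "(norm (v - (1 / 2) *\<^sub>R e))\<^sup>2 = (norm v)\<^sup>2 - v \<bullet> e + 1 / 4"
      by (simp add: power2_norm_eq_inner inner_simps ee inner_commute)
    then have "(norm (v - (1 / 2) *\<^sub>R e))\<^sup>2 < (1 / 2)\<^sup>2" using v by (simp add: power2_eq_square)
    then have "norm (v - (1 / 2) *\<^sub>R e) < 1 / 2" by (rule power_less_imp_less_base) simp
    then show ?thesis by (simp add: g_def)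
  qed
  have "isCont g 0" using cg by (simp add: continuous_on_eq_continuous_at)
  then have "(\<lambda>k. g (\<tau> (real k))) \<longlonglongrightarrow> g 0"
    using sph_coeff_at_infinity[OF n0 b0(1)] unfolding \<tau>_def by (rule isCont_tendsto_compose)
  then have "\<forall>\<^sub>F k in sequentially. g (\<tau> (real k)) < 0" using g0 by (rule order_tendstoD)
  then obtain k where k: "g (\<tau> (real k)) < 0" by (auto simp: eventually_sequentially)
  have "\<exists>x\<ge>0. x \<le> real k \<and> g (\<tau> x) = 0"
  proof (rule IVT2')
    show "g (\<tau> (real k)) \<le> 0" using k by simp
    show "0 \<le> g (\<tau> 0)" by (simp add: \<tau>_def sph_coeff_at_0[OF b0(1)] g_def)
    have "continuous_on {0..real k} \<tau>"
      unfolding \<tau>_def by (rule continuous_on_subset[OF sph_coeff_continuous[OF b0(1)]]) auto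
    then show "continuous_on {0..real k} (\<lambda>x. g (\<tau> x))"
      by (rule continuous_on_compose2[OF cg]) auto
  qed simp
  then obtain \<kappa> where \<kappa>: "\<kappa> \<ge> 0" "g (\<tau> \<kappa>) = 0" by auto
  define t where "t = \<tau> \<kappa>"
  have nv: "norm (v - ((1 - t) / 2) *\<^sub>R e) = (1 - 3 * t) / 2" using \<kappa>(2) by (simp add: g_def t_def)
  \<comment> \<open>at \<open>t = 1 / 3\<close> the sphere is a point and every direction is admissible\<close>
  obtain u where u: "norm u = 1" "v - ((1 - t) / 2) *\<^sub>R e = ((1 - 3 * t) / 2) *\<^sub>R u"
  proof (cases "1 - 3 * t = 0")
    case True
    then show ?thesis using nv e that[of e] by simp
  next
    case False
    let ?w = "v - ((1 - t) / 2) *\<^sub>R e"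
    have "norm ?w \<noteq> 0" unfolding nv using False by simp
    then have "?w \<noteq> 0" by (simp only: norm_eq_zero not_False_eq_True)
    then have "norm (sgn ?w) = 1" by (simp only: norm_sgn if_False)
    moreover have "?w = ((1 - 3 * t) / 2) *\<^sub>R sgn ?w"
      unfolding nv[symmetric] using \<open>?w \<noteq> 0\<close> by (simp add: sgn_div_norm)
    ultimately show ?thesis using that by blast
  qed
  obtain n where n: "norm n = 1" "(2 * (n \<bullet> e)) *\<^sub>R n = e + u" using exists_bisector[OF e u(1)] by metis
  have "norm n0 = norm n" using n n0 by simp
  from orthogonal_maps[OF this] obtain f where f: "orthogonal_transformation f" "f n0 = n" by auto
  define b where "b = f b0"
  have b: "norm b = 1" "n \<bullet> b = 0"
    using b0 inner_orthogonal_transformation[OF f(1), of n0 b0] orthogonal_transformation_norm[OF f(1)] f(2) by (auto simp: b_def)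
  have tb: "sph_coeff n b \<kappa> = t"
    using sph_coeff_orthogonal[OF f(1), of n0 b0 \<kappa>] f(2) by (simp add: b_def t_def \<tau>_def)
  obtain s where s: "\<And>\<rho>. \<rho> > 0 \<Longrightarrow> \<exists>c. \<forall>x \<in> spheroid n \<kappa> \<rho>. pot (indicator (spheroid n \<kappa> \<rho>)) x
     = c - 2 * pi * (s * (n \<bullet> x)\<^sup>2 + t * ((norm x)\<^sup>2 - (n \<bullet> x)\<^sup>2))"
    using pot_spheroid_quadratic[OF n(1) b \<kappa>(1)] unfolding tb by metis
  have st: "s = 1 - 2 * t" using spheroid_trace[OF n(1) \<kappa>(1) s] by simp
  have vn: "v = t *\<^sub>R e + ((s - t) * (n \<bullet> e)) *\<^sub>R n"
  proof -
    have "((s - t) * (n \<bullet> e)) *\<^sub>R n = ((s - t) / 2) *\<^sub>R ((2 * (n \<bullet> e)) *\<^sub>R n)" by simp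
    also have "\<dots> = ((s - t) / 2) *\<^sub>R e + ((1 - 3 * t) / 2) *\<^sub>R u"
      unfolding n(2) by (simp add: st scaleR_add_right)
    also have "((1 - 3 * t) / 2) *\<^sub>R u = v - ((1 - t) / 2) *\<^sub>R e" by (rule u(2)[symmetric])
    finally have "((s - t) * (n \<bullet> e)) *\<^sub>R n = v - ((1 - t) / 2 - (s - t) / 2) *\<^sub>R e"
      by (simp add: scaleR_diff_left)
    also have "(1 - t) / 2 - (s - t) / 2 = t" by (simp add: st field_simps)
    finally show ?thesis by simp
  qed
  show ?thesis
  proof (rule that[OF n(1) \<kappa>(1)])
    fix \<rho> x h assume \<rho>: "\<rho> > 0" and x: "x \<in> spheroid n \<kappa> \<rho>" "x + h *\<^sub>R e \<in> spheroid n \<kappa> \<rho>"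
    obtain c where c: "\<And>x. x \<in> spheroid n \<kappa> \<rho> \<Longrightarrow> pot (indicator (spheroid n \<kappa> \<rho>)) x
       = c - 2 * pi * (s * (n \<bullet> x)\<^sup>2 + t * ((norm x)\<^sup>2 - (n \<bullet> x)\<^sup>2))" using s[OF \<rho>] by metis
    have 1: "n \<bullet> (x + h *\<^sub>R e) = n \<bullet> x + h * (n \<bullet> e)" by (simp add: inner_simps)
    have 2: "(norm (x + h *\<^sub>R e))\<^sup>2 = (norm x)\<^sup>2 + 2 * h * (e \<bullet> x) + h\<^sup>2"
      by (simp only: power2_norm_eq_inner) (simp add: inner_simps ee inner_commute power2_eq_square algebra_simps)
    have 3: "v \<bullet> x = t * (e \<bullet> x) + (s - t) * (n \<bullet> e) * (n \<bullet> x)" "v \<bullet> e = t + (s - t) * (n \<bullet> e) * (n \<bullet> e)"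
      by (subst vn, simp add: inner_simps ee)+
    show "pot (indicator (spheroid n \<kappa> \<rho>)) (x + h *\<^sub>R e) - pot (indicator (spheroid n \<kappa> \<rho>)) x
         = - 4 * pi * (h * (v \<bullet> x) + h\<^sup>2 / 2 * (v \<bullet> e))"
      unfolding c[OF x(1)] c[OF x(2)] 1 2 3 by (simp add: power2_eq_square algebra_simps)
  qed
qed

section \<open>Energies of difference quotients of a convex body\<close>

lemma energy_shift_difference_left:
  assumes g: "charge g" and f: "charge f"
  shows "energy (\<lambda>y. g (- h + y) - g y) f = (\<integral>x. g x * (pot f (x + h) - pot f x) \<partial>lborel)"
proof -
  note [measurable] = charge_measurable[OF g] pot_measurable[OF f]
  have "energy (\<lambda>y. g (- h + y) - g y) f = (\<integral>x. g (- h + x) * pot f x \<partial>lborel) - energy g f"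
    using energy_diff_left[OF charge_translate[OF g, of "- h"] g f] by (simp add: energy_def)
  also have "(\<integral>x. g (- h + x) * pot f x \<partial>lborel) = (\<integral>x. (\<lambda>x. g x * pot f (h + x)) (- h + x) \<partial>lborel)"
    by simp
  also have "\<dots> = (\<integral>x. g x * pot f (h + x) \<partial>lborel)"
    by (rule integral_translate) measurable
  also have "(\<integral>x. g x * pot f (h + x) \<partial>lborel) - energy g f = (\<integral>x. g x * pot f (h + x) - g x * pot f x \<partial>lborel)"
    unfolding energy_def by (rule Bochner_Integration.integral_diff[symmetric]) (intro integrable_energy integrable_energy0 g f)+
  finally show ?thesis by (simp add: algebra_simps)
qed

lemma energy_shift_difference:
  assumes g: "charge g"
  shows "energy (\<lambda>y. g (- h + y) - g y) (\<lambda>y. g (- h + y) - g y)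
     = (\<integral>x. g x * (2 * pot g x - pot g (x + h) - pot g (x - h)) \<partial>lborel)"
proof -
  note gh = charge_translate[OF g, of "- h"]
  have p: "pot (\<lambda>y. g (- h + y) - g y) x = pot g (x - h) - pot g x" for x
    by (simp only: pot_diff[OF gh g] pot_translate[OF g]) (simp add: add.commute)
  have "energy (\<lambda>y. g (- h + y) - g y) (\<lambda>y. g (- h + y) - g y)
      = (\<integral>x. g x * (pot g (x + h - h) - pot g (x + h) - (pot g (x - h) - pot g x)) \<partial>lborel)"
    by (simp only: energy_shift_difference_left[OF g charge_diff[OF gh g]] p)
  also have "\<dots> = (\<integral>x. g x * (2 * pot g x - pot g (x + h) - pot g (x - h)) \<partial>lborel)"
    by (intro Bochner_Integration.integral_cong refl) simp
  finally show ?thesis .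
qed

text \<open>A body and its translate attract each other with a force that is odd in the translation.\<close>

lemma energy_shift_even:
  assumes g: "charge g"
  shows "(\<integral>x. g x * (pot g (x + h) - pot g (x - h)) \<partial>lborel) = 0"
proof -
  note [measurable] = charge_measurable[OF g] pot_measurable[OF g]
  have "(\<integral>x. g x * pot g (h + x) \<partial>lborel) = energy g (\<lambda>y. g (h + y))"
    by (simp add: energy_def pot_translate[OF g])
  also have "\<dots> = energy (\<lambda>y. g (h + y)) g" by (intro energy_commute g charge_translate)
  also have "\<dots> = (\<integral>x. (\<lambda>x. g x * pot g (- h + x)) (h + x) \<partial>lborel)" by (simp add: energy_def)
  also have "\<dots> = (\<integral>x. g x * pot g (- h + x) \<partial>lborel)" by (rule integral_translate) measurable
  finally have "(\<integral>x. g x * pot g (h + x) \<partial>lborel) - (\<integral>x. g x * pot g (- h + x) \<partial>lborel) = 0" by simp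
  then have "(\<integral>x. g x * pot g (h + x) - g x * pot g (- h + x) \<partial>lborel) = 0"
    by (subst Bochner_Integration.integral_diff) (intro integrable_energy g)+
  then show ?thesis by (simp add: algebra_simps)
qed

text \<open>The contraction by the factor \<open>1 - s\<close> with centre \<open>x0\<close>, as a preimage, so that Borel sets stay Borel.\<close>

definition shrink :: "real^3 \<Rightarrow> real \<Rightarrow> (real^3) set \<Rightarrow> (real^3) set" where
  "shrink x0 s A = {y. x0 + (1 / (1 - s)) *\<^sub>R (y - x0) \<in> A}"

lemma shrink_borel[measurable]:
  assumes [measurable]: "A \<in> sets borel"
  shows "shrink x0 s A \<in> sets borel"
  unfolding shrink_def by measurable

lemma vol_shrink:
  assumes [measurable]: "A \<in> sets borel" and s: "0 \<le> s" "s < 1"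
  shows "measure lborel (shrink x0 s A) = (1 - s)^3 * measure lborel A"
proof -
  define c where "c = 1 / (1 - s)"
  have c: "c > 0" using s by (simp add: c_def)
  have "emeasure lborel A = (\<integral>\<^sup>+y. indicator A y \<partial>lborel)" by simp
  also have "\<dots> = (\<integral>\<^sup>+y. indicator A (x0 + y) \<partial>lborel)"
    by (rule nn_integral_translate[symmetric]) measurable
  also have "\<dots> = ennreal (c^3) * (\<integral>\<^sup>+y. indicator A (x0 + c *\<^sub>R y) \<partial>lborel)"
    by (rule nn_integral_scale[OF _ c]) measurable
  also have "(\<integral>\<^sup>+y. indicator A (x0 + c *\<^sub>R y) \<partial>lborel) = (\<integral>\<^sup>+y. (\<lambda>y. indicator A (x0 + c *\<^sub>R (y - x0))) (x0 + y) \<partial>lborel)"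
    by simp
  also have "\<dots> = (\<integral>\<^sup>+y. indicator A (x0 + c *\<^sub>R (y - x0)) \<partial>lborel)"
    by (rule nn_integral_translate) measurable
  also have "\<dots> = (\<integral>\<^sup>+y. indicator (shrink x0 s A) y \<partial>lborel)"
    by (intro nn_integral_cong) (simp add: shrink_def c_def indicator_def)
  also have "\<dots> = emeasure lborel (shrink x0 s A)"
    by simp
  finally have "measure lborel A = c^3 * measure lborel (shrink x0 s A)"
    using c by (simp add: measure_def enn2real_mult)
  moreover have "(1 - s)^3 * c^3 = 1" using s by (simp add: c_def flip: power_mult_distrib)
  ultimately show ?thesis by (simp flip: mult.assoc)
qed

text \<open>Every point of the contracted set is a convex combination, with weight \<open>s\<close> on the centre, so a ball of radius \<open>s \<rho>\<close> around it lies in the original set.\<close>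

lemma shrink_margin:
  assumes A: "convex A" "ball x0 \<rho> \<subseteq> A" and s: "0 < s" "s < 1" and y: "y \<in> shrink x0 s A" and h: "norm h < s * \<rho>"
  shows "y + h \<in> A"
proof -
  define w where "w = x0 + (1 / (1 - s)) *\<^sub>R (y - x0)"
  have w: "w \<in> A" using y by (simp add: w_def shrink_def)
  have "x0 + (1 / s) *\<^sub>R h \<in> ball x0 \<rho>"
    using h s by (simp add: dist_norm field_simps)
  then have "(1 - s) *\<^sub>R w + s *\<^sub>R (x0 + (1 / s) *\<^sub>R h) \<in> A"
    using A s w by (intro convexD) auto
  moreover have "(1 - s) *\<^sub>R w = (1 - s) *\<^sub>R x0 + (y - x0)"
    using s by (simp add: w_def scaleR_add_right)
  then have "(1 - s) *\<^sub>R w + s *\<^sub>R (x0 + (1 / s) *\<^sub>R h) = y + h"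
    using s by (simp add: scaleR_add_right scaleR_diff_left)
  ultimately show ?thesis by simp
qed

text \<open>A bounded open convex set, containing a fixed ball, on which the derivative of the Newtonian potential in direction \<open>e\<close> is the affine function \<open>v \<bullet> x + \<delta>\<close>.  The hypothesis is stated through differences, which integrates this derivative along \<open>e\<close> and avoids differentiating the potential; \<open>v\<close> is the row of the Hessian belonging to \<open>e\<close>.\<close>

locale row_body =
  fixes \<Omega> :: "(real^3) set" and e v x0 :: "real^3" and \<delta> \<rho> :: real
  assumes op: "open \<Omega>" and bd: "bounded \<Omega>" and cv: "convex \<Omega>"
    and e: "norm e = 1" and \<rho>: "\<rho> > 0" and ball: "ball x0 \<rho> \<subseteq> \<Omega>"
    and row: "\<And>x t. x \<in> \<Omega> \<Longrightarrow> x + t *\<^sub>R e \<in> \<Omega> \<Longrightarrow>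
       pot (indicator \<Omega>) (x + t *\<^sub>R e) - pot (indicator \<Omega>) x = - 4 * pi * (t * (v \<bullet> x + \<delta>) + t\<^sup>2 / 2 * (v \<bullet> e))"
begin

abbreviation "U \<equiv> pot (indicator \<Omega>)"
abbreviation "V \<equiv> measure lborel \<Omega>"
abbreviation "\<Omega>s s \<equiv> shrink x0 s \<Omega>"

lemma meas[measurable]: "\<Omega> \<in> sets borel" using op by simp

lemma ch: "charge (indicator \<Omega>)" by (rule charge_indicator[OF bd meas])

lemma shrink_sub: "0 < s \<Longrightarrow> s < 1 \<Longrightarrow> \<Omega>s s \<subseteq> \<Omega>"
  using shrink_margin[OF cv ball, of s _ 0] \<rho> by auto

lemma chs: "0 < s \<Longrightarrow> s < 1 \<Longrightarrow> charge (indicator (\<Omega>s s))"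
  by (rule charge_indicator[OF bounded_subset[OF bd shrink_sub]]) auto

lemma V_pos: "V > 0"
proof -
  have "0 < measure lborel (ball x0 \<rho>)" using \<rho> by simp
  also have "\<dots> \<le> V"
    using ball emeasure_bounded_finite[OF bd] by (intro measure_mono_fmeasurable) (auto simp: fmeasurable_def)
  finally show ?thesis .
qed

text \<open>A function that vanishes well inside the body has a small integral, because the boundary layer
  of width \<open>t\<close> has volume \<open>O(t)\<close>.\<close>

lemma layer_bound:
  fixes G :: "real^3 \<Rightarrow> real"
  assumes s: "0 < s" "s < 1" and [measurable]: "G \<in> borel_measurable borel"
    and zero: "\<And>x. x \<in> \<Omega>s s \<Longrightarrow> G x = 0" and b: "\<And>x. x \<in> \<Omega> \<Longrightarrow> \<bar>G x\<bar> \<le> M"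
  shows "integrable lborel (\<lambda>x. indicator \<Omega> x * G x)" "\<bar>\<integral>x. indicator \<Omega> x * G x \<partial>lborel\<bar> \<le> M * (3 * s * V)"
proof -
  let ?d = "\<lambda>x. indicator \<Omega> x - indicator (\<Omega>s s) x :: real"
  have M: "M \<ge> 0" using b[of x0] ball \<rho> by force
  have id: "integrable lborel (\<lambda>x. M * ?d x)"
    by (intro integrable_mult_right Bochner_Integration.integrable_diff charge_integrable ch chs s)
  have le: "\<bar>indicator \<Omega> x * G x\<bar> \<le> M * ?d x" for x
    using b[of x] zero[of x] shrink_sub[OF s] by (auto simp: indicator_def)
  show i: "integrable lborel (\<lambda>x. indicator \<Omega> x * G x)"
    by (rule integrable_dominated[OF id _ le]) measurable
  have "\<bar>\<integral>x. indicator \<Omega> x * G x \<partial>lborel\<bar> \<le> (\<integral>x. \<bar>indicator \<Omega> x * G x\<bar> \<partial>lborel)" by (rule integral_abs_bound)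
  also have "\<dots> \<le> (\<integral>x. M * ?d x \<partial>lborel)"
    by (rule integral_mono[OF _ id le]) (use i in simp)
  also have "\<dots> = M * (V - measure lborel (\<Omega>s s))"
    using charge_integrable[OF ch] charge_integrable[OF chs[OF s]] by simp
  also have "\<dots> = M * ((1 - (1 - s)^3) * V)" using vol_shrink[OF meas, of s x0] s by (simp add: algebra_simps)
  also have "\<dots> \<le> M * (3 * s * V)"
  proof (intro mult_left_mono mult_right_mono M)
    have "s\<^sup>2 * (3 - s) \<ge> 0" using s by simp
    then show "1 - (1 - s)^3 \<le> 3 * s" by (simp add: power2_eq_square power3_eq_cube algebra_simps)
  qed simp
  finally show "\<bar>\<integral>x. indicator \<Omega> x * G x \<partial>lborel\<bar> \<le> M * (3 * s * V)" .
qed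

text \<open>The difference quotient of the indicator in direction \<open>e\<close>.  The translation is written with a double minus sign so that the
  lemmas on energies of shift differences apply with the shift \<open>- t e\<close>.\<close>

definition quot :: "real \<Rightarrow> real^3 \<Rightarrow> real" where
  "quot t x = (1 / t) * (indicator \<Omega> (- (- t *\<^sub>R e) + x) - indicator \<Omega> x)"

lemma ch_quot: "charge (quot t)"
  unfolding quot_def by (intro charge_scale charge_diff charge_translate ch)

lemma pot_quot: "pot (quot t) x = (1 / t) * (U (x + t *\<^sub>R e) - U x)"
  unfolding quot_def by (simp only: pot_scale pot_diff[OF charge_translate[OF ch] ch] pot_translate[OF ch]) (simp add: add.commute)

lemma row_minus:
  assumes "x \<in> \<Omega>" "x - t *\<^sub>R e \<in> \<Omega>"
  shows "U (x - t *\<^sub>R e) - U x = - 4 * pi * (- t * (v \<bullet> x + \<delta>) + t\<^sup>2 / 2 * (v \<bullet> e))"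
  using row[of x "- t"] assms by simp

lemma U_measurable[measurable]: "U \<in> borel_measurable borel" by (rule pot_measurable[OF ch])

text \<open>The energy of the difference quotient is the integral over the body of the second difference of the potential.  Well inside the body this difference is exactly quadratic; the layer of volume \<open>O(t)\<close> near the boundary contributes \<open>O(t powr (3/2)) * O(t)\<close>, which is negligible against \<open>t\<^sup>2\<close>.\<close>

lemma energy_quot_tendsto: "((\<lambda>t. energy (quot t) (quot t)) \<longlongrightarrow> 4 * pi * (v \<bullet> e) * V) (at_right 0)"
proof -
  obtain C where C: "C > 0" "\<And>x h. \<bar>U (x + h) + U (x - h) - 2 * U x\<bar> \<le> C * norm h powr (3/2)"
    using pot_second_difference[OF ch] by metis
  let ?a = "4 * pi * (v \<bullet> e)"
  have bound: "\<bar>energy (quot t) (quot t) - ?a * V\<bar> \<le> (C * sqrt t + \<bar>?a\<bar> * t) * (6 / \<rho> * V)" if t: "0 < t" "t < \<rho> / 2" for t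
  proof -
    \<comment> \<open>the least contraction, up to the factor two, that leaves room for a shift by \<open>t\<close>\<close>
    define s where "s = 2 * t / \<rho>"
    have s: "0 < s" "s < 1" and ts: "t < s * \<rho>" using t \<rho> by (auto simp: s_def field_simps)
    let ?g = "\<lambda>y. indicator \<Omega> (- (- t *\<^sub>R e) + y) - indicator \<Omega> y"
    let ?S = "\<lambda>x. 2 * U x - U (x - t *\<^sub>R e) - U (x + t *\<^sub>R e)"
    let ?G = "\<lambda>x. ?S x - t\<^sup>2 * ?a"
    have G0: "?G x = 0" if x: "x \<in> \<Omega>s s" for x
    proof -
      have "x \<in> \<Omega>" "x + t *\<^sub>R e \<in> \<Omega>" "x - t *\<^sub>R e \<in> \<Omega>"
        using shrink_sub[OF s] x shrink_margin[OF cv ball s x, of "t *\<^sub>R e"] shrink_margin[OF cv ball s x, of "- t *\<^sub>R e"] ts t e by auto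
      then show ?thesis using row[of x t] row_minus[of x t] by (simp add: algebra_simps)
    qed
    have Gb: "\<bar>?G x\<bar> \<le> C * t powr (3/2) + t\<^sup>2 * \<bar>?a\<bar>" for x
    proof -
      have "\<bar>?S x\<bar> \<le> C * t powr (3/2)" using C(2)[of x "t *\<^sub>R e"] t e by (simp add: abs_if split: if_splits)
      moreover have "\<bar>t\<^sup>2 * ?a\<bar> = t\<^sup>2 * \<bar>?a\<bar>" by (simp add: abs_mult)
      ultimately show ?thesis by linarith
    qed
    have iS: "energy ?g ?g = (\<integral>x. indicator \<Omega> x * ?S x \<partial>lborel)"
      using energy_shift_difference[OF ch, of "- t *\<^sub>R e"] by simp
    note lb = layer_bound[OF s, of ?G "C * t powr (3/2) + t\<^sup>2 * \<bar>?a\<bar>", OF _ G0 Gb]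
    have "energy ?g ?g = (\<integral>x. indicator \<Omega> x * ?G x + t\<^sup>2 * ?a * indicator \<Omega> x \<partial>lborel)"
      unfolding iS by (intro Bochner_Integration.integral_cong refl) (simp add: algebra_simps)
    also have "\<dots> = (\<integral>x. indicator \<Omega> x * ?G x \<partial>lborel) + (\<integral>x. t\<^sup>2 * ?a * indicator \<Omega> x \<partial>lborel)"
      by (intro Bochner_Integration.integral_add integrable_mult_right charge_integrable ch lb(1)) measurable
    finally have "energy ?g ?g - t\<^sup>2 * (?a * V) = (\<integral>x. indicator \<Omega> x * ?G x \<partial>lborel)" by simp
    also have "\<bar>\<dots>\<bar> \<le> (C * t powr (3/2) + t\<^sup>2 * \<bar>?a\<bar>) * (3 * s * V)"
      by (rule lb(2)) measurable
    also have "(C * t powr (3/2) + t\<^sup>2 * \<bar>?a\<bar>) * (3 * s * V) = t\<^sup>2 * ((C * sqrt t + \<bar>?a\<bar> * t) * (6 / \<rho> * V))"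
    proof -
      have "t powr (3/2) = t powr (1 + 1/2)" by simp
      also have "\<dots> = t * sqrt t" using t by (simp only: powr_add powr_half_sqrt) simp
      finally have *: "t powr (3/2) = t * sqrt t" .
      show ?thesis unfolding * s_def using \<rho> by (simp add: field_simps power2_eq_square)
    qed
    finally have *: "\<bar>energy ?g ?g - t\<^sup>2 * (?a * V)\<bar> \<le> t\<^sup>2 * ((C * sqrt t + \<bar>?a\<bar> * t) * (6 / \<rho> * V))" .
    have eq: "energy (quot t) (quot t) = (1 / t)\<^sup>2 * energy ?g ?g"
      unfolding quot_def energy_scale_left energy_scale_right by (simp add: power2_eq_square)
    have "\<bar>energy (quot t) (quot t) - ?a * V\<bar> = (1 / t)\<^sup>2 * \<bar>energy ?g ?g - t\<^sup>2 * (?a * V)\<bar>"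
    proof -
      have "energy (quot t) (quot t) - ?a * V = (1 / t)\<^sup>2 * (energy ?g ?g - t\<^sup>2 * (?a * V))"
        unfolding eq right_diff_distrib using t by (simp add: power2_eq_square)
      then show ?thesis by (simp only: abs_mult abs_power2)
    qed
    also have "\<dots> \<le> (1 / t)\<^sup>2 * (t\<^sup>2 * ((C * sqrt t + \<bar>?a\<bar> * t) * (6 / \<rho> * V)))"
      by (intro mult_left_mono *) simp
    also have "\<dots> = ((1 / t)\<^sup>2 * t\<^sup>2) * ((C * sqrt t + \<bar>?a\<bar> * t) * (6 / \<rho> * V))" by (rule mult.assoc[symmetric])
    also have "(1 / t)\<^sup>2 * t\<^sup>2 = 1" using t by (simp add: power_divide)
    finally show ?thesis by simp
  qed
  have "((\<lambda>t. (C * sqrt t + \<bar>?a\<bar> * t) * (6 / \<rho> * V)) \<longlongrightarrow> (C * sqrt 0 + \<bar>?a\<bar> * 0) * (6 / \<rho> * V)) (at_right 0)"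
    by (intro tendsto_intros)
  then have "((\<lambda>t. (C * sqrt t + \<bar>?a\<bar> * t) * (6 / \<rho> * V)) \<longlongrightarrow> 0) (at_right 0)" by simp
  moreover have "\<forall>\<^sub>F t in at_right 0. norm (energy (quot t) (quot t) - ?a * V) \<le> (C * sqrt t + \<bar>?a\<bar> * t) * (6 / \<rho> * V)"
  proof -
    have "\<forall>\<^sub>F t in at_right 0. t \<in> {0<..<\<rho> / 2}" using \<rho> by (intro eventually_at_right_real) simp
    then show ?thesis unfolding real_norm_def by eventually_elim (rule bound; simp)
  qed
  ultimately have "((\<lambda>t. energy (quot t) (quot t) - ?a * V) \<longlongrightarrow> 0) (at_right 0)"
    by (rule Lim_null_comparison[rotated])
  then show ?thesis by (simp add: LIM_zero_iff)
qed

text \<open>Contracting the body leaves room for both shifts, so only values of the potential inside the body enter.\<close>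

lemma energy_quot_shrink:
  assumes s: "0 < s" "s < 1" and t: "0 < t" and h: "norm h + t < s * \<rho>"
  shows "energy (\<lambda>y. indicator (\<Omega>s s) (- h + y) - indicator (\<Omega>s s) y) (quot t) = - 4 * pi * (v \<bullet> h) * measure lborel (\<Omega>s s)"
proof -
  have "energy (\<lambda>y. indicator (\<Omega>s s) (- h + y) - indicator (\<Omega>s s) y) (quot t)
    = (\<integral>x. indicator (\<Omega>s s) x * (pot (quot t) (x + h) - pot (quot t) x) \<partial>lborel)"
    by (rule energy_shift_difference_left[OF chs[OF s] ch_quot])
  also have "\<dots> = (\<integral>x. (- 4 * pi * (v \<bullet> h)) * indicator (\<Omega>s s) x \<partial>lborel)"
  proof (intro Bochner_Integration.integral_cong refl)
    fix x
    show "indicator (\<Omega>s s) x * (pot (quot t) (x + h) - pot (quot t) x) = (- 4 * pi * (v \<bullet> h)) * indicator (\<Omega>s s) x"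
    proof (cases "x \<in> \<Omega>s s")
      case True
      have n: "norm (t *\<^sub>R e) < s * \<rho>" "norm h < s * \<rho>" "norm (h + t *\<^sub>R e) < s * \<rho>"
      proof -
        have nt: "norm (t *\<^sub>R e) = t" using t e by simp
        show "norm (t *\<^sub>R e) < s * \<rho>" "norm h < s * \<rho>" "norm (h + t *\<^sub>R e) < s * \<rho>"
          using h t nt norm_triangle_ineq[of h "t *\<^sub>R e"] norm_ge_zero[of h] by linarith+
      qed
      have "x \<in> \<Omega>" "x + t *\<^sub>R e \<in> \<Omega>" "x + h \<in> \<Omega>" "x + h + t *\<^sub>R e \<in> \<Omega>"
        using shrink_sub[OF s] True shrink_margin[OF cv ball s True n(1)] shrink_margin[OF cv ball s True n(2)]
          shrink_margin[OF cv ball s True n(3)] by (auto simp: add.assoc)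
      then have "U (x + t *\<^sub>R e) - U x = - 4 * pi * (t * (v \<bullet> x + \<delta>) + t\<^sup>2 / 2 * (v \<bullet> e))"
        "U (x + h + t *\<^sub>R e) - U (x + h) = - 4 * pi * (t * (v \<bullet> (x + h) + \<delta>) + t\<^sup>2 / 2 * (v \<bullet> e))"
        by - (rule row, assumption+)+
      then have "pot (quot t) (x + h) - pot (quot t) x = (1 / t) * (- 4 * pi * (t * (v \<bullet> h)))"
        unfolding pot_quot by (simp only:) (simp add: inner_simps algebra_simps)
      then show ?thesis using True t by simp
    qed simp
  qed
  also have "\<dots> = - 4 * pi * (v \<bullet> h) * measure lborel (\<Omega>s s)" by simp
  finally show ?thesis .
qed

lemma pot_big_ball:
  assumes "x \<in> ball z0 R"
  shows "pot (indicator (ball z0 R)) x = 2 * pi * R\<^sup>2 - 2 * pi / 3 * (norm (x - z0))\<^sup>2"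
  using assms unfolding pot_ball_translate[of z0]
  by (intro pot_ball_inside) (simp add: dist_norm norm_minus_commute)

lemma pot_big_ball_diff:
  assumes "x \<in> ball z0 R" "x + h \<in> ball z0 R"
  shows "pot (indicator (ball z0 R)) (x + h) - pot (indicator (ball z0 R)) x = - (2 * pi / 3) * (2 * ((x - z0) \<bullet> h) + (norm h)\<^sup>2)"
proof -
  have "(norm (x + h - z0))\<^sup>2 = (norm (x - z0))\<^sup>2 + (2 * ((x - z0) \<bullet> h) + (norm h)\<^sup>2)"
    by (simp only: power2_norm_eq_inner) (simp add: inner_simps inner_commute algebra_simps)
  moreover have "(c - a * (p + q)) - (c - a * p) = - a * q" for a c p q :: real by (simp add: algebra_simps)
  ultimately show ?thesis by (simp only: pot_big_ball[OF assms(1)] pot_big_ball[OF assms(2)])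
qed

text \<open>A ball so large that its potential is an explicit quadratic function on a neighbourhood of the body,
  with a gradient whose component along \<open>b\<close> has a fixed sign there.\<close>

lemma big_ball:
  assumes b: "norm b = 1"
  obtains z0 R where "\<And>x h. x \<in> \<Omega> \<Longrightarrow> norm h \<le> 1 \<Longrightarrow> x + h \<in> ball z0 R" "\<And>x. x \<in> \<Omega> \<Longrightarrow> (x - z0) \<bullet> b \<ge> 1"
proof -
  obtain M where M: "\<And>x. x \<in> \<Omega> \<Longrightarrow> norm x \<le> M" using bd by (auto simp: bounded_iff)
  have "x0 \<in> \<Omega>" using ball \<rho> by auto
  then have M0: "M \<ge> 0" using M[of x0] norm_ge_zero[of x0] by linarith
  \<comment> \<open>far enough on the side of \<open>- b\<close> to see the whole body in direction \<open>b\<close>\<close>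
  let ?z = "- (M + 1) *\<^sub>R b"
  have bb: "b \<bullet> b = 1" using b by (simp add: dot_square_norm)
  show ?thesis
  proof (rule that[of ?z "2 * M + 3"])
    fix x h :: "real^3" assume x: "x \<in> \<Omega>" and h: "norm h \<le> 1"
    have "norm (x + h - ?z) \<le> norm x + norm h + norm ?z"
      by (metis norm_triangle_ineq4 norm_triangle_ineq order_trans add_right_mono)
    also have "norm ?z = M + 1" using b M0 by simp
    finally have "norm (x + h - ?z) < 2 * M + 3" using M[OF x] h by linarith
    then show "x + h \<in> ball ?z (2 * M + 3)" by (simp only: mem_ball dist_norm norm_minus_commute)
  next
    fix x assume x: "x \<in> \<Omega>"
    have "\<bar>x \<bullet> b\<bar> \<le> M" using Cauchy_Schwarz_ineq2[of x b] M[OF x] b by simp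
    then show "(x - ?z) \<bullet> b \<ge> 1" by (simp add: inner_simps bb)
  qed
qed

lemma energy_quot_ball:
  assumes b: "\<And>x h. x \<in> \<Omega> \<Longrightarrow> norm h \<le> 1 \<Longrightarrow> x + h \<in> ball z0 R" "\<And>x. x \<in> \<Omega> \<Longrightarrow> (x - z0) \<bullet> e \<ge> 1"
    and t: "0 < t" "t \<le> 1"
  shows "energy (quot t) (indicator (ball z0 R)) \<ge> 2 * pi / 3 * V"
proof -
  let ?k = "indicator (ball z0 R) :: real^3 \<Rightarrow> real"
  have "energy (quot t) ?k = (1 / t) * energy (\<lambda>y. indicator \<Omega> (- (- t *\<^sub>R e) + y) - indicator \<Omega> y) ?k"
    unfolding quot_def by (rule energy_scale_left)
  also have "\<dots> = (1 / t) * (\<integral>x. indicator \<Omega> x * (pot ?k (x + - t *\<^sub>R e) - pot ?k x) \<partial>lborel)"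
    by (simp only: energy_shift_difference_left[OF ch charge_ball])
  finally have eq: "energy (quot t) ?k = (1 / t) * (\<integral>x. indicator \<Omega> x * (pot ?k (x + - t *\<^sub>R e) - pot ?k x) \<partial>lborel)" .
  have "(\<integral>x. indicator \<Omega> x * (pot ?k (x + - t *\<^sub>R e) - pot ?k x) \<partial>lborel) \<ge> (\<integral>x. (2 * pi / 3 * t) * indicator \<Omega> x \<partial>lborel)"
  proof (rule integral_mono)
    show "integrable lborel (\<lambda>x. indicator \<Omega> x * (pot ?k (x + - t *\<^sub>R e) - pot ?k x))"
      using integrable_energy[OF ch charge_ball[of z0 R], of "- t *\<^sub>R e"] integrable_energy0[OF ch charge_ball[of z0 R]]
      by (simp only: right_diff_distrib add.commute) (rule Bochner_Integration.integrable_diff)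
    show "integrable lborel (\<lambda>x. (2 * pi / 3 * t) * indicator \<Omega> x)" by (intro integrable_mult_right charge_integrable ch)
    fix x
    show "(2 * pi / 3 * t) * indicator \<Omega> x \<le> indicator \<Omega> x * (pot ?k (x + - t *\<^sub>R e) - pot ?k x)"
    proof (cases "x \<in> \<Omega>")
      case True
      have "x + 0 \<in> ball z0 R" "x + - t *\<^sub>R e \<in> ball z0 R" by (rule b; use True t e in simp)+
      then have "pot ?k (x + - t *\<^sub>R e) - pot ?k x = - (2 * pi / 3) * (2 * ((x - z0) \<bullet> (- t *\<^sub>R e)) + (norm (- t *\<^sub>R e))\<^sup>2)"
        by (intro pot_big_ball_diff) simp_all
      also have "\<dots> = (2 * pi / 3 * t) * (2 * ((x - z0) \<bullet> e) - t)"
        using t e by (simp add: power2_eq_square algebra_simps)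
      also have "\<dots> \<ge> (2 * pi / 3 * t) * 1"
        using t b(2)[OF True] by (intro mult_left_mono) auto
      finally show ?thesis using True by simp
    qed simp
  qed
  then have "(1 / t) * (\<integral>x. (2 * pi / 3 * t) * indicator \<Omega> x \<partial>lborel) \<le> energy (quot t) ?k"
    unfolding eq using t by (intro mult_left_mono) auto
  then show ?thesis using t by simp
qed

text \<open>If \<open>v \<bullet> e \<le> 0\<close>, the energy of the difference quotients has a nonpositive limit.  Their interaction with a suitable large ball stays away from zero, which contradicts the Cauchy-Schwarz inequality for the energy.\<close>

lemma row_pos: "v \<bullet> e > 0"
proof (rule ccontr)
  assume neg: "\<not> v \<bullet> e > 0"
  obtain z0 R where b: "\<And>x h. x \<in> \<Omega> \<Longrightarrow> norm h \<le> 1 \<Longrightarrow> x + h \<in> ball z0 R" "\<And>x. x \<in> \<Omega> \<Longrightarrow> (x - z0) \<bullet> e \<ge> 1"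
    using big_ball[OF e] by metis
  let ?k = "indicator (ball z0 R) :: real^3 \<Rightarrow> real"
  let ?K = "energy ?k ?k"
  have le: "2 * y * (2 * pi / 3 * V) \<le> ?K" if y: "y > 0" for y
  proof -
    have "((\<lambda>t. ?K + y\<^sup>2 * energy (quot t) (quot t)) \<longlongrightarrow> ?K + y\<^sup>2 * (4 * pi * (v \<bullet> e) * V)) (at_right 0)"
      by (intro tendsto_intros energy_quot_tendsto)
    moreover have "\<forall>\<^sub>F t in at_right 0. 2 * y * (2 * pi / 3 * V) \<le> ?K + y\<^sup>2 * energy (quot t) (quot t)"
    proof -
      have "2 * y * (2 * pi / 3 * V) \<le> ?K + y\<^sup>2 * energy (quot t) (quot t)" if t: "0 < t" "t < 1" for t
      proof -
        have "0 \<le> energy (quot t) (quot t) * y\<^sup>2 - 2 * y * energy (quot t) ?k + ?K"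
          using energy_quadratic_nonneg[OF charge_ball[of z0 R] ch_quot[of t] ch_quot[of t], of "- y" 0]
            energy_commute[OF ch_quot[of t] charge_ball[of z0 R]] by (simp add: algebra_simps)
        moreover have "2 * y * (2 * pi / 3 * V) \<le> 2 * y * energy (quot t) ?k"
          using energy_quot_ball[OF b, of t] t y by (intro mult_left_mono) auto
        moreover have "y\<^sup>2 * energy (quot t) (quot t) = energy (quot t) (quot t) * y\<^sup>2" by (rule mult.commute)
        ultimately show ?thesis by linarith
      qed
      moreover have "\<forall>\<^sub>F t in at_right 0. t \<in> {0<..<1::real}" by (intro eventually_at_right_real) simp
      ultimately show ?thesis by (auto elim!: eventually_mono)
    qed
    ultimately have "2 * y * (2 * pi / 3 * V) \<le> ?K + y\<^sup>2 * (4 * pi * (v \<bullet> e) * V)"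
      by (intro tendsto_lowerbound[OF _ _ trivial_limit_at_right_real])
    moreover have "y\<^sup>2 * (4 * pi * (v \<bullet> e) * V) \<le> 0"
      using neg V_pos by (intro mult_nonneg_nonpos mult_nonpos_nonneg) (auto intro: mult_nonneg_nonpos)
    ultimately show ?thesis by linarith
  qed
  have P: "2 * pi / 3 * V > 0" using V_pos by simp
  have K0: "?K \<ge> 0" by (rule energy_nonneg[OF charge_ball])
  have "(?K + 1) / (2 * pi / 3 * V) > 0" using P K0 by (intro divide_pos_pos) auto
  from le[OF this] have "2 * ((?K + 1) / (2 * pi / 3 * V) * (2 * pi / 3 * V)) \<le> ?K" by (simp only: mult.assoc)
  moreover have "a / p * p = a" if "p > 0" for a p :: real using that by simp
  ultimately have "2 * (?K + 1) \<le> ?K" using P by (simp only:)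
  moreover have "k < 2 * (k + 1)" if "k \<ge> 0" for k :: real using that by (simp add: distrib_left)
  ultimately show False using K0 by (meson not_le)
qed

text \<open>The Hessian of the self-interaction of a body has as trace the integral of \<open>\<Delta> N\<close> over the body, that is, its volume.  In terms of
  averages over all shift directions this is superharmonicity of the potential, with the bound on its mean value excess.\<close>

lemma average_energy_shift:
  assumes s: "0 < s" "s < 1" and r: "r > 0"
  defines "g \<equiv> indicator (\<Omega>s s) :: real^3 \<Rightarrow> real"
  defines "E h \<equiv> energy (\<lambda>y. g (- h + y) - g y) (\<lambda>y. g (- h + y) - g y)"
  shows "integrable lborel (\<lambda>h. indicator (ball 0 r) h * E h)"
    and "(\<integral>h. indicator (ball 0 r) h * E h \<partial>lborel) \<le> 4 / 3 * pi * r^3 * (r\<^sup>2 / 5 * (4 * pi * measure lborel (\<Omega>s s)))"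
proof -
  have cg: "charge g" unfolding g_def by (rule chs[OF s])
  note [measurable] = charge_measurable[OF cg] pot_measurable[OF cg]
  let ?B = "indicator (ball 0 r) :: real^3 \<Rightarrow> real"
  let ?W = "4 / 3 * pi * r^3"
  let ?S = "\<lambda>h x. 2 * pot g x - pot g (x + h) - pot g (x - h)"
  let ?F = "\<lambda>h x. ?B h * (g x * ?S h x)"
  obtain C where C: "C > 0" "\<And>x. \<bar>pot g x\<bar> \<le> C" using pot_bounded[OF cg] by metis
  have Fb: "\<bar>?F h x\<bar> \<le> 4 * C * (?B h * g x)" for h x
  proof -
    have "\<bar>?S h x\<bar> \<le> 4 * C" using C(2)[of x] C(2)[of "x + h"] C(2)[of "x - h"] by linarith
    then show ?thesis by (auto simp: g_def indicator_def)
  qed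
  have iF: "integrable (lborel \<Otimes>\<^sub>M lborel) (case_prod ?F)"
  proof (rule Bochner_Integration.integrable_bound)
    have "emeasure (lborel \<Otimes>\<^sub>M lborel) (ball (0::real^3) r \<times> \<Omega>s s) = emeasure lborel (ball (0::real^3) r) * emeasure lborel (\<Omega>s s)"
      by (rule lborel.emeasure_pair_measure_Times) auto
    also have "\<dots> < \<infinity>"
      using emeasure_ball_finite[of 0 r] emeasure_bounded_finite[OF bounded_subset[OF bd shrink_sub[OF s]]]
      by (simp add: ennreal_mult_less_top)
    finally have "integrable (lborel \<Otimes>\<^sub>M lborel) (\<lambda>p. 4 * C * indicator (ball (0::real^3) r \<times> \<Omega>s s) p :: real)"
      by (intro integrable_mult_right integrable_real_indicator) auto
    moreover have "(\<lambda>p. 4 * C * indicator (ball (0::real^3) r \<times> \<Omega>s s) p) = (\<lambda>(h, x). 4 * C * (?B h * g x))"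
      by (auto simp: fun_eq_iff g_def indicator_times)
    ultimately show "integrable (lborel \<Otimes>\<^sub>M lborel) (\<lambda>(h, x). 4 * C * (?B h * g x))"
      by (simp only:)
    show "case_prod ?F \<in> borel_measurable (lborel \<Otimes>\<^sub>M lborel)" by measurable
    show "AE p in lborel \<Otimes>\<^sub>M lborel. norm (case_prod ?F p) \<le> norm (case p of (h, x) \<Rightarrow> 4 * C * (?B h * g x))"
    proof (rule AE_I2)
      fix p :: "(real^3) \<times> (real^3)"
      have "0 \<le> 4 * C * (?B (fst p) * g (snd p))" using C(1) by (simp add: g_def)
      then show "norm (case_prod ?F p) \<le> norm (case p of (h, x) \<Rightarrow> 4 * C * (?B h * g x))"
        using Fb[of "fst p" "snd p"] by (simp only: case_prod_beta real_norm_def abs_of_nonneg)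
    qed
  qed
  have E: "?B h * E h = (\<integral>x. ?F h x \<partial>lborel)" for h
    unfolding E_def by (simp only: energy_shift_difference[OF cg] integral_mult_right_zero)
  show "integrable lborel (\<lambda>h. ?B h * E h)"
    unfolding E using lborel_pair.integrable_fst[OF iF] .
  have "(\<integral>h. ?B h * E h \<partial>lborel) = (\<integral>x. (\<integral>h. ?F h x \<partial>lborel) \<partial>lborel)"
    unfolding E by (rule lborel_pair.Fubini_integral[OF iF, symmetric])
  also have "\<dots> \<le> (\<integral>x. ?W * (4 * pi * r\<^sup>2 / 5) * g x \<partial>lborel)"
  proof (rule integral_mono)
    show "integrable lborel (\<lambda>x. \<integral>h. ?F h x \<partial>lborel)" by (rule lborel_pair.integrable_snd[OF iF])
    show "integrable lborel (\<lambda>x. ?W * (4 * pi * r\<^sup>2 / 5) * g x)" by (intro integrable_mult_right charge_integrable cg)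
    fix x
    have i1: "integrable lborel (\<lambda>h. ?B h * pot g (x + h))" by (rule integrable_energy[OF charge_ball cg])
    have i2: "integrable lborel (\<lambda>h. ?B h * pot g (x - h))"
    proof (rule integrable_dominated)
      show "integrable lborel (\<lambda>h. C * ?B h)" by (intro integrable_mult_right charge_integrable charge_ball)
      show "\<bar>?B h * pot g (x - h)\<bar> \<le> C * ?B h" for h using C(2)[of "x - h"] by (auto simp: indicator_def)
    qed measurable
    have "(\<integral>h. ?B h * pot g (x - h) \<partial>lborel) = (\<integral>h. (\<lambda>h. ?B h * pot g (x + h)) (- h) \<partial>lborel)"
      by (intro Bochner_Integration.integral_cong refl) (simp add: indicator_def)
    also have "\<dots> = (\<integral>h. ?B h * pot g (x + h) \<partial>lborel)"
      by (rule integral_orthogonal) (auto simp: orthogonal_transformation_neg)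
    finally have m: "(\<integral>h. ?B h * pot g (x - h) \<partial>lborel) = (\<integral>h. ?B h * pot g (x + h) \<partial>lborel)" .
    have "(\<integral>h. ?B h * ?S h x \<partial>lborel) = (\<integral>h. 2 * pot g x * ?B h - ?B h * pot g (x + h) - ?B h * pot g (x - h) \<partial>lborel)"
      by (intro Bochner_Integration.integral_cong refl) (simp add: algebra_simps)
    also have "\<dots> = 2 * pot g x * ?W - (\<integral>h. ?B h * pot g (x + h) \<partial>lborel) - (\<integral>h. ?B h * pot g (x - h) \<partial>lborel)"
      using r by (simp only: Bochner_Integration.integral_diff Bochner_Integration.integrable_diff i1 i2 integrable_mult_right
        charge_integrable[OF charge_ball] integral_mult_right_zero integral_ball_const less_imp_le)
    also have "\<dots> \<le> ?W * (4 * pi * r\<^sup>2 / 5)"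
      unfolding m using pot_mean_value_ge[of "\<Omega>s s" r x] bounded_subset[OF bd shrink_sub[OF s]] r
      by (simp add: g_def algebra_simps)
    finally have le: "(\<integral>h. ?B h * ?S h x \<partial>lborel) \<le> ?W * (4 * pi * r\<^sup>2 / 5)" .
    have "(\<integral>h. ?F h x \<partial>lborel) = (\<integral>h. g x * (?B h * ?S h x) \<partial>lborel)" by (simp only: mult.left_commute)
    also have "\<dots> = g x * (\<integral>h. ?B h * ?S h x \<partial>lborel)" by (rule integral_mult_right_zero)
    also have "\<dots> \<le> g x * (?W * (4 * pi * r\<^sup>2 / 5))" by (rule mult_left_mono[OF le]) (simp add: g_def)
    finally show "(\<integral>h. ?F h x \<partial>lborel) \<le> ?W * (4 * pi * r\<^sup>2 / 5) * g x" by (simp only: mult.commute)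
  qed
  also have "\<dots> = ?W * (r\<^sup>2 / 5 * (4 * pi * measure lborel (\<Omega>s s)))" by (simp add: g_def)
  finally show "(\<integral>h. ?B h * E h \<partial>lborel) \<le> ?W * (r\<^sup>2 / 5 * (4 * pi * measure lborel (\<Omega>s s)))" .
qed

text \<open>Positivity of the energy of \<open>g\<^sub>h + c (v \<bullet> h) f\<^sub>t + \<epsilon> (b \<bullet> h) k\<close>, averaged over \<open>h\<close> in a small ball.  Here \<open>g\<^sub>h\<close> is
  the difference of the indicators of a slightly contracted body and of its translate by \<open>h\<close>, \<open>f\<^sub>t\<close> is the
  difference quotient of the indicator of the body itself in direction \<open>e\<close>, and \<open>k\<close> is the indicator of a large ball.
  The contraction keeps the support of \<open>g\<^sub>h\<close> inside the body, where the row of the potential is known.  The large ball has an explicit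
  quadratic potential on the body; as \<open>b\<close> is orthogonal to \<open>v\<close>, its interaction with \<open>f\<^sub>t\<close> averages out, while the one with
  \<open>g\<^sub>h\<close> contributes a negative term of first order in \<open>\<epsilon>\<close>.\<close>

lemma averaged_positivity:
  assumes s: "0 < s" "s < 1" and t: "0 < t" "t < s * \<rho> / 2"
    and b: "norm b = 1" "v \<bullet> b = 0"
    and k: "\<And>x h. x \<in> \<Omega> \<Longrightarrow> norm h \<le> 1 \<Longrightarrow> x + h \<in> ball z0 R" "\<And>x. x \<in> \<Omega> \<Longrightarrow> (x - z0) \<bullet> b \<ge> 1"
    and \<epsilon>: "\<epsilon> > 0"
  shows "0 \<le> 4 * pi * measure lborel (\<Omega>s s) * (1 - 2 * c * (norm v)\<^sup>2 - 2 / 3 * \<epsilon>)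
     + c\<^sup>2 * (norm v)\<^sup>2 * energy (quot t) (quot t) + \<epsilon>\<^sup>2 * energy (indicator (ball z0 R)) (indicator (ball z0 R))"
proof -
  define g where "g = (indicator (\<Omega>s s) :: real^3 \<Rightarrow> real)"
  define \<kappa> where "\<kappa> = (indicator (ball z0 R) :: real^3 \<Rightarrow> real)"
  define gh where "gh h = (\<lambda>y. g (- h + y) - g y)" for h
  define f where "f = quot t"
  define F K X where "F = energy f f" and "K = energy \<kappa> \<kappa>" and "X = energy f \<kappa>"
  define w where "w = measure lborel (\<Omega>s s)"
  define r where "r = min (s * \<rho> / 2) 1"
  have r: "r > 0" "r \<le> s * \<rho> / 2" "r \<le> 1" using s \<rho> by (auto simp: r_def)
  let ?B = "indicator (ball 0 r) :: real^3 \<Rightarrow> real"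
  let ?W = "4 / 3 * pi * r^3"
  have cg: "charge g" unfolding g_def by (rule chs[OF s])
  have cgh: "charge (gh h)" for h unfolding gh_def by (intro charge_diff charge_translate cg)
  have ck: "charge \<kappa>" unfolding \<kappa>_def by (rule charge_ball)
  have cf: "charge f" unfolding f_def by (rule ch_quot)
  have ig: "integrable lborel g" by (rule charge_integrable[OF cg])
  have gf: "energy (gh h) f = - 4 * pi * (v \<bullet> h) * w" if "norm h < r" for h
    unfolding gh_def g_def f_def w_def by (rule energy_quot_shrink[OF s t(1)]) (use that r t in linarith)
  obtain m where m: "\<And>h. (\<integral>x. g x * ((x - z0) \<bullet> h) \<partial>lborel) = m \<bullet> h" "\<And>h. integrable lborel (\<lambda>x. g x * ((x - z0) \<bullet> h))"
  proof -
    have cm: "integrable lborel (\<lambda>x. g x *\<^sub>R (x - z0))"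
    proof (rule Bochner_Integration.integrable_bound)
      show "integrable lborel (\<lambda>x. R * g x)" by (intro integrable_mult_right ig)
      show "(\<lambda>x. g x *\<^sub>R (x - z0)) \<in> borel_measurable lborel" using charge_measurable[OF cg] by measurable
      have "norm (g x *\<^sub>R (x - z0)) \<le> norm (R * g x)" for x
        using k(1)[of x 0] shrink_sub[OF s] by (auto simp: g_def indicator_def dist_norm norm_minus_commute)
      then show "AE x in lborel. norm (g x *\<^sub>R (x - z0)) \<le> norm (R * g x)" by simp
    qed
    show ?thesis
    proof (rule that[of "\<integral>x. g x *\<^sub>R (x - z0) \<partial>lborel"])
      show "(\<integral>x. g x * ((x - z0) \<bullet> h) \<partial>lborel) = (\<integral>x. g x *\<^sub>R (x - z0) \<partial>lborel) \<bullet> h" for h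
        using integral_inner_left[of h lborel "\<lambda>x. g x *\<^sub>R (x - z0)"] cm by simp
      show "integrable lborel (\<lambda>x. g x * ((x - z0) \<bullet> h))" for h
        using integrable_inner_left[of h lborel "\<lambda>x. g x *\<^sub>R (x - z0)"] cm by simp
    qed
  qed
  have gk: "energy (gh h) \<kappa> = - (2 * pi / 3) * (2 * (m \<bullet> h) + (norm h)\<^sup>2 * w)" if h: "norm h < r" for h
  proof -
    have "energy (gh h) \<kappa> = (\<integral>x. g x * (pot \<kappa> (x + h) - pot \<kappa> x) \<partial>lborel)"
      unfolding gh_def by (rule energy_shift_difference_left[OF cg ck])
    also have "\<dots> = (\<integral>x. - (2 * pi / 3) * (2 * (g x * ((x - z0) \<bullet> h)) + (norm h)\<^sup>2 * g x) \<partial>lborel)"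
    proof (intro Bochner_Integration.integral_cong refl)
      fix x
      show "g x * (pot \<kappa> (x + h) - pot \<kappa> x) = - (2 * pi / 3) * (2 * (g x * ((x - z0) \<bullet> h)) + (norm h)\<^sup>2 * g x)"
      proof (cases "x \<in> \<Omega>s s")
        case True
        then have x: "x \<in> \<Omega>" using shrink_sub[OF s] by auto
        have "x \<in> ball z0 R" "x + h \<in> ball z0 R" using k(1)[OF x, of 0] k(1)[OF x, of h] h r by auto
        from pot_big_ball_diff[OF this] show ?thesis using True by (simp add: \<kappa>_def g_def)
      qed (simp add: g_def)
    qed
    also have "\<dots> = - (2 * pi / 3) * (2 * (m \<bullet> h) + (norm h)\<^sup>2 * w)"
    proof -
      have "(\<integral>x. 2 * (g x * ((x - z0) \<bullet> h)) + (norm h)\<^sup>2 * g x \<partial>lborel) = 2 * (m \<bullet> h) + (norm h)\<^sup>2 * (\<integral>x. g x \<partial>lborel)"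
        by (simp only: Bochner_Integration.integral_add m integrable_mult_right ig integral_mult_right_zero)
      then show ?thesis by (simp only: integral_mult_right_zero) (simp add: g_def w_def)
    qed
    finally show ?thesis .
  qed
  have mb: "m \<bullet> b \<ge> w"
  proof -
    have "(\<integral>x. g x \<partial>lborel) \<le> (\<integral>x. g x * ((x - z0) \<bullet> b) \<partial>lborel)"
    proof (rule integral_mono[OF ig m(2)])
      show "g x \<le> g x * ((x - z0) \<bullet> b)" for x
        using k(2)[of x] shrink_sub[OF s] by (auto simp: g_def indicator_def)
    qed
    then show ?thesis unfolding m(1) by (simp add: g_def w_def inner_commute)
  qed
  define T where "T h = ?B h * energy (gh h) (gh h)" for h
  have iT: "integrable lborel T" and T: "(\<integral>h. T h \<partial>lborel) \<le> ?W * (r\<^sup>2 / 5 * (4 * pi * w))"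
    using average_energy_shift[OF s r(1)] by (simp_all add: T_def[abs_def] gh_def g_def w_def)
  define q where "q a b h = ?B h * ((a \<bullet> h) * (b \<bullet> h))" for a b h :: "real^3"
  have iq: "integrable lborel (q a b)" "(\<integral>h. q a b h \<partial>lborel) = ?W * (r\<^sup>2 / 5 * (a \<bullet> b))" for a b
    using ball_moment[OF r(1)] by (simp_all add: q_def[abs_def])
  \<comment> \<open>the cubic part of the interaction with the large ball, which is odd and averages to zero\<close>
  define o3 where "o3 h = ?B h * ((b \<bullet> h) * (norm h)\<^sup>2)" for h
  have io: "integrable lborel o3"
  proof (rule integrable_dominated)
    show "integrable lborel (\<lambda>h. ?B h)" by (rule charge_integrable[OF charge_ball])
    show "\<bar>o3 h\<bar> \<le> ?B h" for h
    proof (cases "h \<in> ball 0 r")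
      case True
      then have h: "norm h \<le> 1" using r by simp
      have "\<bar>b \<bullet> h\<bar> \<le> 1" using Cauchy_Schwarz_ineq2[of b h] b h by simp
      moreover have "(norm h)\<^sup>2 \<le> 1" using h by (simp add: power_le_one)
      ultimately show ?thesis using True by (simp add: o3_def abs_mult mult_le_one)
    qed (simp add: o3_def)
    show "o3 \<in> borel_measurable borel" unfolding o3_def[abs_def] by measurable
  qed
  have o0: "(\<integral>h. o3 h \<partial>lborel) = 0"
    by (rule integral_odd) (auto simp: o3_def indicator_def)
  have pos: "0 \<le> T h + c\<^sup>2 * F * q v v h + \<epsilon>\<^sup>2 * K * q b b h - (8 * pi * c * w) * q v v h
     - (8 * pi / 3 * \<epsilon>) * q b m h - (4 * pi / 3 * \<epsilon> * w) * o3 h + (2 * c * \<epsilon> * X) * q v b h" for h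
  proof (cases "h \<in> ball 0 r")
    case True
    then have h: "norm h < r" by simp
    have "0 \<le> energy (gh h) (gh h) + (c * (v \<bullet> h))\<^sup>2 * energy f f + (\<epsilon> * (b \<bullet> h))\<^sup>2 * energy \<kappa> \<kappa>
       + 2 * (c * (v \<bullet> h)) * energy (gh h) f + 2 * (\<epsilon> * (b \<bullet> h)) * energy (gh h) \<kappa> + 2 * (c * (v \<bullet> h)) * (\<epsilon> * (b \<bullet> h)) * energy f \<kappa>"
      by (rule energy_quadratic_nonneg[OF cgh cf ck])
    then show ?thesis using True
      unfolding gf[OF h] gk[OF h] F_def[symmetric] K_def[symmetric] X_def[symmetric]
      by (simp add: T_def q_def o3_def power2_eq_square algebra_simps)
  qed (simp add: T_def q_def o3_def)
  have "0 \<le> (\<integral>h. T h + c\<^sup>2 * F * q v v h + \<epsilon>\<^sup>2 * K * q b b h - (8 * pi * c * w) * q v v h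
     - (8 * pi / 3 * \<epsilon>) * q b m h - (4 * pi / 3 * \<epsilon> * w) * o3 h + (2 * c * \<epsilon> * X) * q v b h \<partial>lborel)"
    by (rule Bochner_Integration.integral_nonneg) (rule pos)
  also have "\<dots> = (\<integral>h. T h \<partial>lborel) + c\<^sup>2 * F * (?W * (r\<^sup>2 / 5 * (v \<bullet> v))) + \<epsilon>\<^sup>2 * K * (?W * (r\<^sup>2 / 5 * (b \<bullet> b)))
     - (8 * pi * c * w) * (?W * (r\<^sup>2 / 5 * (v \<bullet> v))) - (8 * pi / 3 * \<epsilon>) * (?W * (r\<^sup>2 / 5 * (b \<bullet> m))) - (4 * pi / 3 * \<epsilon> * w) * 0
     + (2 * c * \<epsilon> * X) * (?W * (r\<^sup>2 / 5 * (v \<bullet> b)))"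
    by (simp only: Bochner_Integration.integral_add Bochner_Integration.integral_diff Bochner_Integration.integrable_add
      Bochner_Integration.integrable_diff integrable_mult_right iT iq io integral_mult_right_zero o0)
  also have "\<dots> \<le> ?W * (r\<^sup>2 / 5 * (4 * pi * w)) + c\<^sup>2 * F * (?W * (r\<^sup>2 / 5 * (v \<bullet> v))) + \<epsilon>\<^sup>2 * K * (?W * (r\<^sup>2 / 5 * (b \<bullet> b)))
     - (8 * pi * c * w) * (?W * (r\<^sup>2 / 5 * (v \<bullet> v))) - (8 * pi / 3 * \<epsilon>) * (?W * (r\<^sup>2 / 5 * w)) - (4 * pi / 3 * \<epsilon> * w) * 0
     + (2 * c * \<epsilon> * X) * (?W * (r\<^sup>2 / 5 * (v \<bullet> b)))"
    using r \<epsilon> mb by (intro add_mono diff_mono T order_refl mult_left_mono) (auto simp: inner_commute)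
  also have "\<dots> = (?W * (r\<^sup>2 / 5)) * (4 * pi * w * (1 - 2 * c * (norm v)\<^sup>2 - 2 / 3 * \<epsilon>) + c\<^sup>2 * (norm v)\<^sup>2 * F + \<epsilon>\<^sup>2 * K)"
    unfolding b(2) dot_square_norm b(1) by (simp add: algebra_simps)
  finally have "0 \<le> (?W * (r\<^sup>2 / 5)) * (4 * pi * w * (1 - 2 * c * (norm v)\<^sup>2 - 2 / 3 * \<epsilon>) + c\<^sup>2 * (norm v)\<^sup>2 * F + \<epsilon>\<^sup>2 * K)" .
  moreover have "?W * (r\<^sup>2 / 5) > 0" using r by simp
  ultimately show ?thesis by (simp only: zero_le_mult_iff) (auto simp: w_def F_def f_def K_def \<kappa>_def)
qed

text \<open>Letting \<open>t\<close> and \<open>s\<close> tend to zero in \<open>averaged_positivity\<close> with \<open>c = 1 / (v \<bullet> e)\<close>, the minimiser, leaves \<open>1 - \<bar>v\<bar>\<^sup>2 / (v \<bullet> e) - (2/3) \<epsilon> + O(\<epsilon>\<^sup>2) \<ge> 0\<close>; a small \<open>\<epsilon> > 0\<close> makes the inequality strict.\<close>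

theorem row_strict: "(norm v)\<^sup>2 < v \<bullet> e"
proof -
  obtain b where b: "norm b = 1" "v \<bullet> b = 0" by (rule exists_perpendicular)
  obtain z0 R where k: "\<And>x h. x \<in> \<Omega> \<Longrightarrow> norm h \<le> 1 \<Longrightarrow> x + h \<in> ball z0 R" "\<And>x. x \<in> \<Omega> \<Longrightarrow> (x - z0) \<bullet> b \<ge> 1"
    using big_ball[OF b(1)] by metis
  define K where "K = energy (indicator (ball z0 R)) (indicator (ball z0 R))"
  define a where "a = v \<bullet> e"
  have a: "a > 0" using row_pos by (simp add: a_def)
  define n2 where "n2 = (norm v)\<^sup>2"
  have K0: "K \<ge> 0" unfolding K_def by (rule energy_nonneg[OF charge_ball])
  let ?c = "1 / a"
  have shr: "0 \<le> 4 * pi * ((1 - s)^3 * V) * (1 - 2 * ?c * n2 - 2 / 3 * \<epsilon>) + ?c\<^sup>2 * n2 * (4 * pi * a * V) + \<epsilon>\<^sup>2 * K"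
    if s: "0 < s" "s < 1" and \<epsilon>: "\<epsilon> > 0" for s \<epsilon>
  proof -
    have "((\<lambda>t. 4 * pi * measure lborel (\<Omega>s s) * (1 - 2 * ?c * n2 - 2 / 3 * \<epsilon>) + ?c\<^sup>2 * n2 * energy (quot t) (quot t) + \<epsilon>\<^sup>2 * K)
       \<longlongrightarrow> 4 * pi * measure lborel (\<Omega>s s) * (1 - 2 * ?c * n2 - 2 / 3 * \<epsilon>) + ?c\<^sup>2 * n2 * (4 * pi * a * V) + \<epsilon>\<^sup>2 * K) (at_right 0)"
      unfolding a_def by (intro tendsto_intros energy_quot_tendsto)
    moreover have "\<forall>\<^sub>F t in at_right 0. 0 \<le> 4 * pi * measure lborel (\<Omega>s s) * (1 - 2 * ?c * n2 - 2 / 3 * \<epsilon>) + ?c\<^sup>2 * n2 * energy (quot t) (quot t) + \<epsilon>\<^sup>2 * K"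
    proof -
      have "\<forall>\<^sub>F t in at_right 0. t \<in> {0<..<s * \<rho> / 2}" using s \<rho> by (intro eventually_at_right_real) simp
      then show ?thesis unfolding n2_def K_def
        by eventually_elim (rule averaged_positivity[OF s _ _ b k \<epsilon>]; simp)
    qed
    ultimately have "0 \<le> 4 * pi * measure lborel (\<Omega>s s) * (1 - 2 * ?c * n2 - 2 / 3 * \<epsilon>) + ?c\<^sup>2 * n2 * (4 * pi * a * V) + \<epsilon>\<^sup>2 * K"
      by (intro tendsto_lowerbound[OF _ _ trivial_limit_at_right_real])
    then show ?thesis using vol_shrink[OF meas, of s x0] s by simp
  qed
  have lim: "0 \<le> 4 * pi * V * (1 - n2 / a - 2 / 3 * \<epsilon>) + \<epsilon>\<^sup>2 * K" if \<epsilon>: "\<epsilon> > 0" for \<epsilon>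
  proof -
    have "((\<lambda>s. 4 * pi * ((1 - s)^3 * V) * (1 - 2 * ?c * n2 - 2 / 3 * \<epsilon>) + ?c\<^sup>2 * n2 * (4 * pi * a * V) + \<epsilon>\<^sup>2 * K)
      \<longlongrightarrow> 4 * pi * ((1 - 0)^3 * V) * (1 - 2 * ?c * n2 - 2 / 3 * \<epsilon>) + ?c\<^sup>2 * n2 * (4 * pi * a * V) + \<epsilon>\<^sup>2 * K) (at_right 0)"
      by (intro tendsto_intros)
    moreover have "\<forall>\<^sub>F s in at_right 0. 0 \<le> 4 * pi * ((1 - s)^3 * V) * (1 - 2 * ?c * n2 - 2 / 3 * \<epsilon>) + ?c\<^sup>2 * n2 * (4 * pi * a * V) + \<epsilon>\<^sup>2 * K"
    proof -
      have "\<forall>\<^sub>F s in at_right 0. s \<in> {0<..<1::real}" by (intro eventually_at_right_real) simp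
      then show ?thesis by eventually_elim (rule shr; use \<epsilon> in simp)
    qed
    ultimately have "0 \<le> 4 * pi * ((1 - 0)^3 * V) * (1 - 2 * ?c * n2 - 2 / 3 * \<epsilon>) + ?c\<^sup>2 * n2 * (4 * pi * a * V) + \<epsilon>\<^sup>2 * K"
      by (intro tendsto_lowerbound[OF _ _ trivial_limit_at_right_real])
    also have "\<dots> = 4 * pi * V * (1 - n2 / a - 2 / 3 * \<epsilon>) + \<epsilon>\<^sup>2 * K"
      using a by (simp add: field_simps power2_eq_square)
    finally show ?thesis .
  qed
  \<comment> \<open>so small that \<open>\<epsilon>\<^sup>2 K\<close> is below the term \<open>\<pi> V \<epsilon>\<close>, a fraction of the gain of first order\<close>
  define \<epsilon> where "\<epsilon> = pi * V / (K + 1)"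
  have PV: "pi * V > 0" using V_pos by simp
  have \<epsilon>: "\<epsilon> > 0" unfolding \<epsilon>_def using PV K0 by (intro divide_pos_pos) auto
  have "\<epsilon> * K < \<epsilon> * (K + 1)" using \<epsilon> by simp
  also have "\<epsilon> * (K + 1) = pi * V" using K0 by (simp add: \<epsilon>_def)
  finally have "\<epsilon> * (\<epsilon> * K) < \<epsilon> * (pi * V)" using \<epsilon> by simp
  then have "\<epsilon>\<^sup>2 * K < pi * V * \<epsilon>" by (simp add: power2_eq_square mult_ac)
  then have "0 < 4 * (pi * V) * (1 - n2 / a - 2 / 3 * \<epsilon>) + pi * V * \<epsilon>" using lim[OF \<epsilon>] by (simp add: mult.assoc)
  also have "\<dots> = (pi * V) * (4 * (1 - n2 / a) - 5 / 3 * \<epsilon>)" by (simp add: algebra_simps)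
  finally have "4 * (1 - n2 / a) - 5 / 3 * \<epsilon> > 0" by (rule zero_less_mult_pos[OF _ PV])
  moreover have "4 * (1 - n2 / a) = 4 - 4 * (n2 / a)" by (simp only: right_diff_distrib mult_1_right)
  ultimately have "n2 / a < 1" using \<epsilon> by linarith
  then show ?thesis using a by (simp add: n2_def a_def)
qed

text \<open>Newton's third law: the body exerts no net force on itself, so the derivative of its potential in direction \<open>e\<close>
  has mean zero.\<close>

lemma row_no_sign:
  assumes \<sigma>: "\<sigma> = 1 \<or> \<sigma> = - 1" and sgn: "\<And>x. x \<in> \<Omega> \<Longrightarrow> \<sigma> * (v \<bullet> x + \<delta>) > 0"
  shows False
proof -
  obtain L where L: "L > 0" "\<And>x h. \<bar>U (x + h) - U x\<bar> \<le> L * norm h" using pot_lipschitz[OF ch] by metis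
  let ?l = "\<lambda>x. \<sigma> * (v \<bullet> x + \<delta>)"
  define I where "I = (\<integral>x. indicator (ball x0 (\<rho> / 2)) x * ?l x \<partial>lborel)"
  obtain M where M: "\<And>x. x \<in> \<Omega> \<Longrightarrow> norm x \<le> M" using bd by (auto simp: bounded_iff)
  have lb: "\<bar>?l x\<bar> \<le> norm v * M + \<bar>\<delta>\<bar>" if "x \<in> \<Omega>" for x
  proof -
    have "\<bar>v \<bullet> x\<bar> \<le> norm v * M"
      using Cauchy_Schwarz_ineq2[of v x] mult_left_mono[OF M[OF that], of "norm v"] by auto
    then show ?thesis using \<sigma> by auto
  qed
  have il: "integrable lborel (\<lambda>x. indicator A x * ?l x)" if "A \<subseteq> \<Omega>" "A \<in> sets borel" for A
  proof (rule integrable_dominated)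
    note [measurable] = that(2)
    show "integrable lborel (\<lambda>x. (norm v * M + \<bar>\<delta>\<bar>) * indicator \<Omega> x)" by (intro integrable_mult_right charge_integrable ch)
    show "(\<lambda>x. indicator A x * ?l x) \<in> borel_measurable borel" by measurable
    show "\<bar>indicator A x * ?l x\<bar> \<le> (norm v * M + \<bar>\<delta>\<bar>) * indicator \<Omega> x" for x
      using lb[of x] that(1) by (auto simp: indicator_def)
  qed
  have sub: "ball x0 (\<rho> / 2) \<subseteq> \<Omega>" using ball \<rho> subset_ball[of "\<rho> / 2" \<rho> x0] by auto
  have "I > 0"
  proof -
    have nn: "0 \<le> indicator (ball x0 (\<rho> / 2)) x * ?l x" for x using sgn[of x] sub by (auto simp: indicator_def less_imp_le)
    have "I \<noteq> 0"
    proof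
      assume "I = 0"
      then have "AE x in lborel. indicator (ball x0 (\<rho> / 2)) x * ?l x = 0"
        unfolding I_def by (subst (asm) integral_nonneg_eq_0_iff_AE[OF il[OF sub]]) (use nn in auto)
      then have "AE x in lborel. x \<notin> ball x0 (\<rho> / 2)"
      proof eventually_elim
        case (elim x)
        show ?case
        proof
          assume "x \<in> ball x0 (\<rho> / 2)"
          then have "?l x = 0" "?l x > 0" using elim sgn[of x] sub by auto
          then show False by linarith
        qed
      qed
      then have "ball x0 (\<rho> / 2) \<in> null_sets lborel" by (subst AE_iff_null_sets) auto
      then have "emeasure lborel (ball x0 (\<rho> / 2)) = 0" by auto
      then have "measure lborel (ball x0 (\<rho> / 2)) = 0" by (simp add: measure_def)
      then show False using \<rho> by simp
    qed
    moreover have "I \<ge> 0" unfolding I_def by (rule Bochner_Integration.integral_nonneg) (rule nn)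
    ultimately show ?thesis by simp
  qed
  have le: "8 * pi * I \<le> t * (2 * L * (6 / \<rho> * V))" if t: "0 < t" "t < \<rho> / 4" for t
  proof -
    define s where "s = 2 * t / \<rho>"
    have s: "0 < s" "s < 1" "s \<le> 1 / 2" and ts: "t < s * \<rho>" using t \<rho> by (auto simp: s_def field_simps)
    let ?D = "\<lambda>x. \<sigma> * (U (x + t *\<^sub>R e) - U (x - t *\<^sub>R e))"
    let ?G = "\<lambda>x. (if x \<in> \<Omega>s s then 0 else ?D x)"
    have D: "?D x = - 8 * pi * t * ?l x" if x: "x \<in> \<Omega>s s" for x
    proof -
      have "x \<in> \<Omega>" "x + t *\<^sub>R e \<in> \<Omega>" "x - t *\<^sub>R e \<in> \<Omega>"
        using shrink_sub[OF s(1,2)] x shrink_margin[OF cv ball s(1,2) x, of "t *\<^sub>R e"] shrink_margin[OF cv ball s(1,2) x, of "- t *\<^sub>R e"] ts t e by auto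
      then have "U (x + t *\<^sub>R e) - U (x - t *\<^sub>R e) = - 8 * pi * t * (v \<bullet> x + \<delta>)"
        using row[of x t] row_minus[of x t] by (simp add: algebra_simps)
      then show ?thesis by (simp only: mult_ac)
    qed
    have Db: "\<bar>?D x\<bar> \<le> 2 * L * t" for x
    proof -
      have "\<bar>U (x - t *\<^sub>R e + (2 * t) *\<^sub>R e) - U (x - t *\<^sub>R e)\<bar> \<le> L * norm ((2 * t) *\<^sub>R e)" by (rule L)
      moreover have "x - t *\<^sub>R e + (2 * t) *\<^sub>R e = x + t *\<^sub>R e" by (simp add: algebra_simps flip: scaleR_add_left)
      ultimately show ?thesis using \<sigma> t e by (auto simp: abs_mult abs_minus_commute)
    qed
    have [measurable]: "?G \<in> borel_measurable borel" by measurable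
    note lay = layer_bound[OF s(1,2), of ?G "2 * L * t"]
    have L1: "integrable lborel (\<lambda>x. indicator \<Omega> x * ?G x)" "\<bar>\<integral>x. indicator \<Omega> x * ?G x \<partial>lborel\<bar> \<le> 2 * L * t * (3 * s * V)"
      by (rule lay; use Db L t in \<open>auto split: if_splits\<close>)+
    have ils: "integrable lborel (\<lambda>x. indicator (\<Omega>s s) x * ?l x)"
      by (rule il[OF shrink_sub[OF s(1,2)]]) measurable
    have "0 = (\<integral>x. \<sigma> * (indicator \<Omega> x * (U (x + t *\<^sub>R e) - U (x - t *\<^sub>R e))) \<partial>lborel)"
      unfolding integral_mult_right_zero energy_shift_even[OF ch] by simp
    also have "\<dots> = (\<integral>x. indicator \<Omega> x * ?G x - (8 * pi * t) * (indicator (\<Omega>s s) x * ?l x) \<partial>lborel)"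
    proof (intro Bochner_Integration.integral_cong refl)
      fix x
      show "\<sigma> * (indicator \<Omega> x * (U (x + t *\<^sub>R e) - U (x - t *\<^sub>R e))) = indicator \<Omega> x * ?G x - (8 * pi * t) * (indicator (\<Omega>s s) x * ?l x)"
        using D[of x] shrink_sub[OF s(1,2)] by (cases "x \<in> \<Omega>s s") (auto simp: indicator_def)
    qed
    also have "\<dots> = (\<integral>x. indicator \<Omega> x * ?G x \<partial>lborel) - (8 * pi * t) * (\<integral>x. indicator (\<Omega>s s) x * ?l x \<partial>lborel)"
      by (simp only: Bochner_Integration.integral_diff[OF L1(1) integrable_mult_right[OF ils]] integral_mult_right_zero)
    finally have "(8 * pi * t) * (\<integral>x. indicator (\<Omega>s s) x * ?l x \<partial>lborel) \<le> 2 * L * t * (3 * s * V)"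
      using L1(2) by linarith
    moreover have "I \<le> (\<integral>x. indicator (\<Omega>s s) x * ?l x \<partial>lborel)"
      unfolding I_def
    proof (rule integral_mono[OF il[OF sub] ils])
      have bs: "ball x0 (\<rho> / 2) \<subseteq> \<Omega>s s"
      proof
        fix y assume y: "y \<in> ball x0 (\<rho> / 2)"
        have "1 / (1 - s) \<le> 2" using s by (simp add: field_simps)
        then have "1 / (1 - s) * norm (y - x0) \<le> 2 * norm (y - x0)" by (rule mult_right_mono) simp
        moreover have "norm ((1 / (1 - s)) *\<^sub>R (y - x0)) = 1 / (1 - s) * norm (y - x0)"
          unfolding norm_scaleR using s by simp
        ultimately have "norm ((1 / (1 - s)) *\<^sub>R (y - x0)) \<le> 2 * norm (y - x0)" by (simp only:)
        also have "\<dots> < \<rho>" using y by (simp add: dist_norm norm_minus_commute)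
        finally have "x0 + (1 / (1 - s)) *\<^sub>R (y - x0) \<in> ball x0 \<rho>" by (simp add: dist_norm)
        then show "y \<in> \<Omega>s s" using ball by (auto simp: shrink_def)
      qed
      show "indicator (ball x0 (\<rho> / 2)) x * ?l x \<le> indicator (\<Omega>s s) x * ?l x" for x
        using bs sgn[of x] shrink_sub[OF s(1,2)] by (auto simp: indicator_def less_imp_le)
    qed simp
    ultimately have "(8 * pi * t) * I \<le> 2 * L * t * (3 * s * V)"
      using t by (meson mult_left_mono order_trans mult_nonneg_nonneg pi_ge_zero less_imp_le zero_le_numeral)
    also have "\<dots> = t * (t * (2 * L * (6 / \<rho> * V)))" by (simp add: s_def)
    finally have "t * (8 * pi * I) \<le> t * (t * (2 * L * (6 / \<rho> * V)))" by (simp add: mult_ac)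
    then show ?thesis using t(1) by (rule mult_left_le_imp_le)
  qed
  have "((\<lambda>t. t * (2 * L * (6 / \<rho> * V))) \<longlongrightarrow> 0 * (2 * L * (6 / \<rho> * V))) (at_right 0)" by (intro tendsto_intros)
  moreover have "\<forall>\<^sub>F t in at_right 0. 8 * pi * I \<le> t * (2 * L * (6 / \<rho> * V))"
  proof -
    have "\<forall>\<^sub>F t in at_right 0. t \<in> {0<..<\<rho> / 4}" using \<rho> by (intro eventually_at_right_real) simp
    then show ?thesis by eventually_elim (rule le; simp)
  qed
  ultimately have "8 * pi * I \<le> 0 * (2 * L * (6 / \<rho> * V))"
    by (intro tendsto_lowerbound[OF _ _ trivial_limit_at_right_real])
  moreover have "8 * pi * I > 0" using \<open>I > 0\<close> by simp
  ultimately show False by simp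
qed

lemma row_zero: "\<exists>p\<in>\<Omega>. v \<bullet> p + \<delta> = 0"
proof (rule ccontr)
  assume no: "\<not> ?thesis"
  have "connected ((\<lambda>x. v \<bullet> x + \<delta>) ` \<Omega>)"
    by (intro connected_continuous_image convex_connected cv continuous_intros)
  then have "(\<forall>x\<in>\<Omega>. v \<bullet> x + \<delta> > 0) \<or> (\<forall>x\<in>\<Omega>. v \<bullet> x + \<delta> < 0)"
    using no unfolding connected_iff_interval
    by (smt (verit, ccfv_threshold) imageE imageI)
  then show False
  proof
    assume "\<forall>x\<in>\<Omega>. v \<bullet> x + \<delta> > 0"
    then show False by (intro row_no_sign[of 1]) auto
  next
    assume "\<forall>x\<in>\<Omega>. v \<bullet> x + \<delta> < 0"
    then have "- 1 * (v \<bullet> x + \<delta>) > 0" if "x \<in> \<Omega>" for x using that by (metis mult_minus1 neg_0_less_iff_less)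
    then show False by (intro row_no_sign[of "- 1"]) auto
  qed
qed

end

section \<open>The part depending on the third coordinate is quadratic\<close>

lemma integrable_ball_fun:
  fixes F :: "real \<Rightarrow> real" and e :: "real^3"
  assumes F: "continuous_on UNIV F" and e: "norm e = 1"
  shows "integrable lborel (\<lambda>h. indicator (ball 0 r) h * F (\<tau> + h \<bullet> e))"
proof -
  have [measurable]: "F \<in> borel_measurable borel" by (rule borel_measurable_continuous_onI[OF F])
  have "compact (F ` {\<tau> - r..\<tau> + r})"
    by (rule compact_continuous_image[OF continuous_on_subset[OF F]]) auto
  then have "bounded (F ` {\<tau> - r..\<tau> + r})" by (rule compact_imp_bounded)
  then obtain M where "\<forall>x\<in>F ` {\<tau> - r..\<tau> + r}. norm x \<le> M" unfolding bounded_iff by blast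
  then have M: "\<And>\<sigma>. \<sigma> \<in> {\<tau> - r..\<tau> + r} \<Longrightarrow> \<bar>F \<sigma>\<bar> \<le> M" by simp
  show ?thesis
  proof (rule integrable_dominated)
    show "integrable lborel (\<lambda>h::real^3. M * indicator (ball 0 r) h)" by (intro integrable_mult_right charge_integrable charge_ball)
    fix h :: "real^3"
    show "\<bar>indicator (ball 0 r) h * F (\<tau> + h \<bullet> e)\<bar> \<le> M * indicator (ball 0 r) h"
    proof (cases "h \<in> ball 0 r")
      case True
      then have "\<bar>h \<bullet> e\<bar> \<le> r" using Cauchy_Schwarz_ineq2[of h e] e by simp
      then have "\<tau> + h \<bullet> e \<in> {\<tau> - r..\<tau> + r}" by auto
      then show ?thesis using M True by simp
    qed simp
  qed measurable
qed

lemma ball_average_quadratic: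
  assumes e: "norm e = 1" and r: "r > 0"
  shows "(\<integral>h. indicator (ball 0 r) h * (p0 + p1 * (\<tau> + h \<bullet> e) + p2 * (\<tau> + h \<bullet> e)\<^sup>2) \<partial>(lborel :: (real^3) measure))
     = 4 / 3 * pi * r^3 * (p0 + p1 * \<tau> + p2 * \<tau>\<^sup>2 + p2 * (r\<^sup>2 / 5))"
proof -
  let ?B = "indicator (ball 0 r) :: real^3 \<Rightarrow> real"
  have o: "(\<integral>h. ?B h * (h \<bullet> e) \<partial>lborel) = 0" by (rule integral_odd) (auto simp: indicator_def)
  have io: "integrable lborel (\<lambda>h. ?B h * (h \<bullet> e))"
    using integrable_ball_fun[of "\<lambda>x. x" e r 0] e by simp
  have ib: "integrable lborel ?B" by (rule charge_integrable[OF charge_ball])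
  note q = ball_moment[OF r, of e e]
  have "(\<integral>h. ?B h * (p0 + p1 * (\<tau> + h \<bullet> e) + p2 * (\<tau> + h \<bullet> e)\<^sup>2) \<partial>lborel) =
     (\<integral>h. (p0 + p1 * \<tau> + p2 * \<tau>\<^sup>2) * ?B h + (p1 + 2 * p2 * \<tau>) * (?B h * (h \<bullet> e)) + p2 * (?B h * ((e \<bullet> h) * (e \<bullet> h))) \<partial>lborel)"
    by (intro Bochner_Integration.integral_cong refl) (simp add: power2_eq_square inner_commute algebra_simps)
  also have "\<dots> = (p0 + p1 * \<tau> + p2 * \<tau>\<^sup>2) * (4 / 3 * pi * r^3) + (p1 + 2 * p2 * \<tau>) * 0 + p2 * (4 / 3 * pi * r^3 * (r\<^sup>2 / 5 * (e \<bullet> e)))"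
    using r by (simp only: Bochner_Integration.integral_add Bochner_Integration.integrable_add integrable_mult_right io ib q
       integral_mult_right_zero o integral_ball_const less_imp_le)
  finally show ?thesis using e by (simp add: dot_square_norm algebra_simps)
qed

text \<open>A weak maximum principle: adding \<open>\<epsilon> (\<tau> - a)\<^sup>2\<close> makes the mean value inequality strict, and a strict
  inequality is impossible at an interior maximum.\<close>

lemma ball_average_maximum_principle:
  fixes F :: "real \<Rightarrow> real" and e :: "real^3"
  assumes F: "continuous_on UNIV F" and e: "norm e = 1" and ab: "a < b" and bd: "F a \<le> 0" "F b \<le> 0"
    and sub: "\<And>\<tau>. a < \<tau> \<Longrightarrow> \<tau> < b \<Longrightarrow> \<exists>r>0. a \<le> \<tau> - r \<and> \<tau> + r \<le> b \<and>
        4 / 3 * pi * r^3 * F \<tau> \<le> (\<integral>h. indicator (ball 0 r) h * F (\<tau> + h \<bullet> e) \<partial>lborel)"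
    and \<tau>: "\<tau> \<in> {a..b}"
  shows "F \<tau> \<le> 0"
proof (rule ccontr)
  assume "\<not> F \<tau> \<le> 0"
  then have pos: "F \<tau> > 0" by simp
  \<comment> \<open>small enough that the added term does not move the maximum to the right end point\<close>
  define \<epsilon> where "\<epsilon> = F \<tau> / (2 * (b - a)\<^sup>2)"
  have \<epsilon>: "\<epsilon> > 0" "\<epsilon> * (b - a)\<^sup>2 < F \<tau>" using pos ab by (auto simp: \<epsilon>_def)
  define G where "G = (\<lambda>\<sigma>. F \<sigma> + (\<epsilon> * a\<^sup>2 + (- 2 * \<epsilon> * a) * \<sigma> + \<epsilon> * \<sigma>\<^sup>2))"
  have G: "G \<sigma> = F \<sigma> + \<epsilon> * (\<sigma> - a)\<^sup>2" for \<sigma> by (simp add: G_def power2_eq_square algebra_simps)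
  have cG: "continuous_on UNIV G" unfolding G_def by (intro continuous_intros F)
  obtain \<sigma> where \<sigma>: "\<sigma> \<in> {a..b}" "\<And>y. y \<in> {a..b} \<Longrightarrow> G y \<le> G \<sigma>"
    using continuous_attains_sup[of "{a..b}" G] continuous_on_subset[OF cG] ab by auto
  have "G \<sigma> \<ge> G \<tau>" using \<sigma>(2) \<tau> by simp
  then have "G \<sigma> > \<epsilon> * (b - a)\<^sup>2" using \<epsilon> G[of \<tau>] by (smt (verit) mult_nonneg_nonneg zero_le_power2)
  moreover have "\<epsilon> * (b - a)\<^sup>2 \<ge> 0" using \<epsilon> by simp
  ultimately have "\<sigma> \<noteq> a" "\<sigma> \<noteq> b" using bd G[of a] G[of b] by auto
  then have "a < \<sigma>" "\<sigma> < b" using \<sigma>(1) by auto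
  from sub[OF this] obtain r where r: "r > 0" "a \<le> \<sigma> - r" "\<sigma> + r \<le> b"
    and le: "4 / 3 * pi * r^3 * F \<sigma> \<le> (\<integral>h. indicator (ball 0 r) h * F (\<sigma> + h \<bullet> e) \<partial>lborel)" by blast
  let ?B = "indicator (ball 0 r) :: real^3 \<Rightarrow> real"
  let ?W = "4 / 3 * pi * r^3"
  have cq: "continuous_on UNIV (\<lambda>\<sigma>. \<epsilon> * a\<^sup>2 + (- 2 * \<epsilon> * a) * \<sigma> + \<epsilon> * \<sigma>\<^sup>2)" by (intro continuous_intros)
  have "(\<integral>h. ?B h * G (\<sigma> + h \<bullet> e) \<partial>lborel) = (\<integral>h. ?B h * F (\<sigma> + h \<bullet> e) + ?B h * (\<epsilon> * a\<^sup>2 + (- 2 * \<epsilon> * a) * (\<sigma> + h \<bullet> e) + \<epsilon> * (\<sigma> + h \<bullet> e)\<^sup>2) \<partial>lborel)"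
    by (simp only: G_def distrib_left)
  also have "\<dots> = (\<integral>h. ?B h * F (\<sigma> + h \<bullet> e) \<partial>lborel) + ?W * (\<epsilon> * a\<^sup>2 + (- 2 * \<epsilon> * a) * \<sigma> + \<epsilon> * \<sigma>\<^sup>2 + \<epsilon> * (r\<^sup>2 / 5))"
    by (simp only: Bochner_Integration.integral_add[OF integrable_ball_fun[OF F e] integrable_ball_fun[OF cq e]] ball_average_quadratic[OF e r(1)])
  also have "\<dots> \<ge> ?W * F \<sigma> + ?W * (\<epsilon> * a\<^sup>2 + (- 2 * \<epsilon> * a) * \<sigma> + \<epsilon> * \<sigma>\<^sup>2 + \<epsilon> * (r\<^sup>2 / 5))" using le by simp
  finally have 1: "?W * G \<sigma> + ?W * (\<epsilon> * (r\<^sup>2 / 5)) \<le> (\<integral>h. ?B h * G (\<sigma> + h \<bullet> e) \<partial>lborel)"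
    by (simp add: G_def distrib_left)
  have "(\<integral>h. ?B h * G (\<sigma> + h \<bullet> e) \<partial>lborel) \<le> (\<integral>h. G \<sigma> * ?B h \<partial>lborel)"
  proof (rule integral_mono[OF integrable_ball_fun[OF cG e]])
    show "integrable lborel (\<lambda>h. G \<sigma> * ?B h)" by (intro integrable_mult_right charge_integrable charge_ball)
    fix h :: "real^3"
    show "?B h * G (\<sigma> + h \<bullet> e) \<le> G \<sigma> * ?B h"
    proof (cases "h \<in> ball 0 r")
      case True
      then have "\<bar>h \<bullet> e\<bar> \<le> r" using Cauchy_Schwarz_ineq2[of h e] e by simp
      then have "\<sigma> + h \<bullet> e \<in> {a..b}" using r by auto
      then show ?thesis using \<sigma>(2) True by simp
    qed simp
  qed
  also have "\<dots> = ?W * G \<sigma>" using r by (simp only: integral_mult_right_zero integral_ball_const less_imp_le mult.commute)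
  finally have "?W * (\<epsilon> * (r\<^sup>2 / 5)) \<le> 0" using 1 by linarith
  moreover have "?W * (\<epsilon> * (r\<^sup>2 / 5)) > 0" using r \<epsilon> by simp
  ultimately show False by linarith
qed

text \<open>After subtracting an interpolating quadratic, the function vanishes at both ends and at the midpoint, so it has an
  interior maximum and an interior minimum.  The mean value excess does not depend on the point, is nonpositive at the
  maximum and nonnegative at the minimum, hence zero.\<close>

lemma constant_mean_excess_imp_quadratic:
  fixes F :: "real \<Rightarrow> real" and e :: "real^3"
  assumes F: "continuous_on UNIV F" and e: "norm e = 1" and ab: "a < b"
    and ex: "\<And>\<tau>1 \<tau>2 r. r > 0 \<Longrightarrow> a \<le> \<tau>1 - r \<Longrightarrow> \<tau>1 + r \<le> b \<Longrightarrow> a \<le> \<tau>2 - r \<Longrightarrow> \<tau>2 + r \<le> b \<Longrightarrow>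
       (\<integral>h. indicator (ball 0 r) h * F (\<tau>1 + h \<bullet> e) \<partial>lborel) - (\<integral>h. indicator (ball 0 r) h * F (\<tau>2 + h \<bullet> e) \<partial>lborel)
         = 4 / 3 * pi * r^3 * (F \<tau>1 - F \<tau>2)"
  shows "\<exists>c0 c1 c2. \<forall>\<tau>\<in>{a..b}. F \<tau> = c0 + c1 * \<tau> + c2 * \<tau>\<^sup>2"
proof -
  define c where "c = (a + b) / 2"
  have c: "a < c" "c < b" using ab by (auto simp: c_def)
  \<comment> \<open>Newton's divided differences at \<open>a, c, b\<close>\<close>
  define s1 where "s1 = (F c - F a) / (c - a)"
  define s2 where "s2 = (F b - F a - s1 * (b - a)) / ((b - a) * (b - c))"
  define p0 p1 p2 where "p0 = F a - s1 * a + s2 * a * c" and "p1 = s1 - s2 * (a + c)" and "p2 = s2"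
  define p where "p \<tau> = p0 + p1 * \<tau> + p2 * \<tau>\<^sup>2" for \<tau>
  have p: "p \<tau> = F a + s1 * (\<tau> - a) + s2 * (\<tau> - a) * (\<tau> - c)" for \<tau>
    by (simp add: p_def p0_def p1_def p2_def power2_eq_square algebra_simps)
  have cp: "continuous_on UNIV p" unfolding p_def by (intro continuous_intros)
  define g where "g \<tau> = F \<tau> - p \<tau>" for \<tau>
  have cg: "continuous_on UNIV g" unfolding g_def by (intro continuous_intros F cp)
  have g0: "g a = 0" "g c = 0" "g b = 0"
  proof -
    show "g a = 0" by (simp add: g_def p)
    show "g c = 0" using c by (simp add: g_def p s1_def)
    have "s2 * (b - a) * (b - c) = F b - F a - s1 * (b - a)" using c ab by (simp add: s2_def)
    then show "g b = 0" by (simp add: g_def p)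
  qed
  let ?A = "\<lambda>F r \<tau>. (\<integral>h. indicator (ball 0 r) h * F (\<tau> + h \<bullet> e) \<partial>lborel) :: real"
  let ?W = "\<lambda>r. 4 / 3 * pi * r^3 :: real"
  have Ag: "?A g r \<tau> = ?A F r \<tau> - ?W r * (p \<tau> + p2 * (r\<^sup>2 / 5))" if r: "r > 0" for r \<tau>
  proof -
    have "?A g r \<tau> = ?A F r \<tau> - ?A p r \<tau>"
      unfolding g_def right_diff_distrib
      by (rule Bochner_Integration.integral_diff) (rule integrable_ball_fun[OF F e], rule integrable_ball_fun[OF cp e])
    then show ?thesis unfolding p_def ball_average_quadratic[OF e r] by simp
  qed
  have exg: "?A g r \<tau>1 - ?A g r \<tau>2 = ?W r * (g \<tau>1 - g \<tau>2)"
    if "r > 0" "a \<le> \<tau>1 - r" "\<tau>1 + r \<le> b" "a \<le> \<tau>2 - r" "\<tau>2 + r \<le> b" for r \<tau>1 \<tau>2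
  proof -
    have gen: "(y - w * (u + q)) - (z - w * (v + q)) = (y - z) - w * (u - v)" for y z w u v q :: real
      by (simp add: algebra_simps)
    have "?A g r \<tau>1 - ?A g r \<tau>2 = (?A F r \<tau>1 - ?A F r \<tau>2) - ?W r * (p \<tau>1 - p \<tau>2)"
      unfolding Ag[OF that(1)] by (rule gen)
    also have "\<dots> = ?W r * (F \<tau>1 - F \<tau>2) - ?W r * (p \<tau>1 - p \<tau>2)" unfolding ex[OF that] ..
    also have "\<dots> = ?W r * (g \<tau>1 - g \<tau>2)" unfolding g_def right_diff_distrib[symmetric] by simp
    finally show ?thesis .
  qed
  have upper: "?A G r \<tau> \<le> ?W r * G \<tau>" if G: "continuous_on UNIV G" and r: "r > 0" "a \<le> \<tau> - r" "\<tau> + r \<le> b"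
      and mx: "\<And>y. y \<in> {a..b} \<Longrightarrow> G y \<le> G \<tau>" for G :: "real \<Rightarrow> real" and r \<tau>
  proof -
    have "?A G r \<tau> \<le> (\<integral>h. G \<tau> * indicator (ball (0::real^3) r) h \<partial>lborel)"
    proof (rule integral_mono[OF integrable_ball_fun[OF G e]])
      show "integrable lborel (\<lambda>h. G \<tau> * indicator (ball (0::real^3) r) h)" by (intro integrable_mult_right charge_integrable charge_ball)
      fix h :: "real^3"
      show "indicator (ball 0 r) h * G (\<tau> + h \<bullet> e) \<le> G \<tau> * indicator (ball 0 r) h"
      proof (cases "h \<in> ball 0 r")
        case True
        then have "\<bar>h \<bullet> e\<bar> \<le> r" using Cauchy_Schwarz_ineq2[of h e] e by simp
        then have "\<tau> + h \<bullet> e \<in> {a..b}" using r by auto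
        then show ?thesis using mx True by simp
      qed simp
    qed
    also have "\<dots> = ?W r * G \<tau>" using r by (simp only: integral_mult_right_zero integral_ball_const less_imp_le mult.commute)
    finally show ?thesis .
  qed
  have interior: "\<exists>\<tau>. a < \<tau> \<and> \<tau> < b \<and> (\<forall>y\<in>{a..b}. G y \<le> G \<tau>)" if G: "continuous_on UNIV G" and z: "G a = 0" "G c = 0" "G b = 0" for G :: "real \<Rightarrow> real"
  proof -
    obtain \<sigma> where \<sigma>: "\<sigma> \<in> {a..b}" "\<And>y. y \<in> {a..b} \<Longrightarrow> G y \<le> G \<sigma>"
      using continuous_attains_sup[of "{a..b}" G] continuous_on_subset[OF G] ab by auto
    show ?thesis
    proof (cases "\<sigma> = a \<or> \<sigma> = b")
      case True
      then have "G \<sigma> = G c" using z by auto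
      then show ?thesis using \<sigma> c by auto
    next
      case False
      then show ?thesis using \<sigma> by (intro exI[of _ \<sigma>]) auto
    qed
  qed
  have cm: "continuous_on UNIV (\<lambda>\<tau>. - g \<tau>)" by (intro continuous_intros cg)
  obtain \<tau>1 where \<tau>1: "a < \<tau>1" "\<tau>1 < b" "\<And>y. y \<in> {a..b} \<Longrightarrow> g y \<le> g \<tau>1" using interior[OF cg g0] by auto
  obtain \<tau>2 where \<tau>2: "a < \<tau>2" "\<tau>2 < b" "\<And>y. y \<in> {a..b} \<Longrightarrow> - g y \<le> - g \<tau>2" using interior[OF cm] g0 by auto
  define r0 where "r0 = min (min (\<tau>1 - a) (b - \<tau>1)) (min (\<tau>2 - a) (b - \<tau>2))"
  have r0: "r0 > 0" using \<tau>1 \<tau>2 by (auto simp: r0_def)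
  have neg: "?A (\<lambda>\<tau>. - g \<tau>) r \<tau> = - ?A g r \<tau>" for r \<tau> by (simp flip: integral_minus)
  have zero: "?A g r \<tau> = ?W r * g \<tau>" if r: "0 < r" "r \<le> r0" "a \<le> \<tau> - r" "\<tau> + r \<le> b" for r \<tau>
  proof -
    have b1: "a \<le> \<tau>1 - r" "\<tau>1 + r \<le> b" "a \<le> \<tau>2 - r" "\<tau>2 + r \<le> b" using r by (auto simp: r0_def)
    have "?A g r \<tau>1 \<le> ?W r * g \<tau>1" by (rule upper[OF cg r(1) b1(1,2) \<tau>1(3)])
    moreover have "?A (\<lambda>\<tau>. - g \<tau>) r \<tau>2 \<le> ?W r * - g \<tau>2" by (rule upper[OF cm r(1) b1(3,4) \<tau>2(3)])
    then have "- ?A g r \<tau>2 \<le> - (?W r * g \<tau>2)" unfolding neg by simp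
    moreover have "?A g r \<tau>1 - ?A g r \<tau>2 = ?W r * g \<tau>1 - ?W r * g \<tau>2" using exg[OF r(1) b1] by (simp only: right_diff_distrib)
    ultimately have "?A g r \<tau>1 = ?W r * g \<tau>1" by linarith
    moreover have "?A g r \<tau> - ?A g r \<tau>1 = ?W r * g \<tau> - ?W r * g \<tau>1" using exg[OF r(1,3,4) b1(1,2)] by (simp only: right_diff_distrib)
    ultimately show ?thesis by linarith
  qed
  have rad: "\<exists>r>0. r \<le> r0 \<and> a \<le> \<tau> - r \<and> \<tau> + r \<le> b" if "a < \<tau>" "\<tau> < b" for \<tau>
    using r0 that by (intro exI[of _ "min r0 (min (\<tau> - a) (b - \<tau>))"]) auto
  have "g \<tau> = 0" if \<tau>: "\<tau> \<in> {a..b}" for \<tau>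
  proof -
    have "g \<tau> \<le> 0"
    proof (rule ball_average_maximum_principle[OF cg e ab _ _ _ \<tau>])
      fix \<sigma> assume "a < \<sigma>" "\<sigma> < b"
      from rad[OF this] obtain r where r: "r > 0" "r \<le> r0" "a \<le> \<sigma> - r" "\<sigma> + r \<le> b" by blast
      then show "\<exists>r>0. a \<le> \<sigma> - r \<and> \<sigma> + r \<le> b \<and> ?W r * g \<sigma> \<le> ?A g r \<sigma>"
        using zero[OF r] by (intro exI[of _ r]) simp
    qed (use g0 in auto)
    moreover have "- g \<tau> \<le> 0"
    proof (rule ball_average_maximum_principle[OF cm e ab _ _ _ \<tau>])
      fix \<sigma> assume "a < \<sigma>" "\<sigma> < b"
      from rad[OF this] obtain r where r: "r > 0" "r \<le> r0" "a \<le> \<sigma> - r" "\<sigma> + r \<le> b" by blast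
      then show "\<exists>r>0. a \<le> \<sigma> - r \<and> \<sigma> + r \<le> b \<and> ?W r * - g \<sigma> \<le> ?A (\<lambda>\<tau>. - g \<tau>) r \<sigma>"
        using zero[OF r] unfolding neg by (intro exI[of _ r]) simp
    qed (use g0 in auto)
    ultimately show ?thesis by simp
  qed
  then show ?thesis by (intro exI[of _ p0] exI[of _ p1] exI[of _ p2]) (simp add: g_def p_def)
qed

lemma quadratic_eq_on_interval:
  fixes c0 c1 c2 d0 d1 d2 :: real
  assumes \<rho>: "\<rho> > 0" and eq: "\<And>\<sigma>. \<bar>\<sigma> - \<tau>\<bar> < \<rho> \<Longrightarrow> c0 + c1 * \<sigma> + c2 * \<sigma>\<^sup>2 = d0 + d1 * \<sigma> + d2 * \<sigma>\<^sup>2"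
  shows "c0 = d0 \<and> c1 = d1 \<and> c2 = d2"
proof -
  define r where "r = \<rho> / 2"
  have r: "r > 0" "r < \<rho>" using \<rho> by (auto simp: r_def)
  define a b c where "a = c0 - d0" and "b = c1 - d1" and "c = c2 - d2"
  have z: "a + b * \<sigma> + c * \<sigma>\<^sup>2 = 0" if "\<bar>\<sigma> - \<tau>\<bar> < \<rho>" for \<sigma>
    using eq[OF that] by (simp add: a_def b_def c_def algebra_simps)
  have 1: "a + b * \<tau> + c * \<tau>\<^sup>2 = 0" "a + b * (\<tau> + r) + c * (\<tau> + r)\<^sup>2 = 0" "a + b * (\<tau> - r) + c * (\<tau> - r)\<^sup>2 = 0"
    by (rule z; use r in simp)+
  have "2 * c * r\<^sup>2 = (a + b * (\<tau> + r) + c * (\<tau> + r)\<^sup>2) + (a + b * (\<tau> - r) + c * (\<tau> - r)\<^sup>2) - 2 * (a + b * \<tau> + c * \<tau>\<^sup>2)"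
    by (simp add: power2_eq_square algebra_simps)
  then have "2 * c * r\<^sup>2 = 0" unfolding 1 by simp
  then have c: "c = 0" using r by simp
  then have "b * r = (a + b * (\<tau> + r) + c * (\<tau> + r)\<^sup>2) - (a + b * \<tau> + c * \<tau>\<^sup>2)" by (simp add: algebra_simps)
  then have "b * r = 0" unfolding 1 by simp
  then have b: "b = 0" using r by simp
  then have "a = 0" using 1(1) c by simp
  then show ?thesis using b c by (simp add: a_def b_def c_def)
qed

text \<open>The coefficients are locally constant, hence constant on a connected set.\<close>

lemma locally_quadratic_imp_quadratic:
  fixes f :: "real \<Rightarrow> real"
  assumes I: "connected I"
    and loc: "\<And>\<tau>. \<tau> \<in> I \<Longrightarrow> \<exists>\<rho>>0. \<exists>c0 c1 c2. \<forall>\<sigma>. \<bar>\<sigma> - \<tau>\<bar> < \<rho> \<longrightarrow> f \<sigma> = c0 + c1 * \<sigma> + c2 * \<sigma>\<^sup>2"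
  shows "\<exists>c0 c1 c2. \<forall>\<tau>\<in>I. f \<tau> = c0 + c1 * \<tau> + c2 * \<tau>\<^sup>2"
proof (cases "I = {}")
  case False
  then obtain \<tau>0 where \<tau>0: "\<tau>0 \<in> I" by auto
  define P where "P c \<tau> \<longleftrightarrow> (\<exists>\<rho>>0. \<forall>\<sigma>. \<bar>\<sigma> - \<tau>\<bar> < \<rho> \<longrightarrow> f \<sigma> = fst c + fst (snd c) * \<sigma> + snd (snd c) * \<sigma>\<^sup>2)" for c \<tau>
  have ex: "\<exists>c. P c \<tau>" if \<tau>: "\<tau> \<in> I" for \<tau>
  proof -
    from loc[OF \<tau>] obtain \<rho> c0 c1 c2 where "\<rho> > 0" "\<forall>\<sigma>. \<bar>\<sigma> - \<tau>\<bar> < \<rho> \<longrightarrow> f \<sigma> = c0 + c1 * \<sigma> + c2 * \<sigma>\<^sup>2" by blast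
    then have "P (c0, c1, c2) \<tau>" unfolding P_def by auto
    then show ?thesis by blast
  qed
  have uniq: "c = d" if "P c \<tau>" "P d \<tau>" for c d \<tau>
  proof -
    from that(1) obtain \<rho>1 where 1: "\<rho>1 > 0" "\<forall>\<sigma>. \<bar>\<sigma> - \<tau>\<bar> < \<rho>1 \<longrightarrow> f \<sigma> = fst c + fst (snd c) * \<sigma> + snd (snd c) * \<sigma>\<^sup>2"
      unfolding P_def by auto
    from that(2) obtain \<rho>2 where 2: "\<rho>2 > 0" "\<forall>\<sigma>. \<bar>\<sigma> - \<tau>\<bar> < \<rho>2 \<longrightarrow> f \<sigma> = fst d + fst (snd d) * \<sigma> + snd (snd d) * \<sigma>\<^sup>2" unfolding P_def by auto
    have "fst c = fst d \<and> fst (snd c) = fst (snd d) \<and> snd (snd c) = snd (snd d)"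
    proof (rule quadratic_eq_on_interval[of "min \<rho>1 \<rho>2" \<tau>])
      fix \<sigma> assume "\<bar>\<sigma> - \<tau>\<bar> < min \<rho>1 \<rho>2"
      then have "\<bar>\<sigma> - \<tau>\<bar> < \<rho>1" "\<bar>\<sigma> - \<tau>\<bar> < \<rho>2" by auto
      then show "fst c + fst (snd c) * \<sigma> + snd (snd c) * \<sigma>\<^sup>2 = fst d + fst (snd d) * \<sigma> + snd (snd d) * \<sigma>\<^sup>2"
        using 1(2) 2(2) by metis
    qed (use 1 2 in auto)
    then show ?thesis by (simp add: prod_eq_iff)
  qed
  have op: "open {\<tau>. P c \<tau>}" for c
  proof (unfold open_contains_ball, rule ballI)
    fix \<tau> assume "\<tau> \<in> {\<tau>. P c \<tau>}"
    then obtain \<rho> where \<rho>: "\<rho> > 0" "\<forall>\<sigma>. \<bar>\<sigma> - \<tau>\<bar> < \<rho> \<longrightarrow> f \<sigma> = fst c + fst (snd c) * \<sigma> + snd (snd c) * \<sigma>\<^sup>2" unfolding P_def by auto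
    have "ball \<tau> \<rho> \<subseteq> {\<tau>. P c \<tau>}"
    proof
      fix \<tau>' assume "\<tau>' \<in> ball \<tau> \<rho>"
      then have d: "\<bar>\<tau> - \<tau>'\<bar> < \<rho>" by (simp add: dist_real_def)
      have "P c \<tau>'"
        unfolding P_def
      proof (intro exI[of _ "\<rho> - \<bar>\<tau> - \<tau>'\<bar>"] conjI allI impI)
        fix \<sigma> assume "\<bar>\<sigma> - \<tau>'\<bar> < \<rho> - \<bar>\<tau> - \<tau>'\<bar>"
        then have "\<bar>\<sigma> - \<tau>\<bar> < \<rho>" by linarith
        then show "f \<sigma> = fst c + fst (snd c) * \<sigma> + snd (snd c) * \<sigma>\<^sup>2" using \<rho> by blast
      qed (use d in simp)
      then show "\<tau>' \<in> {\<tau>. P c \<tau>}" by simp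
    qed
    then show "\<exists>\<rho>>0. ball \<tau> \<rho> \<subseteq> {\<tau>. P c \<tau>}" using \<rho>(1) by blast
  qed
  obtain c where c: "P c \<tau>0" using ex[OF \<tau>0] by blast
  let ?S = "{\<tau>. P c \<tau>}" and ?T = "\<Union>d\<in>- {c}. {\<tau>. P d \<tau>}"
  have "I \<subseteq> ?S"
  proof (rule ccontr)
    assume "\<not> I \<subseteq> ?S"
    have oS: "open ?S" and oT: "open ?T" using op by auto
    have IST: "I \<subseteq> ?S \<union> ?T"
    proof
      fix \<tau> assume "\<tau> \<in> I"
      then obtain d where "P d \<tau>" using ex by blast
      then show "\<tau> \<in> ?S \<union> ?T" by (cases "d = c") auto
    qed
    have disj: "?S \<inter> ?T \<inter> I = {}"
    proof -
      have False if "P c \<tau>" "d \<noteq> c" "P d \<tau>" for d \<tau> using uniq[OF that(1,3)] that(2) by simp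
      then show ?thesis by auto
    qed
    have "?S \<inter> I \<noteq> {}" using c \<tau>0 by blast
    moreover have "?T \<inter> I \<noteq> {}" using \<open>\<not> I \<subseteq> ?S\<close> IST by blast
    ultimately show False using connectedD[OF I oS oT disj IST] by blast
  qed
  then have "f \<tau> = fst c + fst (snd c) * \<tau> + snd (snd c) * \<tau>\<^sup>2" if \<tau>I: "\<tau> \<in> I" for \<tau>
  proof -
    obtain \<rho> where "\<rho> > 0" "\<forall>\<sigma>. \<bar>\<sigma> - \<tau>\<bar> < \<rho> \<longrightarrow> f \<sigma> = fst c + fst (snd c) * \<sigma> + snd (snd c) * \<sigma>\<^sup>2"
      using \<open>I \<subseteq> ?S\<close> \<tau>I unfolding P_def by auto
    then show ?thesis by simp
  qed
  then show ?thesis by blast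
qed auto

text \<open>Moving a small ball along \<open>e\<close> changes neither the contribution of \<open>\<Psi>\<close> nor the mean value excesses of the potential and of the quadratic function.  So the mean value excess of \<open>f\<close> does not depend on the position.\<close>

lemma separated_part_locally_quadratic:
  fixes \<Omega> :: "(real^3) set" and e :: "real^3" and f :: "real \<Rightarrow> real" and \<Psi> :: "real^3 \<Rightarrow> real" and A :: "real^3^3"
  assumes op: "open \<Omega>" and bd: "bounded \<Omega>" and e: "norm e = 1"
    and eq: "\<And>x. x \<in> \<Omega> \<Longrightarrow> pot (indicator \<Omega>) x = (x \<bullet> (A *v x) + b \<bullet> x + c) + f (x \<bullet> e) + \<Psi> x"
    and inv: "\<And>x t. \<Psi> (x + t *\<^sub>R e) = \<Psi> x" and x0: "x0 \<in> \<Omega>"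
  shows "\<exists>\<rho>>0. \<exists>c0 c1 c2. \<forall>\<sigma>. \<bar>\<sigma> - x0 \<bullet> e\<bar> < \<rho> \<longrightarrow> f \<sigma> = c0 + c1 * \<sigma> + c2 * \<sigma>\<^sup>2"
proof -
  let ?U = "pot (indicator \<Omega>)"
  have meas: "\<Omega> \<in> sets borel" using op by simp
  have ch: "charge (indicator \<Omega>)" by (rule charge_indicator[OF bd meas])
  have ee: "e \<bullet> e = 1" using e by (simp add: dot_square_norm)
  define Q where "Q x = x \<bullet> (A *v x) + b \<bullet> x + c" for x
  obtain R where R: "R > 0" "ball x0 R \<subseteq> \<Omega>" using op x0 open_contains_ball by metis
  define \<rho> where "\<rho> = R / 3"
  have \<rho>: "\<rho> > 0" "3 * \<rho> = R" using R by (auto simp: \<rho>_def)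
  define m where "m = x0 \<bullet> e"
  define pt where "pt \<tau> = x0 + (\<tau> - m) *\<^sub>R e" for \<tau>
  have pte: "pt \<tau> \<bullet> e = \<tau>" for \<tau> by (simp add: pt_def inner_simps ee m_def)
  have inB: "pt \<tau> + h \<in> \<Omega>" if "\<bar>\<tau> - m\<bar> \<le> \<rho>" "norm h \<le> \<rho>" for \<tau> h
  proof -
    have "norm ((\<tau> - m) *\<^sub>R e + h) \<le> \<bar>\<tau> - m\<bar> + norm h" using norm_triangle_ineq[of "(\<tau> - m) *\<^sub>R e" h] e by simp
    then have "norm ((\<tau> - m) *\<^sub>R e + h) < R" using that \<rho> by linarith
    moreover have "dist x0 (pt \<tau> + h) = norm ((\<tau> - m) *\<^sub>R e + h)"
      unfolding dist_norm pt_def by (subst norm_minus_commute) (simp add: algebra_simps)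
    ultimately have "pt \<tau> + h \<in> ball x0 R" by simp
    then show ?thesis using R by blast
  qed
  \<comment> \<open>\<open>f\<close> expressed through the potential along the line through \<open>x0\<close>; it is defined and continuous everywhere\<close>
  define H where "H \<tau> = ?U (pt \<tau>) - Q (pt \<tau>) - \<Psi> x0" for \<tau>
  have cpt: "continuous_on UNIV pt" unfolding pt_def by (intro continuous_intros)
  have cQ: "continuous_on UNIV Q" unfolding Q_def
    by (intro continuous_intros matrix_vector_mult_linear_continuous_on)
  have cH: "continuous_on UNIV H"
    unfolding H_def
    by (intro continuous_intros continuous_on_compose2[OF pot_continuous[OF ch] cpt] continuous_on_compose2[OF cQ cpt]) auto
  have fH: "f \<tau> = H \<tau>" if "\<bar>\<tau> - m\<bar> \<le> \<rho>" for \<tau>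
  proof -
    have "pt \<tau> \<in> \<Omega>" using inB[OF that, of 0] \<rho> by simp
    then show ?thesis using eq[of "pt \<tau>"] inv[of x0 "\<tau> - m"] by (simp add: H_def Q_def pte pt_def[symmetric])
  qed
  let ?B = "\<lambda>r. indicator (ball (0::real^3) r) :: real^3 \<Rightarrow> real"
  let ?W = "\<lambda>r. 4 / 3 * pi * r^3 :: real"
  have "\<exists>c0 c1 c2. \<forall>\<tau>\<in>{m - \<rho>..m + \<rho>}. H \<tau> = c0 + c1 * \<tau> + c2 * \<tau>\<^sup>2"
  proof (rule constant_mean_excess_imp_quadratic[OF cH e])
    show "m - \<rho> < m + \<rho>" using \<rho> by simp
    fix \<tau>1 \<tau>2 r assume r: "r > 0" "m - \<rho> \<le> \<tau>1 - r" "\<tau>1 + r \<le> m + \<rho>" "m - \<rho> \<le> \<tau>2 - r" "\<tau>2 + r \<le> m + \<rho>"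
    have b12: "\<bar>\<tau>1 - m\<bar> \<le> \<rho>" "\<bar>\<tau>2 - m\<bar> \<le> \<rho>" "r \<le> \<rho>" using r by linarith+
    define d where "d = \<tau>1 - \<tau>2"
    have p12: "pt \<tau>1 = pt \<tau>2 + d *\<^sub>R e" by (simp add: pt_def d_def algebra_simps)
    \<comment> \<open>the dependence of the quadratic function on the base point is linear in \<open>h\<close> and averages to zero\<close>
    define l where "l h = d * (e \<bullet> (A *v h)) + d * (h \<bullet> (A *v e))" for h
    have Qd: "Q (pt \<tau>1 + h) - Q (pt \<tau>2 + h) = Q (pt \<tau>1) - Q (pt \<tau>2) + l h" for h
      unfolding Q_def l_def p12
      by (simp add: inner_simps matrix_vector_right_distrib matrix_vector_mult_scaleR algebra_simps)
    have cl: "continuous_on UNIV l" unfolding l_def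
      by (intro continuous_intros matrix_vector_mult_linear_continuous_on)
    have lm[measurable]: "l \<in> borel_measurable borel" by (rule borel_measurable_continuous_onI[OF cl])
    have l0: "(\<integral>h. ?B r h * l h \<partial>lborel) = 0"
    proof (rule integral_odd)
      show "?B r (- y) * l (- y) = - (?B r y * l y)" for y
        by (simp add: l_def indicator_def vec.neg algebra_simps)
    qed measurable
    have key: "?B r h * H (\<tau>1 + h \<bullet> e) - ?B r h * H (\<tau>2 + h \<bullet> e)
        = ?B r h * ?U (pt \<tau>1 + h) - ?B r h * ?U (pt \<tau>2 + h) - (Q (pt \<tau>1) - Q (pt \<tau>2)) * ?B r h - ?B r h * l h" for h
    proof (cases "h \<in> ball 0 r")
      case True
      then have h: "norm h \<le> r" by simp
      have he: "\<bar>h \<bullet> e\<bar> \<le> r" using Cauchy_Schwarz_ineq2[of h e] e h by simp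
      have i1: "pt \<tau>1 + h \<in> \<Omega>" "pt \<tau>2 + h \<in> \<Omega>" using inB b12 h by (auto intro: order_trans)
      have a1: "\<bar>\<tau>1 + h \<bullet> e - m\<bar> \<le> \<rho>" "\<bar>\<tau>2 + h \<bullet> e - m\<bar> \<le> \<rho>" using he r by linarith+
      have \<Psi>: "\<Psi> (pt \<tau>1 + h) = \<Psi> (pt \<tau>2 + h)" unfolding p12 using inv[of "pt \<tau>2 + h" d] by (simp add: ac_simps)
      have "H (\<tau>1 + h \<bullet> e) - H (\<tau>2 + h \<bullet> e) = f ((pt \<tau>1 + h) \<bullet> e) - f ((pt \<tau>2 + h) \<bullet> e)"
        using fH[OF a1(1)] fH[OF a1(2)] by (simp add: inner_add_left pte)
      also have "\<dots> = (?U (pt \<tau>1 + h) - ?U (pt \<tau>2 + h)) - (Q (pt \<tau>1 + h) - Q (pt \<tau>2 + h))"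
        using eq[OF i1(1)] eq[OF i1(2)] \<Psi> by (simp add: Q_def)
      finally show ?thesis using True by (simp add: Qd)
    qed simp
    have iU: "integrable lborel (\<lambda>h. ?B r h * ?U (x + h))" for x by (rule integrable_energy[OF charge_ball ch])
    have iB: "integrable lborel (?B r)" by (rule charge_integrable[OF charge_ball])
    note iH = integrable_ball_fun[OF cH e]
    have il: "integrable lborel (\<lambda>h. ?B r h * l h)"
    proof -
      have "integrable lborel (\<lambda>h. ?B r h * ?U (pt \<tau>1 + h) - ?B r h * ?U (pt \<tau>2 + h) - (Q (pt \<tau>1) - Q (pt \<tau>2)) * ?B r h
          - (?B r h * H (\<tau>1 + h \<bullet> e) - ?B r h * H (\<tau>2 + h \<bullet> e)))"
        by (intro Bochner_Integration.integrable_diff integrable_mult_right iU iB iH)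
      then show ?thesis unfolding key by simp
    qed
    have mv: "(\<integral>h. ?B r h * ?U (pt \<tau> + h) \<partial>lborel) = ?W r * (?U (pt \<tau>) - 2 * pi * r\<^sup>2 / 5)" if "\<bar>\<tau> - m\<bar> \<le> \<rho>" for \<tau>
    proof (rule pot_mean_value_inside[OF bd meas r(1)])
      show "ball (pt \<tau>) r \<subseteq> \<Omega>"
      proof
        fix y assume "y \<in> ball (pt \<tau>) r"
        then have "norm (y - pt \<tau>) \<le> \<rho>" using b12 by (simp add: dist_norm norm_minus_commute)
        from inB[OF that this] show "y \<in> \<Omega>" by simp
      qed
    qed
    have "(\<integral>h. ?B r h * H (\<tau>1 + h \<bullet> e) \<partial>lborel) - (\<integral>h. ?B r h * H (\<tau>2 + h \<bullet> e) \<partial>lborel)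
        = (\<integral>h. ?B r h * H (\<tau>1 + h \<bullet> e) - ?B r h * H (\<tau>2 + h \<bullet> e) \<partial>lborel)"
      by (rule Bochner_Integration.integral_diff[OF iH iH, symmetric])
    also have "\<dots> = ?W r * (?U (pt \<tau>1) - 2 * pi * r\<^sup>2 / 5) - ?W r * (?U (pt \<tau>2) - 2 * pi * r\<^sup>2 / 5) - (Q (pt \<tau>1) - Q (pt \<tau>2)) * ?W r - 0"
      unfolding key using r(1) by (simp only: Bochner_Integration.integral_diff Bochner_Integration.integrable_diff iU iB il integrable_mult_right
          mv[OF b12(1)] mv[OF b12(2)] l0 integral_mult_right_zero integral_ball_const less_imp_le)
    also have "\<dots> = ?W r * (H \<tau>1 - H \<tau>2)"
    proof -
      have gen: "w * (y - q) - w * (y' - q) - (u - u') * w - 0 = w * ((y - u - z) - (y' - u' - z))" for w y y' q u u' z :: real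
        by (simp add: algebra_simps)
      show ?thesis unfolding H_def by (rule gen)
    qed
    finally show "(\<integral>h. ?B r h * H (\<tau>1 + h \<bullet> e) \<partial>lborel) - (\<integral>h. ?B r h * H (\<tau>2 + h \<bullet> e) \<partial>lborel) = ?W r * (H \<tau>1 - H \<tau>2)" .
  qed
  then obtain c0 c1 c2 where "\<And>\<tau>. \<tau> \<in> {m - \<rho>..m + \<rho>} \<Longrightarrow> H \<tau> = c0 + c1 * \<tau> + c2 * \<tau>\<^sup>2" by blast
  then have "f \<sigma> = c0 + c1 * \<sigma> + c2 * \<sigma>\<^sup>2" if "\<bar>\<sigma> - m\<bar> < \<rho>" for \<sigma>
    using fH[of \<sigma>] that by (simp add: abs_less_iff)
  then show ?thesis using \<rho>(1) unfolding m_def by blast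
qed

lemma separated_potential_has_row:
  fixes \<Omega> :: "(real^3) set" and e :: "real^3" and f :: "real \<Rightarrow> real" and \<Psi> :: "real^3 \<Rightarrow> real" and A :: "real^3^3"
  assumes op: "open \<Omega>" and bd: "bounded \<Omega>" and con: "connected \<Omega>" and e: "norm e = 1"
    and eq: "\<And>x. x \<in> \<Omega> \<Longrightarrow> pot (indicator \<Omega>) x = (x \<bullet> (A *v x) + b \<bullet> x + c) + f (x \<bullet> e) + \<Psi> x"
    and inv: "\<And>x t. \<Psi> (x + t *\<^sub>R e) = \<Psi> x"
  shows "\<exists>v \<delta>. \<forall>x t. x \<in> \<Omega> \<longrightarrow> x + t *\<^sub>R e \<in> \<Omega> \<longrightarrow>
     pot (indicator \<Omega>) (x + t *\<^sub>R e) - pot (indicator \<Omega>) x = - 4 * pi * (t * (v \<bullet> x + \<delta>) + t\<^sup>2 / 2 * (v \<bullet> e))"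
proof -
  have ee: "e \<bullet> e = 1" using e by (simp add: dot_square_norm)
  have "connected ((\<lambda>x. x \<bullet> e) ` \<Omega>)" by (intro connected_continuous_image con continuous_intros)
  then have "\<exists>c0 c1 c2. \<forall>\<tau>\<in>(\<lambda>x. x \<bullet> e) ` \<Omega>. f \<tau> = c0 + c1 * \<tau> + c2 * \<tau>\<^sup>2"
  proof (rule locally_quadratic_imp_quadratic)
    fix \<tau> assume "\<tau> \<in> (\<lambda>x. x \<bullet> e) ` \<Omega>"
    then obtain x0 where x0: "x0 \<in> \<Omega>" "\<tau> = x0 \<bullet> e" by auto
    then show "\<exists>\<rho>>0. \<exists>c0 c1 c2. \<forall>\<sigma>. \<bar>\<sigma> - \<tau>\<bar> < \<rho> \<longrightarrow> f \<sigma> = c0 + c1 * \<sigma> + c2 * \<sigma>\<^sup>2"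
      using separated_part_locally_quadratic[OF op bd e eq inv x0(1)] by simp
  qed
  then obtain c0 c1 c2 where f: "\<And>x. x \<in> \<Omega> \<Longrightarrow> f (x \<bullet> e) = c0 + c1 * (x \<bullet> e) + c2 * (x \<bullet> e)\<^sup>2" by auto
  \<comment> \<open>the gradient of the derivative in direction \<open>e\<close> of the quadratic part\<close>
  define u where "u = A *v e + e v* A + (2 * c2) *\<^sub>R e"
  show ?thesis
  proof (intro exI[of _ "(- 1 / (4 * pi)) *\<^sub>R u"] exI[of _ "- 1 / (4 * pi) * (b \<bullet> e + c1)"] allI impI)
    fix x t assume x: "x \<in> \<Omega>" "x + t *\<^sub>R e \<in> \<Omega>"
    have ux: "u \<bullet> x = x \<bullet> (A *v e) + e \<bullet> (A *v x) + 2 * c2 * (x \<bullet> e)" for x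
      by (simp only: u_def inner_add_left dot_lmul_matrix inner_scaleR_left inner_commute[of "A *v e"] inner_commute[of e x])
    have ue: "u \<bullet> e = 2 * (e \<bullet> (A *v e)) + 2 * c2"
      unfolding ux[of e] ee by simp
    have "pot (indicator \<Omega>) (x + t *\<^sub>R e) - pot (indicator \<Omega>) x = t * (u \<bullet> x + (b \<bullet> e + c1)) + t\<^sup>2 / 2 * (u \<bullet> e)"
      unfolding eq[OF x(1)] eq[OF x(2)] f[OF x(1)] f[OF x(2)] inv ux[of x] ue
      by (simp add: inner_simps matrix_vector_right_distrib matrix_vector_mult_scaleR ee power2_eq_square algebra_simps)
    moreover have "- 4 * pi * (t * ((- 1 / (4 * pi)) * y + - 1 / (4 * pi) * z) + w * ((- 1 / (4 * pi)) * q)) = t * (y + z) + w * q"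
      for y z w q :: real by (simp add: field_simps)
    ultimately show "pot (indicator \<Omega>) (x + t *\<^sub>R e) - pot (indicator \<Omega>) x
      = - 4 * pi * (t * (((- 1 / (4 * pi)) *\<^sub>R u) \<bullet> x + - 1 / (4 * pi) * (b \<bullet> e + c1)) + t\<^sup>2 / 2 * (((- 1 / (4 * pi)) *\<^sub>R u) \<bullet> e))"
      by (simp only: inner_scaleR_left)
  qed
qed

section \<open>The ellipsoid\<close>

text \<open>Three orthonormal vectors are the image of the coordinate axes under an orthogonal transformation, so they span the space.\<close>

lemma orthonormal_frame_map:
  assumes u: "orthonormal_frame u"
  obtains f where "orthogonal_transformation f" "\<And>i. f (axis i 1) = u i" "\<And>y i. f y \<bullet> u i = y $ i"
proof -
  define f :: "real^3 \<Rightarrow> real^3" where "f y = (\<Sum>i\<in>UNIV. y $ i *\<^sub>R u i)" for y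
  have lin: "linear f"
    by (rule linearI) (simp_all add: f_def scaleR_add_left sum.distrib scaleR_sum_right)
  have fu: "f y \<bullet> u i = y $ i" for y i
    using u by (simp add: f_def inner_sum_left orthonormal_frame_def)
  have "f y \<bullet> f z = y \<bullet> z" for y z
  proof -
    have "f y \<bullet> f z = (\<Sum>i\<in>UNIV. z $ i * (f y \<bullet> u i))" by (simp add: f_def[of z] inner_sum_right)
    also have "\<dots> = (\<Sum>i\<in>UNIV. z $ i * y $ i)" by (simp only: fu)
    finally show ?thesis by (simp add: inner_vec_def mult.commute)
  qed
  then have o: "orthogonal_transformation f" using lin by (simp add: orthogonal_transformation_def)
  have "f (axis i 1) = u i" for i
  proof -
    have "f (axis i 1) = (\<Sum>j\<in>UNIV. (if j = i then u j else 0))"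
      unfolding f_def by (rule sum.cong) (auto simp: axis_def)
    then show ?thesis by simp
  qed
  then show ?thesis using that o fu by blast
qed

lemma orthogonal_image_frame:
  fixes f :: "real^3 \<Rightarrow> real^3"
  assumes f: "orthogonal_transformation f"
  shows "orthonormal_frame (\<lambda>i. f (axis i 1))"
  by (simp add: orthonormal_frame_def inner_orthogonal_transformation[OF f] inner_axis_axis inner_real_def)

lemma frame_norm:
  assumes u: "orthonormal_frame u"
  shows "(norm x)\<^sup>2 = (\<Sum>i\<in>UNIV. (x \<bullet> u i)\<^sup>2)"
proof -
  obtain f where f: "orthogonal_transformation f" "\<And>i. f (axis i 1) = u i" "\<And>y i. f y \<bullet> u i = y $ i"
    using orthonormal_frame_map[OF u] by blast
  obtain y where y: "x = f y" using orthogonal_transformation_surj[OF f(1)] by (metis surjD)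
  show ?thesis unfolding y f(3) orthogonal_transformation_norm[OF f(1)]
    unfolding power2_norm_eq_inner by (simp add: inner_vec_def power2_eq_square)
qed

lemma spheroid_ellipsoid:
  assumes n: "norm n = 1" and \<kappa>: "\<kappa> \<ge> 0" and \<rho>: "\<rho> > 0"
  shows "ellipsoid {z. z - p \<in> spheroid n \<kappa> \<rho>}"
proof -
  have "norm (axis 3 1 :: real^3) = norm n" using n by simp
  from orthogonal_maps[OF this] obtain f where f: "orthogonal_transformation f" "f (axis 3 1 :: real^3) = n" by auto
  define u where "u i = f (axis i 1)" for i
  have u: "orthonormal_frame u" unfolding u_def[abs_def] by (rule orthogonal_image_frame[OF f(1)])
  define a where "a = (\<lambda>i::3. if i = 3 then \<rho> / sqrt (1 + \<kappa>) else \<rho>)"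
  have a: "a i > 0" for i using \<kappa> \<rho> by (simp add: a_def)
  have "sph_form n \<kappa> w w < \<rho>\<^sup>2 \<longleftrightarrow> (\<Sum>i\<in>UNIV. ((w \<bullet> u i) / a i)\<^sup>2) < 1" for w
  proof -
    have "sph_form n \<kappa> w w = (norm w)\<^sup>2 + \<kappa> * (w \<bullet> u 3)\<^sup>2"
      by (simp add: sph_form_def dot_square_norm u_def f(2) power2_eq_square inner_commute)
    also have "\<dots> = (w \<bullet> u 1)\<^sup>2 + (w \<bullet> u 2)\<^sup>2 + (1 + \<kappa>) * (w \<bullet> u 3)\<^sup>2"
      unfolding frame_norm[OF u] by (simp add: sum_3 algebra_simps)
    also have "\<dots> = \<rho>\<^sup>2 * (\<Sum>i\<in>UNIV. ((w \<bullet> u i) / a i)\<^sup>2)"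
      using \<kappa> \<rho> by (simp add: sum_3 a_def power_divide field_simps)
    finally show ?thesis using \<rho> by simp
  qed
  then have "{z. z - p \<in> spheroid n \<kappa> \<rho>} = {x. (\<Sum>i\<in>UNIV. (((x - p) \<bullet> u i) / a i)\<^sup>2) < 1}"
    by (simp add: spheroid_def)
  then show ?thesis unfolding ellipsoid_def using u a by blast
qed

lemma newtonian_potential_pot: "newtonian_potential D x = - (1 / (4 * pi)) * pot (indicator D) x"
  by (simp add: newtonian_potential_def pot_def set_lebesgue_integral_def)

theorem theorem3p1:
  fixes \<Omega> :: "(real ^ 3) set"
    and \<sigma> :: "real ^ 3 ^ 3"
    and C :: "real ^ 3 ^ 3 ^ 3 ^ 3"
    and lam \<mu> k1 k3 :: real
    and e :: "3 \<Rightarrow> real ^ 3"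
  assumes "\<Omega> \<noteq> {}" and "connected \<Omega>" and "bounded \<Omega>" and "open \<Omega>" and "convex \<Omega>"
    and "lipschitz_boundary \<Omega>"
    and "transpose \<sigma> = \<sigma>"
    and "k3 \<noteq> k1"
    and "orthonormal_frame e"
    and "\<sigma> *v e 1 = k1 *\<^sub>R e 1" and "\<sigma> *v e 2 = k1 *\<^sub>R e 2" and "\<sigma> *v e 3 = k3 *\<^sub>R e 3"
    and "isotropic_elastic_tensor lam \<mu> C"
    and uniformity:
      "\<exists>q1 q2 (\<phi>1 :: real \<Rightarrow> real) (\<phi>2 :: real \<Rightarrow> real \<Rightarrow> real).
         quadratic_function q1 \<and> quadratic_function q2 \<and>
         (\<forall>x\<in>\<Omega>.
            gamma_coeff lam \<mu> k1 k3 * newtonian_potential \<Omega> x + directional_potential (e 3) \<Omega> x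
              = q1 x + \<phi>1 (x \<bullet> e 3) \<and>
            eta_coeff lam \<mu> k1 k3 * newtonian_potential \<Omega> x + directional_potential (e 3) \<Omega> x
              = q2 x + \<phi>2 (x \<bullet> e 1) (x \<bullet> e 2))"
  shows "\<exists>E (\<phi> :: real \<Rightarrow> real \<Rightarrow> real).
           ellipsoid E \<and> E \<subseteq> \<Omega> \<and>
           (\<forall>x\<in>E. newtonian_potential \<Omega> x - newtonian_potential E x
                    = \<phi> (x \<bullet> e 1) (x \<bullet> e 2))"
proof -
  let ?U = "pot (indicator \<Omega>)"
  have fr: "e i \<bullet> e j = of_bool (i = j)" for i j using \<open>orthonormal_frame e\<close> by (simp add: orthonormal_frame_def)
  have e3: "norm (e 3) = 1" using fr[of 3 3] by (simp add: norm_eq_1)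
  have perp: "e 3 \<bullet> e 1 = 0" "e 3 \<bullet> e 2 = 0" using fr[of 3 1] fr[of 3 2] by simp_all
  have el: "\<mu> > 0" "3 * lam + 2 * \<mu> > 0" using \<open>isotropic_elastic_tensor lam \<mu> C\<close> by (auto simp: isotropic_elastic_tensor_def)
  have lm: "lam + \<mu> > 0" "lam + 2 * \<mu> > 0" using el by linarith+
  \<comment> \<open>the common second term cancels in the difference of the two relations\<close>
  define g where "g = gamma_coeff lam \<mu> k1 k3 - eta_coeff lam \<mu> k1 k3"
  have "g = - (2 * (lam + 2 * \<mu>)) / (lam + \<mu>)"
  proof -
    have "g = ((k1 - k3) * (- (2 * (lam + 2 * \<mu>)))) / ((k1 - k3) * (lam + \<mu>))"
      unfolding g_def gamma_coeff_def eta_coeff_def diff_divide_distrib[symmetric]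
      by (simp add: algebra_simps)
    then show ?thesis using \<open>k3 \<noteq> k1\<close> by simp
  qed
  then have g: "g \<noteq> 0" using lm by simp
  obtain q1 q2 \<phi>1 \<phi>2 where q: "quadratic_function q1" "quadratic_function q2"
    and uni: "\<And>x. x \<in> \<Omega> \<Longrightarrow> gamma_coeff lam \<mu> k1 k3 * newtonian_potential \<Omega> x + directional_potential (e 3) \<Omega> x = q1 x + \<phi>1 (x \<bullet> e 3)"
      "\<And>x. x \<in> \<Omega> \<Longrightarrow> eta_coeff lam \<mu> k1 k3 * newtonian_potential \<Omega> x + directional_potential (e 3) \<Omega> x = q2 x + \<phi>2 (x \<bullet> e 1) (x \<bullet> e 2)"
    using uniformity by blast
  obtain A1 b1 c1 where q1: "\<And>x. q1 x = x \<bullet> (A1 *v x) + b1 \<bullet> x + c1" using q(1) unfolding quadratic_function_def by blast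
  obtain A2 b2 c2 where q2: "\<And>x. q2 x = x \<bullet> (A2 *v x) + b2 \<bullet> x + c2" using q(2) unfolding quadratic_function_def by blast
  define k where "k = - (4 * pi) / g"
  have split: "?U x = (x \<bullet> ((k *\<^sub>R (A1 - A2)) *v x) + (k *\<^sub>R (b1 - b2)) \<bullet> x + k * (c1 - c2))
      + k * \<phi>1 (x \<bullet> e 3) + - k * \<phi>2 (x \<bullet> e 1) (x \<bullet> e 2)" if x: "x \<in> \<Omega>" for x
  proof -
    have "g * newtonian_potential \<Omega> x = q1 x - q2 x + \<phi>1 (x \<bullet> e 3) - \<phi>2 (x \<bullet> e 1) (x \<bullet> e 2)"
      using uni[OF x] by (simp add: g_def algebra_simps)
    moreover have "?U x = k * (g * newtonian_potential \<Omega> x)"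
      using g by (simp add: newtonian_potential_pot k_def)
    ultimately have Ueq: "?U x = k * (q1 x - q2 x + \<phi>1 (x \<bullet> e 3) - \<phi>2 (x \<bullet> e 1) (x \<bullet> e 2))" by simp
    have mv: "(k *\<^sub>R (A1 - A2)) *v x = k *\<^sub>R (A1 *v x - A2 *v x)"
      by (simp add: matrix_vector_mult_diff_rdistrib flip: scaleR_matrix_vector_assoc)
    show ?thesis unfolding Ueq q1 q2 mv by (simp add: inner_simps algebra_simps)
  qed
  have "- k * \<phi>2 ((x + t *\<^sub>R e 3) \<bullet> e 1) ((x + t *\<^sub>R e 3) \<bullet> e 2) = - k * \<phi>2 (x \<bullet> e 1) (x \<bullet> e 2)" for x t
    by (simp add: inner_simps perp)
  from separated_potential_has_row[where f="\<lambda>\<tau>. k * \<phi>1 \<tau>" and \<Psi>="\<lambda>x. - k * \<phi>2 (x \<bullet> e 1) (x \<bullet> e 2)",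
      OF \<open>open \<Omega>\<close> \<open>bounded \<Omega>\<close> \<open>connected \<Omega>\<close> e3 split this]
  obtain v \<delta> where row: "\<And>x t. x \<in> \<Omega> \<Longrightarrow> x + t *\<^sub>R e 3 \<in> \<Omega> \<Longrightarrow>
     ?U (x + t *\<^sub>R e 3) - ?U x = - 4 * pi * (t * (v \<bullet> x + \<delta>) + t\<^sup>2 / 2 * (v \<bullet> e 3))" by blast
  obtain x0 where "x0 \<in> \<Omega>" using \<open>\<Omega> \<noteq> {}\<close> by blast
  then obtain \<rho>0 where \<rho>0: "\<rho>0 > 0" "ball x0 \<rho>0 \<subseteq> \<Omega>" using \<open>open \<Omega>\<close> open_contains_ball by metis
  interpret row_body \<Omega> "e 3" v x0 \<delta> \<rho>0
    by unfold_locales (fact \<open>open \<Omega>\<close> \<open>bounded \<Omega>\<close> \<open>convex \<Omega>\<close> e3 \<rho>0 row)+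
  obtain p where p: "p \<in> \<Omega>" "v \<bullet> p + \<delta> = 0" using row_zero by blast
  obtain n \<kappa> where n: "norm n = 1" "\<kappa> \<ge> 0"
    and sph: "\<And>\<rho> x h. \<rho> > 0 \<Longrightarrow> x \<in> spheroid n \<kappa> \<rho> \<Longrightarrow> x + h *\<^sub>R e 3 \<in> spheroid n \<kappa> \<rho> \<Longrightarrow>
       pot (indicator (spheroid n \<kappa> \<rho>)) (x + h *\<^sub>R e 3) - pot (indicator (spheroid n \<kappa> \<rho>)) x
         = - 4 * pi * (h * (v \<bullet> x) + h\<^sup>2 / 2 * (v \<bullet> e 3))"
    using exists_spheroid_with_row[OF e3 row_strict] by blast
  obtain \<rho> where \<rho>: "\<rho> > 0" "ball p \<rho> \<subseteq> \<Omega>" using \<open>open \<Omega>\<close> p(1) open_contains_ball by metis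
  \<comment> \<open>centred at the zero of \<open>v \<bullet> x + \<delta>\<close>, so that both potentials have the same derivative in direction \<open>e 3\<close>\<close>
  define E where "E = {z. z - p \<in> spheroid n \<kappa> \<rho>}"
  have ell: "ellipsoid E" unfolding E_def by (rule spheroid_ellipsoid[OF n \<rho>(1)])
  have EO: "E \<subseteq> \<Omega>"
  proof
    fix z assume "z \<in> E"
    then have "z - p \<in> ball 0 \<rho>" using spheroid_subset[OF n(2), of \<rho> n] \<rho>(1) by (auto simp: E_def)
    then have "z \<in> ball p \<rho>" by (simp add: dist_norm norm_minus_commute)
    then show "z \<in> \<Omega>" using \<rho> by blast
  qed
  have potE: "pot (indicator E) x = pot (indicator (spheroid n \<kappa> \<rho>)) (- p + x)" for x
  proof -
    have "indicator E = (\<lambda>y. indicator (spheroid n \<kappa> \<rho>) (- p + y) :: real)"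
      by (auto simp: fun_eq_iff E_def indicator_def)
    then show ?thesis
      using pot_translate[OF charge_spheroid[OF n(2) less_imp_le[OF \<rho>(1)]], of n "- p" x] by simp
  qed
  define D where "D x = newtonian_potential \<Omega> x - newtonian_potential E x" for x
  have shift: "D (x + t *\<^sub>R e 3) = D x" if x: "x \<in> E" "x + t *\<^sub>R e 3 \<in> E" for x t
  proof -
    have "?U (x + t *\<^sub>R e 3) - ?U x = - 4 * pi * (t * (v \<bullet> x + \<delta>) + t\<^sup>2 / 2 * (v \<bullet> e 3))"
      using row x EO by blast
    moreover have "pot (indicator E) (x + t *\<^sub>R e 3) - pot (indicator E) x = - 4 * pi * (t * (v \<bullet> (- p + x)) + t\<^sup>2 / 2 * (v \<bullet> e 3))"
      unfolding potE using sph[OF \<rho>(1), of "- p + x" t] x by (simp add: E_def algebra_simps)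
    moreover have "v \<bullet> (- p + x) = v \<bullet> x + \<delta>" using p(2) by (simp add: inner_simps)
    ultimately have "?U (x + t *\<^sub>R e 3) - ?U x = pot (indicator E) (x + t *\<^sub>R e 3) - pot (indicator E) x" by (simp only:)
    then have "?U (x + t *\<^sub>R e 3) - pot (indicator E) (x + t *\<^sub>R e 3) = ?U x - pot (indicator E) x" by linarith
    then show ?thesis unfolding D_def newtonian_potential_pot right_diff_distrib[symmetric] by (simp only:)
  qed
  have same: "D y = D x" if x: "x \<in> E" "y \<in> E" and c: "y \<bullet> e 1 = x \<bullet> e 1" "y \<bullet> e 2 = x \<bullet> e 2" for x y
  proof -
    define t where "t = (y - x) \<bullet> e 3"
    have "(norm (y - x - t *\<^sub>R e 3))\<^sup>2 = 0"
      unfolding frame_norm[OF \<open>orthonormal_frame e\<close>] sum_3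
      using c fr[of 3 3] by (simp add: inner_simps perp t_def)
    then have "y = x + t *\<^sub>R e 3" by (simp add: algebra_simps)
    then show ?thesis using shift x by simp
  qed
  \<comment> \<open>the value at any point of \<open>E\<close> over \<open>(a, b)\<close>\<close>
  define \<phi> where "\<phi> a b = D (SOME y. y \<in> E \<and> y \<bullet> e 1 = a \<and> y \<bullet> e 2 = b)" for a b
  have "D x = \<phi> (x \<bullet> e 1) (x \<bullet> e 2)" if x: "x \<in> E" for x
  proof -
    define y where "y = (SOME y. y \<in> E \<and> y \<bullet> e 1 = x \<bullet> e 1 \<and> y \<bullet> e 2 = x \<bullet> e 2)"
    have "y \<in> E \<and> y \<bullet> e 1 = x \<bullet> e 1 \<and> y \<bullet> e 2 = x \<bullet> e 2"
      unfolding y_def by (rule someI[of _ x]) (use x in simp)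
    then have "D y = D x" using same x by blast
    then show ?thesis by (simp add: \<phi>_def y_def)
  qed
  then show ?thesis using ell EO unfolding D_def by blast
qed

end
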